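(* Let $E$ be a finite gap set with $g\ge 1$ gaps, let $\Delta_E=\Psi+1/\Psi$ where $\Psi$ is the Ahlfors function of $\overline{\mathbb C}\setminus E$, and let $\mathbf C=(\mathbf c_1,\dots,\mathbf c_g)$ be a fixed ordering of the finite zeros of $\Psi$ (equivalently, of the finite poles of $\Delta_E$). Let $A\in\mathrm{GMP}(\mathbf C)$. Then $$A\in A(E,\mathbf C)\iff\Delta_E(A)=S^{g+1}+S^{-(g+1)}.$$
   Context: **Finite gap set and $\Delta_E$.** $E=[\mathbf b_0,\mathbf a_0]\setminus\bigcup_{j=1}^g(\mathbf a_j,\mathbf b_j)$ with $\mathbf b_0<\mathbf a_1<\mathbf b_1<\dots<\mathbf a_g<\mathbf b_g<\mathbf a_0$ real. The Ahlfors function $\Psi$ of $\overline{\mathbb C}\setminus E$ is the analytic function on $\overline{\mathbb C}\setminus E$ maximizing $|\lim_{z\to\infty}z\Psi(z)|$ among analytic functions vanishing at $\infty$ and bounded by one in modulus, normalized by $\lim_{z\to\infty}z\Psi(z)>0$. Then $\Delta_E=\Psi+1/\Psi$ is a rational function of the form $\Delta_E(z)=\lambda_0z+\mathbf c_0+\sum_{j=1}^g\frac{\lambda_j}{\mathbf c_j-z}$ with all $\lambda_j>0$, exactly one of the points $\mathbf c_1,\dots,\mathbf c_g$ lying in each gap, and $E=\Delta_E^{-1}([-2,2])$. For an operator $A$ with all $\mathbf c_j-A$ invertible, $\Delta_E(A)=\lambda_0A+\mathbf c_0I+\sum_{j=1}^g\lambda_j(\mathbf c_j-A)^{-1}$.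 **GMP matrices.** $S$ is the right shift on $\ell^2(\mathbb Z)$, $Se_n=e_{n+1}$. Vectors in $\mathbb R^{g+1}$ are indexed by $0,\dots,g$; $\delta_g$ is the last standard basis vector. For a matrix $T$, $T^-$ is its upper triangular part excluding the main diagonal and $T^+=T-T^-$. For an ordered collection $\mathbf C=(\mathbf c_1,\dots,\mathbf c_g)$ of distinct real points, a bounded operator $A$ on $\ell^2(\mathbb Z)$ is of the class $\mathbb A$ (with respect to $\mathbf C$) if it is a $(g+1)$-block Jacobi matrix (block number $j$ consists of the indices $(g+1)j,\dots,(g+1)j+g$) whose $j$-th block row has the entries $A(\vec p_j)^*$, $B(\vec p_j,\vec q_j)$, $A(\vec p_{j+1})$ in block columns $j-1,j,j+1$ and zeros elsewhere, where $\vec p_j,\vec q_j\in\mathbb R^{g+1}$, the last entry of each $\vec p_j$ is positive, and $$A(\vec p)=\delta_g\vec p^{\,*},\qquad B(\vec p,\vec q)=(\vec q\,\vec p^{\,*})^-+(\vec p\,\vec q^{\,*})^++\operatorname{diag}(\mathbf c_1,\dots,\mathbf c_g,0).$$ The $(\vec p_j,\vec q_j)$ are the generating coefficients. $A\in\mathrm{GMP}(\mathbf C)$ if $A$ is of the class $\mathbb A$ with respect to $\mathbf C$, all $\mathbf c_k-A$ ($1\le k\le g$) are invertible, and for each $1\le k\le g$ the operator $S^{-k}(\mathbf c_k-A)^{-1}S^k$ is also of the class $\mathbb A$, with respect to the collection $\big(\tfrac1{\mathbf c_k-\mathbf c_{k+1}},\dots,\tfrac1{\mathbf c_k-\mathbf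 c_g},0,\tfrac1{\mathbf c_k-\mathbf c_1},\dots,\tfrac1{\mathbf c_k-\mathbf c_{k-1}}\big)$. A GMP matrix is periodic if $(\vec p_j,\vec q_j)=(\vec p,\vec q)$ for all $j\in\mathbb Z$. Finally $$A(E,\mathbf C)=\{A\in\mathrm{GMP}(\mathbf C):\ \sigma(A)=E,\ A\text{ periodic}\}.$$ *)

theory Defs
  imports "HOL-Complex_Analysis.Complex_Analysis"
begin

section \<open>The complex Hilbert space of square-summable bilateral sequences\<close>

definition square_summable :: "(int \<Rightarrow> complex) \<Rightarrow> bool" where
  "square_summable x \<longleftrightarrow> (\<lambda>n. (cmod (x n))\<^sup>2) summable_on UNIV"

lemma square_summable_0: "square_summable (\<lambda>_. 0)"
  by (simp add: square_summable_def)

lemma square_summable_add: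
  assumes "square_summable x" "square_summable y"
  shows "square_summable (\<lambda>n. x n + y n)"
proof -
  have "(\<lambda>n. 2 * (cmod (x n))\<^sup>2 + 2 * (cmod (y n))\<^sup>2) summable_on UNIV"
    using assms unfolding square_summable_def
    by (intro summable_on_add summable_on_cmult_right)
  moreover have "(cmod (x n + y n))\<^sup>2 \<le> 2 * (cmod (x n))\<^sup>2 + 2 * (cmod (y n))\<^sup>2" for n
  proof -
    have "(cmod (x n + y n))\<^sup>2 \<le> (cmod (x n) + cmod (y n))\<^sup>2"
      by (intro power_mono norm_triangle_ineq) auto
    also have "\<dots> \<le> 2 * (cmod (x n))\<^sup>2 + 2 * (cmod (y n))\<^sup>2"
      using zero_le_power2[of "cmod (x n) - cmod (y n)"]
      by (simp add: power2_eq_square algebra_simps)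
    finally show ?thesis .
  qed
  ultimately show ?thesis
    unfolding square_summable_def by (rule summable_on_comparison_test) auto
qed

lemma square_summable_mult:
  assumes "square_summable x"
  shows "square_summable (\<lambda>n. c * x n)"
  using assms unfolding square_summable_def
  by (simp add: norm_mult power_mult_distrib summable_on_cmult_right)

lemma square_summable_translate:
  assumes "square_summable x"
  shows "square_summable (\<lambda>n. x (n + k))"
proof -
  have "bij (\<lambda>n::int. n + k)"
    by (rule bij_betw_byWitness[where f' = "\<lambda>n. n - k"]) auto
  from summable_on_reindex_bij_betw[OF this, of "\<lambda>n. (cmod (x n))\<^sup>2"]
  show ?thesis using assms by (simp add: square_summable_def)
qed

lemma square_summable_single: "square_summable (\<lambda>m. if m = n then 1 else 0)"
proof -
  have "(\<lambda>m. (cmod (if m = n then 1 else 0))\<^sup>2) summable_on {n}"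
    by simp
  also have "?this \<longleftrightarrow> (\<lambda>m. (cmod (if m = n then 1 else 0))\<^sup>2) summable_on UNIV"
    by (rule summable_on_cong_neutral) auto
  finally show ?thesis
    by (simp add: square_summable_def)
qed

lemma square_summable_inner:
  assumes "square_summable x" "square_summable y"
  shows "(\<lambda>n. inner (x n) (y n)) summable_on UNIV"
proof -
  have "(\<lambda>n. (cmod (x n))\<^sup>2 + (cmod (y n))\<^sup>2) summable_on UNIV"
    using assms unfolding square_summable_def by (intro summable_on_add)
  moreover have "norm (inner (x n) (y n)) \<le> (cmod (x n))\<^sup>2 + (cmod (y n))\<^sup>2" for n
  proof -
    have "norm (inner (x n) (y n)) \<le> cmod (x n) * cmod (y n)"
      using Cauchy_Schwarz_ineq2[of "x n" "y n"] by simp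
    also have "\<dots> \<le> (cmod (x n))\<^sup>2 + (cmod (y n))\<^sup>2"
      using zero_le_power2[of "cmod (x n) - cmod (y n)"] 
        mult_nonneg_nonneg[of "cmod (x n)" "cmod (y n)", OF norm_ge_zero norm_ge_zero]
      unfolding power2_diff by linarith
    finally show ?thesis .
  qed
  ultimately have "(\<lambda>n. norm (inner (x n) (y n))) summable_on UNIV"
    by (rule summable_on_comparison_test) auto
  then show ?thesis
    by (rule abs_summable_summable)
qed

typedef l2Z = "{x. square_summable x}"
  morphisms coord Abs_l2Z
  using square_summable_0 by blast

setup_lifting type_definition_l2Z

lemma l2Z_eqI: "(\<And>n. coord x n = coord y n) \<Longrightarrow> x = y"
  by (simp add: coord_inject[symmetric] fun_eq_iff)

lift_definition scaleC_l2Z :: "complex \<Rightarrow> l2Z \<Rightarrow> l2Z" (infixr "*\<^sub>C" 75)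
  is "\<lambda>c x n. c * x n"
  by (rule square_summable_mult)

lift_definition unit_vec :: "int \<Rightarrow> l2Z" is "\<lambda>n m. if m = n then 1 else 0"
  by (rule square_summable_single)

instantiation l2Z :: real_vector
begin

lift_definition zero_l2Z :: l2Z is "\<lambda>_. 0"
  by (rule square_summable_0)

lift_definition plus_l2Z :: "l2Z \<Rightarrow> l2Z \<Rightarrow> l2Z" is "\<lambda>x y n. x n + y n"
  by (rule square_summable_add)

lift_definition uminus_l2Z :: "l2Z \<Rightarrow> l2Z" is "\<lambda>x n. - x n"
  using square_summable_mult[of _ "-1"] by simp

lift_definition minus_l2Z :: "l2Z \<Rightarrow> l2Z \<Rightarrow> l2Z" is "\<lambda>x y n. x n - y n"
  using square_summable_add[OF _ square_summable_mult[of _ "-1"]] by simp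

lift_definition scaleR_l2Z :: "real \<Rightarrow> l2Z \<Rightarrow> l2Z" is "\<lambda>r x n. of_real r * x n"
  by (rule square_summable_mult)

instance
proof
  fix x y z :: l2Z and r s :: real
  show "x + y + z = x + (y + z)" by transfer (simp add: add.assoc)
  show "x + y = y + x" by transfer (simp add: add.commute)
  show "0 + x = x" by transfer simp
  show "- x + x = 0" by transfer simp
  show "x - y = x + - y" by transfer simp
  show "r *\<^sub>R (x + y) = r *\<^sub>R x + r *\<^sub>R y" by transfer (simp add: algebra_simps)
  show "(r + s) *\<^sub>R x = r *\<^sub>R x + s *\<^sub>R x" by transfer (simp add: algebra_simps)
  show "r *\<^sub>R s *\<^sub>R x = (r * s) *\<^sub>R x" by transfer (simp add: algebra_simps)
  show "1 *\<^sub>R x = x" by transfer simp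
qed

end

text \<open>The real inner product below is the real part of the usual complex one, so the norm is
  the usual norm of the complex Hilbert space.\<close>

instantiation l2Z :: real_inner
begin

definition inner_l2Z :: "l2Z \<Rightarrow> l2Z \<Rightarrow> real" where
  "inner_l2Z x y = (\<Sum>\<^sub>\<infinity>n. inner (coord x n) (coord y n))"

definition norm_l2Z :: "l2Z \<Rightarrow> real" where
  "norm_l2Z x = sqrt (\<Sum>\<^sub>\<infinity>n. (cmod (coord x n))\<^sup>2)"

definition dist_l2Z :: "l2Z \<Rightarrow> l2Z \<Rightarrow> real" where
  "dist_l2Z x y = norm (x - y)"

definition sgn_l2Z :: "l2Z \<Rightarrow> l2Z" where
  "sgn_l2Z x = x /\<^sub>R norm x"

definition uniformity_l2Z :: "(l2Z \<times> l2Z) filter" where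
  "uniformity_l2Z = (INF e\<in>{0<..}. principal {(x, y). dist x y < e})"

definition open_l2Z :: "l2Z set \<Rightarrow> bool" where
  "open_l2Z U \<longleftrightarrow> (\<forall>x\<in>U. eventually (\<lambda>(x', y). x' = x \<longrightarrow> y \<in> U) uniformity)"

instance
proof
  fix x y z :: l2Z and r :: real and U :: "l2Z set"
  note sq = coord[unfolded mem_Collect_eq]
  note summ = square_summable_inner[OF sq sq]
  show "sgn x = x /\<^sub>R norm x" by (rule sgn_l2Z_def)
  show "dist x y = norm (x - y)" by (rule dist_l2Z_def)
  show "uniformity = (INF e\<in>{0<..}. principal {(x::l2Z, y). dist x y < e})"
    by (rule uniformity_l2Z_def)
  show "open U \<longleftrightarrow> (\<forall>x\<in>U. \<forall>\<^sub>F (x', y) in uniformity. x' = x \<longrightarrow> y \<in> U)"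
    by (rule open_l2Z_def)
  show "inner x y = inner y x"
    by (simp add: inner_l2Z_def inner_commute)
  show "inner (x + y) z = inner x z + inner y z"
    by (simp add: inner_l2Z_def plus_l2Z.rep_eq inner_add_left infsum_add[OF summ summ])
  show "inner (r *\<^sub>R x) y = r * inner x y"
  proof -
    have "inner (coord (r *\<^sub>R x) n) (coord y n) = r * inner (coord x n) (coord y n)" for n
      by (simp only: scaleR_l2Z.rep_eq scaleR_conv_of_real[symmetric] inner_scaleR_left)
    then show ?thesis
      by (simp only: inner_l2Z_def infsum_cmult_right')
  qed
  show "0 \<le> inner x x"
    by (simp add: inner_l2Z_def infsum_nonneg)
  show "inner x x = 0 \<longleftrightarrow> x = 0"
  proof
    assume "inner x x = 0"
    then have "inner (coord x n) (coord x n) = 0" for n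
      using nonneg_infsum_le_0D[OF _ summ, of x x n] by (simp add: inner_l2Z_def)
    then show "x = 0"
      by (intro l2Z_eqI) (simp add: zero_l2Z.rep_eq)
  next
    assume "x = 0"
    then show "inner x x = 0"
      by (simp add: inner_l2Z_def zero_l2Z.rep_eq)
  qed
  show "norm x = sqrt (inner x x)"
    by (simp add: norm_l2Z_def inner_l2Z_def dot_square_norm)
qed

end

section \<open>Operators\<close>

definition bounded_clinear :: "(l2Z \<Rightarrow> l2Z) \<Rightarrow> bool" where
  "bounded_clinear A \<longleftrightarrow> bounded_linear A \<and> (\<forall>c x. A (c *\<^sub>C x) = c *\<^sub>C A x)"

definition invertible_op :: "(l2Z \<Rightarrow> l2Z) \<Rightarrow> bool" where
  "invertible_op A \<longleftrightarrow>
     bounded_clinear A \<and> (\<exists>B. bounded_clinear B \<and> A \<circ> B = id \<and> B \<circ> A = id)"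

definition shifted_op :: "complex \<Rightarrow> (l2Z \<Rightarrow> l2Z) \<Rightarrow> l2Z \<Rightarrow> l2Z" where
  "shifted_op z A = (\<lambda>x. z *\<^sub>C x - A x)"

definition op_spectrum :: "(l2Z \<Rightarrow> l2Z) \<Rightarrow> complex set" where
  "op_spectrum A = {z. \<not> invertible_op (shifted_op z A)}"

definition resolvent :: "real \<Rightarrow> (l2Z \<Rightarrow> l2Z) \<Rightarrow> l2Z \<Rightarrow> l2Z" where
  "resolvent c A = inv (shifted_op (of_real c) A)"

definition entry :: "(l2Z \<Rightarrow> l2Z) \<Rightarrow> int \<Rightarrow> int \<Rightarrow> complex" where
  "entry A m n = coord (A (unit_vec n)) m"

lift_definition rshift :: "l2Z \<Rightarrow> l2Z" is "\<lambda>x n. x (n - 1)"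
  using square_summable_translate[of _ "-1"] by simp

lemma rshift_unit_vec: "rshift (unit_vec n) = unit_vec (n + 1)"
  by transfer auto

lemma bij_rshift: "bij rshift"
proof (rule bijI)
  show "inj rshift"
  proof (rule injI)
    fix x y assume eq: "rshift x = rshift y"
    have "coord x n = coord y n" for n
      using arg_cong[OF eq, of "\<lambda>z. coord z (n + 1)"] by (simp add: rshift.rep_eq)
    then show "x = y" by (rule l2Z_eqI)
  qed
  have "rshift (Abs_l2Z (\<lambda>n. coord y (n + 1))) = y" for y
  proof -
    have "square_summable (\<lambda>n. coord y (n + 1))"
      using coord[of y] by (intro square_summable_translate) simp
    then show ?thesis
      by (intro l2Z_eqI) (simp add: rshift.rep_eq Abs_l2Z_inverse)
  qed
  then show "surj rshift" by (rule surjI)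
qed

section \<open>Finite gap sets and the Ahlfors function\<close>

definition finite_gap_set :: "nat \<Rightarrow> real set \<Rightarrow> bool" where
  "finite_gap_set g E \<longleftrightarrow> (\<exists>a b :: nat \<Rightarrow> real.
     (\<forall>j<g. b j < a (Suc j) \<and> a (Suc j) < b (Suc j)) \<and> b g < a 0 \<and>
     E = {b 0..a 0} - (\<Union>j\<in>{1..g}. {a j<..<b j}))"

text \<open>A function analytic on the complement of \<open>E\<close> in the Riemann sphere that vanishes at infinity
  is a function holomorphic on the complement in the plane that tends to 0 at infinity. Its values
  on \<open>E\<close> play no role.\<close>

definition ahlfors_admissible :: "real set \<Rightarrow> (complex \<Rightarrow> complex) \<Rightarrow> bool" where
  "ahlfors_admissible E f \<longleftrightarrow>
     f holomorphic_on - of_real ` E \<and> (f \<longlongrightarrow> 0) at_infinity \<and>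
     (\<forall>z\<in>- of_real ` E. cmod (f z) \<le> 1)"

definition ahlfors_function :: "real set \<Rightarrow> (complex \<Rightarrow> complex) \<Rightarrow> bool" where
  "ahlfors_function E \<Psi> \<longleftrightarrow> ahlfors_admissible E \<Psi> \<and>
     (\<exists>L::real. L > 0 \<and> ((\<lambda>z. z * \<Psi> z) \<longlongrightarrow> of_real L) at_infinity \<and>
        (\<forall>f M. ahlfors_admissible E f \<longrightarrow> ((\<lambda>z. z * f z) \<longlongrightarrow> M) at_infinity \<longrightarrow> cmod M \<le> L))"

definition finite_zeros :: "real set \<Rightarrow> (complex \<Rightarrow> complex) \<Rightarrow> complex set" where
  "finite_zeros E \<Psi> = {z. z \<notin> of_real ` E \<and> \<Psi> z = 0}"

definition Delta :: "(complex \<Rightarrow> complex) \<Rightarrow> complex \<Rightarrow> complex" where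
  "Delta \<Psi> z = \<Psi> z + 1 / \<Psi> z"

text \<open>The coefficients \<open>(\<lambda>\<^sub>0, c\<^sub>0, [\<lambda>\<^sub>1, \<dots>, \<lambda>\<^sub>g])\<close> in
  \<open>Delta \<Psi> z = \<lambda>\<^sub>0 z + c\<^sub>0 + (\<Sum>j. \<lambda>\<^sub>j / (c\<^sub>j - z))\<close>, where \<open>C = [c\<^sub>1, \<dots>, c\<^sub>g]\<close> lists the
  finite zeros of \<open>\<Psi>\<close>. The zeros are excluded from the range of \<open>z\<close>, since there
  \<open>Delta \<Psi>\<close> has poles and its value as a total function is meaningless.\<close>

definition is_Delta_expansion ::
    "real set \<Rightarrow> (complex \<Rightarrow> complex) \<Rightarrow> real list \<Rightarrow> real \<times> real \<times> real list \<Rightarrow> bool" where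
  "is_Delta_expansion E \<Psi> C = (\<lambda>(l0, c0, l). length l = length C \<and>
     (\<forall>z. z \<notin> of_real ` E \<longrightarrow> z \<notin> finite_zeros E \<Psi> \<longrightarrow>
        Delta \<Psi> z = of_real l0 * z + of_real c0
          + (\<Sum>j<length C. of_real (l ! j) / (of_real (C ! j) - z))))"

definition Delta_coeffs ::
    "real set \<Rightarrow> (complex \<Rightarrow> complex) \<Rightarrow> real list \<Rightarrow> real \<times> real \<times> real list" where
  "Delta_coeffs E \<Psi> C = (THE cs. is_Delta_expansion E \<Psi> C cs)"

definition Delta_op ::
    "real set \<Rightarrow> (complex \<Rightarrow> complex) \<Rightarrow> real list \<Rightarrow> (l2Z \<Rightarrow> l2Z) \<Rightarrow> l2Z \<Rightarrow> l2Z" where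
  "Delta_op E \<Psi> C A = (case Delta_coeffs E \<Psi> C of (l0, c0, l) \<Rightarrow>
     (\<lambda>x. l0 *\<^sub>R A x + c0 *\<^sub>R x + (\<Sum>j<length C. (l ! j) *\<^sub>R resolvent (C ! j) A x)))"

section \<open>GMP matrices\<close>

text \<open>Blocks are functions of a row and a column index in \<open>{0..g}\<close>, and vectors functions of an
  index in \<open>{0..g}\<close>; values at larger indices are never used. An ordered collection
  \<open>c\<^sub>1, \<dots>, c\<^sub>g\<close> is the list \<open>C\<close> of length \<open>g\<close>, so that \<open>c\<^sub>k\<close> is \<open>C ! (k - 1)\<close>.\<close>

type_synonym rvec = "nat \<Rightarrow> real"
type_synonym rmat = "nat \<Rightarrow> nat \<Rightarrow> real"

definition outer :: "rvec \<Rightarrow> rvec \<Rightarrow> rmat" where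
  "outer u v = (\<lambda>i l. u i * v l)"

definition strict_upper :: "rmat \<Rightarrow> rmat" where
  "strict_upper T = (\<lambda>i l. if i < l then T i l else 0)"

definition lower :: "rmat \<Rightarrow> rmat" where
  "lower T = (\<lambda>i l. T i l - strict_upper T i l)"

definition block_A :: "nat \<Rightarrow> rvec \<Rightarrow> rmat" where
  "block_A g p = outer (\<lambda>i. if i = g then 1 else 0) p"

definition block_B :: "real list \<Rightarrow> rvec \<Rightarrow> rvec \<Rightarrow> rmat" where
  "block_B C p q = (\<lambda>i l. strict_upper (outer q p) i l + lower (outer p q) i l
     + (if i = l then (C @ [0]) ! i else 0))"

text \<open>The pair \<open>(i, l)\<close> is the position inside block row \<open>j\<close> and block column \<open>k\<close>;
  the transposed block is used for \<open>k = j - 1\<close>.\<close>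

definition block_entry ::
    "real list \<Rightarrow> (int \<Rightarrow> rvec) \<Rightarrow> (int \<Rightarrow> rvec) \<Rightarrow> int \<Rightarrow> int \<Rightarrow> nat \<Rightarrow> nat \<Rightarrow> real" where
  "block_entry C p q j k i l =
     (let g = length C in
      if k = j - 1 then block_A g (p j) l i
      else if k = j then block_B C (p j) (q j) i l
      else if k = j + 1 then block_A g (p (j + 1)) i l
      else 0)"

definition generating_coeffs ::
    "real list \<Rightarrow> (l2Z \<Rightarrow> l2Z) \<Rightarrow> (int \<Rightarrow> rvec) \<Rightarrow> (int \<Rightarrow> rvec) \<Rightarrow> bool" where
  "generating_coeffs C A p q \<longleftrightarrow>
     (let g = length C in
      (\<forall>j. p j g > 0) \<and>
      (\<forall>j k. \<forall>i\<le>g. \<forall>l\<le>g.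
         entry A (int (g + 1) * j + int i) (int (g + 1) * k + int l)
           = of_real (block_entry C p q j k i l)))"

definition class_A :: "real list \<Rightarrow> (l2Z \<Rightarrow> l2Z) set" where
  "class_A C = {A. bounded_clinear A \<and> (\<exists>p q. generating_coeffs C A p q)}"

definition resolvent_collection :: "real list \<Rightarrow> nat \<Rightarrow> real list" where
  "resolvent_collection C k =
     (let ck = C ! (k - 1) in
      map (\<lambda>c. 1 / (ck - c)) (drop k C) @ [0] @ map (\<lambda>c. 1 / (ck - c)) (take (k - 1) C))"

definition GMP :: "real list \<Rightarrow> (l2Z \<Rightarrow> l2Z) set" where
  "GMP C = {A \<in> class_A C. \<forall>k\<in>{1..length C}.
     invertible_op (shifted_op (of_real (C ! (k - 1))) A) \<and>
     (inv rshift ^^ k) \<circ> resolvent (C ! (k - 1)) A \<circ> (rshift ^^ k)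
       \<in> class_A (resolvent_collection C k)}"

definition periodic_GMP :: "real list \<Rightarrow> (l2Z \<Rightarrow> l2Z) \<Rightarrow> bool" where
  "periodic_GMP C A \<longleftrightarrow> (\<exists>p q. generating_coeffs C A (\<lambda>_. p) (\<lambda>_. q))"

definition isospectral_GMP :: "real set \<Rightarrow> real list \<Rightarrow> (l2Z \<Rightarrow> l2Z) set" where
  "isospectral_GMP E C = {A \<in> GMP C. op_spectrum A = of_real ` E \<and> periodic_GMP C A}"

end

theory Submission
  imports Defs
begin

text \<open>Put \<open>N = g + 1\<close>, \<open>T = S\<^sup>N + S\<^sup>-\<^sup>N\<close>, and for a GMP matrix \<open>A\<close> let
  \<open>R\<^sub>k = (c\<^sub>k - A)\<^sup>-\<^sup>1\<close>. Call \<open>t(A) = T\<close>, where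
  \<open>t(z) = l\<^sub>0 z + c\<^sub>0 + (\<Sum>k. l\<^sub>k / (c\<^sub>k - z))\<close>, a magic formula for \<open>A\<close>. The theorem says that the magic
  formula for \<open>t = Delta \<Psi>\<close> holds exactly for the periodic \<open>A\<close> with spectrum \<open>E\<close>.

  \<^bold>\<open>Operators.\<close> The matrices \<open>A\<close> and \<open>R\<^sub>k\<close> are real, symmetric and vanish at distance more than \<open>N\<close> from the
  diagonal; at distance exactly \<open>N\<close> each of them is nonzero, and then positive, in a single residue
  class of rows modulo \<open>N\<close>, and these classes are different for the \<open>N\<close> operators
  (\<open>GMP_generator_tip_band\<close>). If \<open>A\<close> is periodic, one can therefore choose \<open>l\<^sub>0, l\<^sub>k > 0\<close> such that
  \<open>D = l\<^sub>0 A + (\<Sum>k. l\<^sub>k R\<^sub>k) - T\<close> vanishes at distance \<open>N\<close>. As \<open>D\<close> commutes with \<open>A\<close> and all \<open>R\<^sub>k\<close>,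
  comparing extreme entries in the commutators shows that \<open>D\<close> is diagonal and then scalar, so \<open>A\<close> satisfies
  some magic formula with positive \<open>l\<close> (\<open>periodic_magic_formula\<close>). Conversely, under any magic formula \<open>A\<close>
  commutes with \<open>T\<close>, and a banded operator commuting with \<open>T\<close> commutes with \<open>S\<^sup>N\<close>
  (\<open>magic_formula_periodic\<close>). Finally, a magic formula with positive \<open>l\<close> determines the spectrum as
  \<open>t\<^sup>-\<^sup>1([-2, 2])\<close> (\<open>spectrum_of_magic_formula\<close>), because \<open>T - t(z)\<close> is the product of \<open>A - z\<close> and the
  banded operator \<open>l\<^sub>0 + (\<Sum>k. l\<^sub>k R\<^sub>k / (c\<^sub>k - z))\<close>, and the latter sends Weyl sequences for \<open>T\<close> to
  Weyl sequences for \<open>A\<close>.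

  \<^bold>\<open>The Ahlfors function.\<close> Write \<open>E\<close> as the union of the bands \<open>[\<beta>\<^sub>j, \<alpha>\<^sub>j]\<close> and let \<open>f\<close> be the
  product of the quotients \<open>(z - \<beta>\<^sub>j) / (z - \<alpha>\<^sub>j)\<close>. Then \<open>\<Psi> = (\<surd>f - 1) / (\<surd>f + 1)\<close>
  (\<open>ahlfors_function_unique\<close>): this function is admissible; by a maximum principle in the upper
  half-plane no admissible function has a larger leading coefficient (\<open>admissible_bound\<close>); and an extremal
  function is unique because the modulus of the mean of two extremal functions, plus half the squared
  modulus of half their difference, is at most 1, which leaves room to improve the mean
  (\<open>extremal_unique\<close>). Hence \<open>Delta \<Psi> = 2 (f + 1) / (f - 1)\<close>, which has the form \<open>t\<close> with positive
  coefficients and satisfies \<open>E = t\<^sup>-\<^sup>1([-2, 2])\<close> (\<open>Delta_rational\<close>).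

  \<^bold>\<open>Conclusion.\<close> If \<open>t = Delta \<Psi>\<close>, the magic formula gives periodicity and the spectrum \<open>E\<close>. If \<open>A\<close> is
  periodic with spectrum \<open>E\<close>, it satisfies a magic formula for some \<open>t\<close> with
  \<open>t\<^sup>-\<^sup>1([-2, 2]) = E\<close>; such a \<open>t\<close> is determined by \<open>E\<close> and its poles, because its values at the
  band edges are known (\<open>rational_fun_determined_by_bands\<close>), so \<open>t = Delta \<Psi>\<close>.\<close>

section \<open>The Hilbert space and its bounded operators\<close>

lemma coord_simps [simp]:
  "coord (x + y) n = coord x n + coord y n"
  "coord (x - y) n = coord x n - coord y n"
  "coord (- x) n = - coord x n"
  "coord 0 n = 0"
  "coord (r *\<^sub>R x) n = of_real r * coord x n"
  "coord (c *\<^sub>C x) n = c * coord x n"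
  "coord (unit_vec m) n = (if n = m then 1 else 0)"
  by (transfer; simp)+

lemma coord_sum [simp]: "coord (\<Sum>i\<in>F. f i) n = (\<Sum>i\<in>F. coord (f i) n)"
  by (induction F rule: infinite_finite_induct) auto

lemma scaleR_eq_scaleC: "r *\<^sub>R x = of_real r *\<^sub>C (x :: l2Z)"
  by (rule l2Z_eqI) simp

lemma summable_coord: "(\<lambda>n. (cmod (coord x n))\<^sup>2) summable_on UNIV"
  using coord[of x] by (simp add: square_summable_def)

lemma norm_l2Z_power2: "(norm x)\<^sup>2 = (\<Sum>\<^sub>\<infinity>n. (cmod (coord x n))\<^sup>2)"
  by (simp add: norm_l2Z_def infsum_nonneg)

lemma norm_scaleC [simp]: "norm (c *\<^sub>C x) = cmod c * norm x"
proof -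
  have "(norm (c *\<^sub>C x))\<^sup>2 = (cmod c * norm x)\<^sup>2"
    by (simp add: norm_l2Z_power2 norm_mult power_mult_distrib infsum_cmult_right')
  then show ?thesis
    by (simp add: power2_eq_iff_nonneg)
qed

lemma sum_coord_le_norm:
  assumes "finite F"
  shows "(\<Sum>n\<in>F. (cmod (coord x n))\<^sup>2) \<le> (norm x)\<^sup>2"
  unfolding norm_l2Z_power2
  by (rule finite_sum_le_infsum[OF summable_coord assms]) auto

lemma norm_coord_le: "cmod (coord x n) \<le> norm x"
  using sum_coord_le_norm[of "{n}" x] by (simp add: power2_le_iff_abs_le)

lemma l2Z_norm_boundI:
  assumes "\<And>F. finite F \<Longrightarrow> (\<Sum>n\<in>F. (cmod (f n))\<^sup>2) \<le> e\<^sup>2" "e \<ge> 0"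
  shows "\<exists>x. coord x = f \<and> norm x \<le> e"
proof -
  have s: "(\<lambda>n. (cmod (f n))\<^sup>2) summable_on UNIV"
    by (rule nonneg_bdd_above_summable_on) (use assms in \<open>auto intro!: bdd_aboveI[of _ "e\<^sup>2"]\<close>)
  then have c: "coord (Abs_l2Z f) = f"
    by (simp add: Abs_l2Z_inverse square_summable_def)
  have "(norm (Abs_l2Z f))\<^sup>2 \<le> e\<^sup>2"
    unfolding norm_l2Z_power2 c by (rule infsum_le_finite_sums[OF s]) (use assms in auto)
  then show ?thesis using c assms(2)
    by (metis power2_le_iff_abs_le abs_of_nonneg norm_ge_zero)
qed

text \<open>Completeness is needed for Neumann series. The limit of a Cauchy sequence is taken coordinatewise.\<close>

instance l2Z :: complete_space
proof
  fix X :: "nat \<Rightarrow> l2Z" assume X: "Cauchy X"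
  have "Cauchy (\<lambda>i. coord (X i) n)" for n
  proof (rule metric_CauchyI)
    fix e :: real assume "e > 0"
    then obtain M where "\<forall>i\<ge>M. \<forall>j\<ge>M. dist (X i) (X j) < e"
      using X metric_CauchyD by blast
    then show "\<exists>M. \<forall>i\<ge>M. \<forall>j\<ge>M. dist (coord (X i) n) (coord (X j) n) < e"
      using norm_coord_le[of "X i - X j" n for i j]
      by (metis coord_simps(2) dist_norm le_less_trans)
  qed
  then have "\<exists>l. (\<lambda>i. coord (X i) n) \<longlonglongrightarrow> l" for n
    using Cauchy_convergent convergent_def by blast
  then obtain y where y: "\<And>n. (\<lambda>i. coord (X i) n) \<longlonglongrightarrow> y n"
    by metis
  have close: "\<exists>M. \<forall>i\<ge>M. \<exists>d. coord d = (\<lambda>n. coord (X i) n - y n) \<and> norm d \<le> e" if "e > 0" for e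
  proof -
    obtain M where M: "\<And>i j. i \<ge> M \<Longrightarrow> j \<ge> M \<Longrightarrow> norm (X i - X j) < e"
      using metric_CauchyD[OF X \<open>e > 0\<close>] unfolding dist_norm by blast
    have "(\<Sum>n\<in>F. (cmod (coord (X i) n - y n))\<^sup>2) \<le> e\<^sup>2" if "i \<ge> M" "finite F" for i F
    proof (rule LIMSEQ_le_const2)
      show "(\<lambda>j. \<Sum>n\<in>F. (cmod (coord (X i) n - coord (X j) n))\<^sup>2)
              \<longlonglongrightarrow> (\<Sum>n\<in>F. (cmod (coord (X i) n - y n))\<^sup>2)"
        by (intro tendsto_intros y)
      have "(\<Sum>n\<in>F. (cmod (coord (X i) n - coord (X j) n))\<^sup>2) \<le> e\<^sup>2" if "j \<ge> M" for j
        using sum_coord_le_norm[OF \<open>finite F\<close>, of "X i - X j"] M[OF \<open>i \<ge> M\<close> that]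
          power_mono[of "norm (X i - X j)" e 2] by simp
      then show "\<exists>M. \<forall>j\<ge>M. (\<Sum>n\<in>F. (cmod (coord (X i) n - coord (X j) n))\<^sup>2) \<le> e\<^sup>2"
        by blast
    qed
    then show ?thesis
      using l2Z_norm_boundI[of "\<lambda>n. coord (X i) n - y n" e for i] \<open>e > 0\<close>
      by (meson less_imp_le)
  qed
  obtain i d where d: "coord d = (\<lambda>n. coord (X i) n - y n)"
    using close[of 1] by (meson le_refl zero_less_one)
  define L where "L = X i - d"
  have L: "coord L = y"
    by (auto simp: L_def d)
  have "X \<longlonglongrightarrow> L"
  proof (rule LIMSEQ_I)
    fix e :: real assume "e > 0"
    then obtain M where M: "\<forall>i\<ge>M. \<exists>d. coord d = (\<lambda>n. coord (X i) n - y n) \<and> norm d \<le> e/2"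
      using close[of "e/2"] by auto
    have "norm (X i - L) < e" if "i \<ge> M" for i
    proof -
      obtain d where "coord d = (\<lambda>n. coord (X i) n - y n)" "norm d \<le> e/2"
        using M \<open>i \<ge> M\<close> by blast
      moreover from this have "X i - L = d"
        by (intro l2Z_eqI) (simp add: L)
      ultimately show ?thesis using \<open>e > 0\<close> by simp
    qed
    then show "\<exists>M. \<forall>i\<ge>M. norm (X i - L) < e" by blast
  qed
  then show "convergent X" by (auto simp: convergent_def)
qed

lemma bounded_clinearI:
  assumes "\<And>x y. A (x + y) = A x + A y" "\<And>c x. A (c *\<^sub>C x) = c *\<^sub>C A x"
    "\<And>x. norm (A x) \<le> norm x * K"
  shows "bounded_clinear A"
  unfolding bounded_clinear_def
  by (auto intro!: bounded_linear_intro[of A K] simp: assms scaleR_eq_scaleC)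

lemma bounded_clinear_imp_linear: "bounded_clinear A \<Longrightarrow> linear A"
  by (simp add: bounded_clinear_def bounded_linear.linear)

lemma bounded_clinear_simps:
  assumes "bounded_clinear A"
  shows "A (x + y) = A x + A y" "A (x - y) = A x - A y" "A 0 = 0" "A (c *\<^sub>C x) = c *\<^sub>C A x"
    "A (r *\<^sub>R x) = r *\<^sub>R A x" "A (sum f F) = (\<Sum>i\<in>F. A (f i))"
  using assms bounded_clinear_imp_linear[OF assms] unfolding bounded_clinear_def
  by (auto simp: linear_add linear_diff linear_0 linear_scale linear_sum)

lemma bounded_clinear_bound:
  assumes "bounded_clinear A" obtains K where "K > 0" "\<And>x. norm (A x) \<le> norm x * K"
  using bounded_linear.pos_bounded[of A] assms by (auto simp: bounded_clinear_def)

lemma scaleC_simps [simp]: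
  "c *\<^sub>C (x + y) = c *\<^sub>C x + c *\<^sub>C y" "c *\<^sub>C (x - y) = c *\<^sub>C x - c *\<^sub>C y"
  "c *\<^sub>C d *\<^sub>C x = (c * d) *\<^sub>C x" "1 *\<^sub>C x = x" "c *\<^sub>C (0::l2Z) = 0" "0 *\<^sub>C x = 0"
  by (rule l2Z_eqI; simp add: algebra_simps)+

lemma bounded_clinear_scaleC: "bounded_clinear (\<lambda>x. c *\<^sub>C x)"
  by (rule bounded_clinearI[where K = "cmod c"]) (auto simp: mult.commute)

lemma bounded_clinear_id: "bounded_clinear (\<lambda>x. x)"
  by (rule bounded_clinearI[where K = 1]) auto

lemma bounded_clinear_add:
  assumes "bounded_clinear A" "bounded_clinear B"
  shows "bounded_clinear (\<lambda>x. A x + B x)"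
  using assms by (auto simp: bounded_clinear_def intro: bounded_linear_add)

lemma bounded_clinear_sub:
  assumes "bounded_clinear A" "bounded_clinear B"
  shows "bounded_clinear (\<lambda>x. A x - B x)"
  using assms by (auto simp: bounded_clinear_def intro: bounded_linear_sub)

lemma bounded_clinear_compose:
  assumes "bounded_clinear A" "bounded_clinear B"
  shows "bounded_clinear (\<lambda>x. A (B x))"
  using assms by (auto simp: bounded_clinear_def intro: bounded_linear_compose)

lemma bounded_clinear_cmul:
  assumes "bounded_clinear A"
  shows "bounded_clinear (\<lambda>x. c *\<^sub>C A x)" "bounded_clinear (\<lambda>x. r *\<^sub>R A x)"
  using bounded_clinear_compose[OF bounded_clinear_scaleC assms] 
  by (auto simp: scaleR_eq_scaleC)

lemma bounded_clinear_sum: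
  assumes "\<And>i. i \<in> F \<Longrightarrow> bounded_clinear (A i)"
  shows "bounded_clinear (\<lambda>x. \<Sum>i\<in>F. A i x)"
proof (cases "finite F")
  case True
  then show ?thesis using assms
  proof (induction F)
    case empty
    then show ?case by (auto intro!: bounded_clinearI[where K = 0])
  next
    case (insert i F)
    then show ?case by (simp add: bounded_clinear_add)
  qed
qed (auto intro!: bounded_clinearI[where K = 0])

lemma finitely_supported_dense:
  assumes "e > 0"
  shows "\<exists>F. finite F \<and> norm (x - (\<Sum>n\<in>F. coord x n *\<^sub>C unit_vec n)) < e"
proof -
  let ?f = "\<lambda>n. (cmod (coord x n))\<^sup>2"
  have "e\<^sup>2 > 0" using assms by simp
  then have "\<forall>\<^sub>F F in finite_subsets_at_top UNIV. dist (sum ?f F) (infsum ?f UNIV) < e\<^sup>2"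
    by (rule tendstoD[OF infsum_tendsto[OF summable_coord]])
  then obtain F where F: "finite F" "dist (sum ?f F) (infsum ?f UNIV) < e\<^sup>2"
    unfolding eventually_finite_subsets_at_top by blast
  let ?d = "x - (\<Sum>n\<in>F. coord x n *\<^sub>C unit_vec n)"
  have c: "coord ?d n = (if n \<in> F then 0 else coord x n)" for n
    using F(1) by (simp add: mult_delta_right)
  have "(norm ?d)\<^sup>2 = infsum ?f (UNIV - F)"
    unfolding norm_l2Z_power2 c by (rule infsum_cong_neutral) auto
  also have "\<dots> = infsum ?f UNIV - sum ?f F"
    using infsum_Diff[OF summable_coord[of x], of F] F(1) by simp
  also have "\<dots> < e\<^sup>2" using F(2) by (simp add: dist_real_def abs_if split: if_splits)
  finally show ?thesis
    using F(1) assms power2_less_imp_less[of "norm ?d" e] by auto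
qed

text \<open>A bounded operator is determined by its matrix, since finitely supported vectors are dense.\<close>

lemma operator_eqI:
  assumes A: "bounded_clinear A" and B: "bounded_clinear B"
    and eq: "\<And>r s. entry A r s = entry B r s"
  shows "A = B"
proof
  fix x
  define D where "D = (\<lambda>x. A x - B x)"
  have D: "bounded_clinear D" unfolding D_def using A B by (rule bounded_clinear_sub)
  obtain K where K: "K > 0" "\<And>x. norm (D x) \<le> norm x * K"
    using bounded_clinear_bound[OF D] by blast
  have u: "D (unit_vec n) = 0" for n
    using eq by (intro l2Z_eqI) (simp add: entry_def D_def)
  have "norm (D x) < e" if "e > 0" for e
  proof -
    define y where "y F = (\<Sum>n\<in>F. coord x n *\<^sub>C unit_vec n)" for F
    obtain F where F: "norm (x - y F) < e / K"
      using finitely_supported_dense[of "e / K" x] divide_pos_pos[OF \<open>e > 0\<close> K(1)] unfolding y_def by blast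
    have "D (y F) = 0"
      unfolding y_def by (simp add: bounded_clinear_simps[OF D] u)
    then have "norm (D x) \<le> norm (x - y F) * K"
      using K(2)[of "x - y F"] by (simp add: bounded_clinear_simps[OF D])
    also have "\<dots> < e"
      using F K(1) by (simp add: pos_less_divide_eq)
    finally show ?thesis .
  qed
  then have "norm (D x) \<le> 0" by (meson less_irrefl not_le)
  then show "A x = B x" by (simp add: D_def)
qed

lemma column_expansion:
  assumes "finite F" "\<And>l. l \<notin> F \<Longrightarrow> entry B l s = 0"
  shows "B (unit_vec s) = (\<Sum>l\<in>F. entry B l s *\<^sub>C unit_vec l)"
  using assms by (intro l2Z_eqI) (auto simp: entry_def mult_delta_right)

text \<open>If a column of \<open>B\<close> is finitely supported, the corresponding column of the product is a finite
  sum. All matrices below are banded, so this covers every product that is needed.\<close>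

lemma entry_compose:
  assumes "bounded_clinear A" "finite F" "\<And>l. l \<notin> F \<Longrightarrow> entry B l s = 0"
  shows "entry (\<lambda>x. A (B x)) r s = (\<Sum>l\<in>F. entry A r l * entry B l s)"
  by (simp add: entry_def[of "\<lambda>x. A (B x)"] column_expansion[OF assms(2,3)]
      bounded_clinear_simps[OF assms(1)] entry_def[of A] mult.commute)

section \<open>Powers of the shift\<close>

lemma coord_rshift_power: "coord ((rshift ^^ k) x) n = coord x (n - int k)"
  by (induction k arbitrary: n) (auto simp: rshift.rep_eq algebra_simps)

lemma coord_inv_rshift: "coord (inv rshift x) n = coord x (n + 1)"
proof -
  have "rshift (inv rshift x) = x"
    using bij_rshift by (simp add: bij_is_surj surj_f_inv_f)
  then show ?thesis
    by (metis add_diff_cancel_right' rshift.rep_eq)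
qed

lemma coord_inv_rshift_power: "coord ((inv rshift ^^ k) x) n = coord x (n + int k)"
  by (induction k arbitrary: n) (auto simp: coord_inv_rshift algebra_simps)

lemma norm_translate:
  assumes "\<And>n. coord y n = coord x (n + k)"
  shows "norm y = norm x"
proof -
  have "bij (\<lambda>n::int. n + k)"
    by (rule bij_betw_byWitness[where f' = "\<lambda>n. n - k"]) auto
  from infsum_reindex_bij_betw[OF this, of "\<lambda>n. (cmod (coord x n))\<^sup>2"]
  show ?thesis by (simp add: norm_l2Z_def assms)
qed

lemma norm_rshift_power [simp]: "norm ((rshift ^^ k) x) = norm x"
  by (rule norm_translate[of _ _ "- int k"]) (simp add: coord_rshift_power)

lemma norm_inv_rshift_power [simp]: "norm ((inv rshift ^^ k) x) = norm x"
  by (rule norm_translate[of _ _ "int k"]) (simp add: coord_inv_rshift_power)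

lemma bounded_clinear_rshift_power: "bounded_clinear (rshift ^^ k)"
  by (rule bounded_clinearI[where K = 1])
     (auto intro!: l2Z_eqI simp: coord_rshift_power)

lemma bounded_clinear_inv_rshift_power: "bounded_clinear (inv rshift ^^ k)"
  by (rule bounded_clinearI[where K = 1])
     (auto intro!: l2Z_eqI simp: coord_inv_rshift_power)

lemma rshift_inv_rshift_power [simp]:
  "(rshift ^^ k) ((inv rshift ^^ k) x) = x" "(inv rshift ^^ k) ((rshift ^^ k) x) = x"
  by (auto intro!: l2Z_eqI simp: coord_rshift_power coord_inv_rshift_power)

lemma rshift_power_unit_vec [simp]:
  "(rshift ^^ k) (unit_vec n) = unit_vec (n + int k)"
  "(inv rshift ^^ k) (unit_vec n) = unit_vec (n - int k)"
  by (auto intro!: l2Z_eqI simp: coord_rshift_power coord_inv_rshift_power)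

section \<open>Band structure of GMP matrices\<close>

text \<open>\<open>tip_band N i M\<close> says that \<open>M\<close> has a real symmetric matrix of bandwidth \<open>N\<close> whose entries at
  distance exactly \<open>N\<close> from the diagonal are positive in the rows congruent to \<open>i\<close> modulo \<open>N\<close> and zero in
  all other rows. For the entries below the diagonal, this is stated through the symmetry.\<close>

definition tip_band :: "nat \<Rightarrow> int \<Rightarrow> (l2Z \<Rightarrow> l2Z) \<Rightarrow> bool" where
  "tip_band N i M \<longleftrightarrow> bounded_clinear M \<and> (\<forall>r s. entry M r s = entry M s r) \<and>
     (\<forall>r s. entry M r s \<in> \<real>) \<and>
     (\<forall>r s. \<bar>r - s\<bar> > int N \<longrightarrow> entry M r s = 0) \<and>
     (\<forall>r. if r mod int N = i mod int N then \<exists>x>0. entry M r (r + int N) = complex_of_real x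
          else entry M r (r + int N) = 0)"

lemma tip_bandD:
  assumes "tip_band N i M"
  shows "bounded_clinear M" "entry M r s = entry M s r"
    "\<bar>r - s\<bar> > int N \<Longrightarrow> entry M r s = 0"
    "r mod int N = i mod int N \<Longrightarrow> \<exists>x>0. entry M r (r + int N) = complex_of_real x"
    "r mod int N \<noteq> i mod int N \<Longrightarrow> entry M r (r + int N) = 0"
    "entry M r s \<in> \<real>"
  using assms unfolding tip_band_def by (blast, blast, blast, meson, meson, blast)

lemma block_index:
  obtains j i where "r = int (g + 1) * j + int i" "i \<le> g"
proof
  show "r = int (g + 1) * (r div int (g + 1)) + int (nat (r mod int (g + 1)))"
    by simp
  show "nat (r mod int (g + 1)) \<le> g"
    using pos_mod_bound[of "int (g + 1)" r] by linarith
qed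

lemma generating_coeffsD:
  assumes "generating_coeffs C M p q" "length C = g"
  shows "p j g > 0" "i \<le> g \<Longrightarrow> l \<le> g \<Longrightarrow>
    entry M (int (g + 1) * j + int i) (int (g + 1) * k + int l) = of_real (block_entry C p q j k i l)"
  using assms unfolding generating_coeffs_def Let_def by auto

lemma block_entry_sym: "block_entry C p q j k i l = block_entry C p q k j l i"
  by (auto simp: block_entry_def Let_def block_B_def strict_upper_def lower_def outer_def)

text \<open>The extreme entries are the last entries of the vectors \<open>p j\<close>, which are positive.\<close>

lemma class_A_tip_band:
  assumes "M \<in> class_A C" "length C = g"
  shows "tip_band (g + 1) (int g) M"
proof -
  obtain p q where M: "bounded_clinear M" and pq: "generating_coeffs C M p q"
    using assms by (auto simp: class_A_def)
  note E = generating_coeffsD[OF pq assms(2)]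
  show ?thesis unfolding tip_band_def
  proof (intro conjI allI impI)
    fix r s
    obtain j i where r: "r = int (g + 1) * j + int i" "i \<le> g" by (rule block_index)
    obtain k l where s: "s = int (g + 1) * k + int l" "l \<le> g" by (rule block_index)
    show "entry M r s = entry M s r"
      by (simp only: r(1) s(1) E(2)[OF r(2) s(2)] E(2)[OF s(2) r(2)]
          block_entry_sym[of C p q j k])
    show "entry M r s \<in> \<real>"
      by (simp only: r(1) s(1) E(2)[OF r(2) s(2)] Reals_of_real)
    show "entry M r s = 0" if far: "\<bar>r - s\<bar> > int (g + 1)"
    proof -
      have "block_entry C p q j k i l = 0"
      proof (rule ccontr)
        assume nz: "block_entry C p q j k i l \<noteq> 0"
        then consider "k = j - 1" "l = g" | "k = j" | "k = j + 1" "i = g"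
          by (auto simp: block_entry_def block_A_def outer_def assms(2) Let_def split: if_splits)
        then have "\<bar>r - s\<bar> \<le> int (g + 1)"
          using r s by cases (auto simp: algebra_simps)
        then show False using far by simp
      qed
      then show ?thesis
        unfolding r(1) s(1) E(2)[OF r(2) s(2)] by simp
    qed
  next
    fix r
    obtain j i where r: "r = int (g + 1) * j + int i" "i \<le> g" by (rule block_index)
    have "r mod int (g + 1) = int i"
      using r by simp
    moreover have "int g mod int (g + 1) = int g" by simp
    moreover have next_block: "r + int (g + 1) = int (g + 1) * (j + 1) + int i"
      using r(1) by (simp add: algebra_simps)
    have "entry M r (r + int (g + 1)) = of_real (block_entry C p q j (j + 1) i i)"
      unfolding next_block by (simp only: r(1) E(2)[OF r(2) r(2)])
    moreover have "block_entry C p q j (j + 1) i i = (if i = g then p (j + 1) g else 0)"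
      by (simp add: block_entry_def block_A_def outer_def assms(2))
    ultimately show "if r mod int (g + 1) = int g mod int (g + 1)
        then \<exists>x>0. entry M r (r + int (g + 1)) = complex_of_real x
        else entry M r (r + int (g + 1)) = 0"
      using E(1)[of "j + 1"] by auto
  qed (rule M)
qed

lemma tip_band_shift:
  assumes "tip_band N i ((inv rshift ^^ k) \<circ> M \<circ> (rshift ^^ k))" "bounded_clinear M"
  shows "tip_band N (i + int k) M"
proof -
  let ?M = "(inv rshift ^^ k) \<circ> M \<circ> (rshift ^^ k)"
  have e: "entry M r s = entry ?M (r - int k) (s - int k)" for r s
    by (simp add: entry_def coord_inv_rshift_power)
  note t = tip_bandD[OF assms(1)]
  have m: "(r - int k) mod int N = i mod int N \<longleftrightarrow> r mod int N = (i + int k) mod int N" for r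
    by (auto simp: mod_eq_dvd_iff algebra_simps)
  show ?thesis unfolding tip_band_def
  proof (intro conjI allI impI)
    show "entry M r s = entry M s r" for r s
      unfolding e by (rule t)
    show "entry M r s \<in> \<real>" for r s
      unfolding e by (rule t)
    show "entry M r s = 0" if "\<bar>r - s\<bar> > int N" for r s
      unfolding e using that by (intro t) simp
    fix r
    have "entry M r (r + int N) = entry ?M (r - int k) (r - int k + int N)"
      unfolding e by (simp add: algebra_simps)
    then show "if r mod int N = (i + int k) mod int N
      then \<exists>x>0. entry M r (r + int N) = complex_of_real x
      else entry M r (r + int N) = 0"
      using t(4)[of "r - int k"] t(5)[of "r - int k"] unfolding m by auto
  qed (rule assms)
qed

lemma resolvent_props:
  assumes "invertible_op (shifted_op (of_real c) A)"
  shows "bounded_clinear (resolvent c A)"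
    "of_real c *\<^sub>C resolvent c A x - A (resolvent c A x) = x"
    "resolvent c A (of_real c *\<^sub>C x - A x) = x"
proof -
  obtain B where B: "bounded_clinear B" "shifted_op (of_real c) A \<circ> B = id" "B \<circ> shifted_op (of_real c) A = id"
    using assms by (auto simp: invertible_op_def)
  then have "resolvent c A = B"
    unfolding resolvent_def by (metis inv_unique_comp)
  then show "bounded_clinear (resolvent c A)"
    "of_real c *\<^sub>C resolvent c A x - A (resolvent c A x) = x"
    "resolvent c A (of_real c *\<^sub>C x - A x) = x"
    using B(1) pointfree_idE[OF B(2), of x] pointfree_idE[OF B(3), of x]
    by (simp_all add: shifted_op_def)
qed

lemma resolvent_commute:
  assumes "invertible_op (shifted_op (of_real c) A)" and F: "bounded_clinear F"
    and comm: "\<And>x. F (A x) = A (F x)"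
  shows "F (resolvent c A x) = resolvent c A (F x)"
proof -
  note R = resolvent_props[OF assms(1)]
  have "F (resolvent c A x) = resolvent c A (of_real c *\<^sub>C F (resolvent c A x) - A (F (resolvent c A x)))"
    by (simp add: R)
  also have "of_real c *\<^sub>C F (resolvent c A x) - A (F (resolvent c A x)) =
      F (of_real c *\<^sub>C resolvent c A x - A (resolvent c A x))"
    by (simp add: bounded_clinear_simps[OF F] comm)
  also have "\<dots> = F x" by (simp add: R)
  finally show ?thesis .
qed

text \<open>The \<open>g + 1\<close> operators \<open>(c\<^sub>1 - A)\<^sup>-\<^sup>1, \<dots>, (c\<^sub>g - A)\<^sup>-\<^sup>1, A\<close>, indexed by \<open>0, \<dots>, g\<close> in such a
  way that the extreme entries of the \<open>j\<close>-th one lie in the rows congruent to \<open>j\<close>.\<close>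

definition generator :: "real list \<Rightarrow> (l2Z \<Rightarrow> l2Z) \<Rightarrow> nat \<Rightarrow> l2Z \<Rightarrow> l2Z" where
  "generator C A j = (if j < length C then resolvent (C ! j) A else A)"

text \<open>The operator \<open>l\<^sub>0 A + c\<^sub>0 + (\<Sum>j. l\<^sub>j (C\<^sub>j - A)\<^sup>-\<^sup>1)\<close>. The coefficients \<open>l\<close> are a function; only its values
  below \<open>length C\<close> matter.\<close>

definition rational_op ::
    "real \<Rightarrow> real \<Rightarrow> (nat \<Rightarrow> real) \<Rightarrow> real list \<Rightarrow> (l2Z \<Rightarrow> l2Z) \<Rightarrow> l2Z \<Rightarrow> l2Z" where
  "rational_op l0 c0 l C A =
     (\<lambda>x. l0 *\<^sub>R A x + c0 *\<^sub>R x + (\<Sum>j<length C. l j *\<^sub>R resolvent (C ! j) A x))"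

text \<open>The operator \<open>S\<^sup>N + S\<^sup>-\<^sup>N\<close>.\<close>

definition two_sided_shift :: "nat \<Rightarrow> l2Z \<Rightarrow> l2Z" where
  "two_sided_shift N x = (rshift ^^ N) x + (inv rshift ^^ N) x"

lemma bounded_clinear_two_sided_shift: "bounded_clinear (two_sided_shift N)"
  unfolding two_sided_shift_def[abs_def]
  by (intro bounded_clinear_add bounded_clinear_rshift_power bounded_clinear_inv_rshift_power)

lemma entry_two_sided_shift:
  "entry (two_sided_shift N) r s = of_bool (r = s + int N) + of_bool (r = s - int N)"
  by (simp add: entry_def two_sided_shift_def)

context
  fixes C :: "real list" and A :: "l2Z \<Rightarrow> l2Z" and g N :: nat
  assumes A: "A \<in> GMP C" and g: "length C = g" and N: "N = g + 1"
begin

lemma GMP_bounded: "bounded_clinear A"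
  using A by (auto simp: GMP_def class_A_def)

lemma GMP_invertible: "j < g \<Longrightarrow> invertible_op (shifted_op (of_real (C ! j)) A)"
  using A g by (auto simp: GMP_def elim!: ballE[of _ _ "Suc j"])

lemmas GMP_resolvent = resolvent_props[OF GMP_invertible]

lemma GMP_generator_tip_band:
  assumes "j \<le> g" shows "tip_band N (int j) (generator C A j)"
proof (cases "j < g")
  case True
  have "(inv rshift ^^ Suc j) \<circ> resolvent (C ! j) A \<circ> (rshift ^^ Suc j)
       \<in> class_A (resolvent_collection C (Suc j))"
    using A True g unfolding GMP_def by (auto elim!: ballE[of _ _ "Suc j"])
  moreover have "length (resolvent_collection C (Suc j)) = g"
    using True g by (simp add: resolvent_collection_def Let_def)
  ultimately have "tip_band N (int g) ((inv rshift ^^ Suc j) \<circ> resolvent (C ! j) A \<circ> (rshift ^^ Suc j))"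
    unfolding N by (rule class_A_tip_band)
  then have "tip_band N (int g + int (Suc j)) (resolvent (C ! j) A)"
    by (rule tip_band_shift) (rule GMP_resolvent(1)[OF True])
  moreover have "(int g + int (Suc j)) mod int N = int j mod int N"
    using N by (simp add: mod_eq_dvd_iff add.commute)
  ultimately show ?thesis
    using True g unfolding tip_band_def generator_def by simp
next
  case False
  then have "j = g" using assms by simp
  then show ?thesis
    using class_A_tip_band[of A C g] A g N by (auto simp: GMP_def generator_def)
qed

lemma generator_commute:
  assumes F: "bounded_clinear F" and comm: "\<And>x. F (A x) = A (F x)" 
  shows "F (generator C A j x) = generator C A j (F x)"
  using resolvent_commute[OF GMP_invertible F comm] comm g by (simp add: generator_def)

lemma generator_bounded: "j \<le> g \<Longrightarrow> bounded_clinear (generator C A j)"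
  using GMP_generator_tip_band tip_bandD(1) by blast

lemma A_generator_commute: "j \<le> g \<Longrightarrow> A (generator C A j x) = generator C A j (A x)"
  by (intro generator_commute GMP_bounded) simp

lemma generator_generator_commute:
  assumes "i \<le> g" "j \<le> g"
  shows "generator C A i (generator C A j x) = generator C A j (generator C A i x)"
  by (intro generator_commute generator_bounded assms A_generator_commute[symmetric])

lemma rational_op_alt:
  "rational_op l0 c0 l C A x = c0 *\<^sub>R x + (\<Sum>j\<le>g. (if j < g then l j else l0) *\<^sub>R generator C A j x)"
  using g by (simp add: rational_op_def generator_def lessThan_Suc_atMost[symmetric])

lemma generator_periodic:
  assumes per: "periodic_GMP C A" and "j \<le> g"
  shows "(rshift ^^ N) (generator C A j x) = generator C A j ((rshift ^^ N) x)"
proof (rule generator_commute[OF bounded_clinear_rshift_power])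
  obtain p q where pq: "generating_coeffs C A (\<lambda>_. p) (\<lambda>_. q)"
    using per by (auto simp: periodic_GMP_def)
  have "entry A (r - int N) s = entry A r (s + int N)" for r s
  proof -
    obtain j i where r: "r = int (g + 1) * j + int i" "i \<le> g" by (rule block_index)
    obtain k l where s: "s = int (g + 1) * k + int l" "l \<le> g" by (rule block_index)
    have "r - int N = int (g + 1) * (j - 1) + int i" "s + int N = int (g + 1) * (k + 1) + int l"
      using r(1) s(1) N by (auto simp: algebra_simps)
    then have "entry A (r - int N) s = of_real (block_entry C (\<lambda>_. p) (\<lambda>_. q) (j - 1) k i l)"
      "entry A r (s + int N) = of_real (block_entry C (\<lambda>_. p) (\<lambda>_. q) j (k + 1) i l)"
      by (simp_all only: r(1) s(1) generating_coeffsD(2)[OF pq g r(2) s(2)])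
    then show ?thesis
      by (auto simp: block_entry_def Let_def)
  qed
  then have "(\<lambda>x. (rshift ^^ N) (A x)) = (\<lambda>x. A ((rshift ^^ N) x))"
    by (intro operator_eqI bounded_clinear_compose[OF bounded_clinear_rshift_power GMP_bounded]
          bounded_clinear_compose[OF GMP_bounded bounded_clinear_rshift_power])
       (simp add: entry_def coord_rshift_power)
  then show "(rshift ^^ N) (A x) = A ((rshift ^^ N) x)" for x
    by (rule fun_cong)
qed

end

section \<open>Periodicity and the magic formula\<close>

lemma shift_commute_entry:
  assumes "\<And>x. (rshift ^^ N) (M x) = M ((rshift ^^ N) x)"
  shows "entry M (r + int N) (s + int N) = entry M r s"
  using arg_cong[OF assms[of "unit_vec s"], of "\<lambda>x. coord x (r + int N)"]
  by (simp add: entry_def coord_rshift_power)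

lemma shift_commute_entry_mult:
  assumes "\<And>x. (rshift ^^ N) (M x) = M ((rshift ^^ N) x)"
  shows "entry M (r + k * int N) (s + k * int N) = entry M r s"
proof (induction k rule: int_induct[where k = 0])
  case (step1 i)
  then show ?case 
    using shift_commute_entry[where M = M and N = N, OF assms, of "r + i * int N" "s + i * int N"]
    by (simp add: algebra_simps)
next
  case (step2 i)
  then show ?case 
    using shift_commute_entry[where M = M and N = N, OF assms, of "r + (i - 1) * int N" "s + (i - 1) * int N"]
    by (simp add: algebra_simps)
qed auto

text \<open>If \<open>D\<close> commutes with \<open>X\<close> and has bandwidth \<open>d < N\<close>, consider the entry of the commutator at
  \<open>(m - N, m + d)\<close>. In \<open>X D\<close> only the product of the two extreme entries survives, and in \<open>D X\<close> only a
  product with an entry of \<open>X\<close> at distance \<open>N\<close> in a row of the wrong residue class.\<close>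

lemma commutator_band_step:
  assumes X: "tip_band N k X" and D: "bounded_clinear D"
    and comm: "\<And>x. X (D x) = D (X x)"
    and band: "\<And>r s. \<bar>r - s\<bar> > int d \<Longrightarrow> entry D r s = 0"
    and d: "0 < d" "d < N" and m: "m mod int N = k mod int N"
  shows "entry D m (m + int d) = 0"
proof -
  note t = tip_bandD[OF X]
  have "entry (\<lambda>x. X (D x)) (m - int N) (m + int d) =
      (\<Sum>l\<in>{m..m + 2 * int d}. entry X (m - int N) l * entry D l (m + int d))"
    by (intro entry_compose t band) auto
  also have "\<dots> = (\<Sum>l\<in>{m}. entry X (m - int N) l * entry D l (m + int d))"
    by (rule sum.mono_neutral_right) (auto simp: t(3))
  also have "\<dots> = entry X (m - int N) m * entry D m (m + int d)"
    by simp
  finally have 1: "entry (\<lambda>x. X (D x)) (m - int N) (m + int d) = 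
    entry X (m - int N) m * entry D m (m + int d)" .
  have "entry (\<lambda>x. D (X x)) (m - int N) (m + int d) =
      (\<Sum>l\<in>{m + int d - int N..m + int d + int N}. entry D (m - int N) l * entry X l (m + int d))"
    by (intro entry_compose t D) auto
  also have "\<dots> = 0"
  proof (rule sum.neutral, intro ballI)
    fix l assume l: "l \<in> {m + int d - int N..m + int d + int N}"
    show "entry D (m - int N) l * entry X l (m + int d) = 0"
    proof (cases "l = m + int d - int N")
      case True
      have "\<not> int N dvd int d"
        using d by (auto dest: zdvd_imp_le)
      moreover have "l - k = (m - k) + int d - int N" using True by simp
      ultimately have "l mod int N \<noteq> k mod int N"
        using m unfolding mod_eq_dvd_iff by (metis dvd_add_right_iff dvd_diff_left_iff dvd_refl)
      from t(5)[OF this] show ?thesis using True by simp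
    next
      case False
      then show ?thesis using l by (simp add: band)
    qed
  qed
  finally have "entry X (m - int N) m * entry D m (m + int d) = 0"
    using 1 comm by simp
  moreover have "(m - int N) mod int N = k mod int N"
    using m by simp
  ultimately show ?thesis
    using t(4)[of "m - int N"] by auto
qed

lemma block_residue:
  fixes r :: int
  assumes "N > 0"
  obtains j k where "j < N" "r = int j + k * int N" "r mod int N = int j mod int N"
proof
  show "nat (r mod int N) < N" using assms by (simp add: nat_less_iff)
  show "r = int (nat (r mod int N)) + (r div int N) * int N" using assms by simp
  show "r mod int N = int (nat (r mod int N)) mod int N" using assms by simp
qed

context
  fixes C :: "real list" and A :: "l2Z \<Rightarrow> l2Z" and g N :: nat
  assumes A: "A \<in> GMP C" and g: "length C = g" and N: "N = g + 1"
begin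

lemmas generator_band = GMP_generator_tip_band[OF A g N]

text \<open>Since every residue class of rows carries the extreme entries of some generator, the bandwidth of a
  symmetric \<open>D\<close> that commutes with all generators can be lowered step by step from \<open>g\<close> to \<open>0\<close>.\<close>

lemma banded_commutant_diagonal:
  assumes D: "bounded_clinear D"
    and comm: "\<And>j x. j \<le> g \<Longrightarrow> generator C A j (D x) = D (generator C A j x)"
    and sym: "\<And>r s. entry D r s = entry D s r"
    and far: "\<And>r s. \<bar>r - s\<bar> > int g \<Longrightarrow> entry D r s = 0"
    and ne: "r \<noteq> s"
  shows "entry D r s = 0"
proof -
  have "\<forall>r s. \<bar>r - s\<bar> > int (g - e) \<longrightarrow> entry D r s = 0" if "e \<le> g" for e
    using that
  proof (induction e)
    case 0
    then show ?case using far by simp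
  next
    case (Suc e)
    define d where "d = g - e"
    have d: "0 < d" "d < N" using Suc.prems N by (auto simp: d_def)
    have IH: "\<And>r s. \<bar>r - s\<bar> > int d \<Longrightarrow> entry D r s = 0"
      using Suc by (simp add: d_def)
    have up: "entry D m (m + int d) = 0" for m
    proof -
      have "N > 0" using N by simp
      then obtain j k where j: "j < N" "m = int j + k * int N" "m mod int N = int j mod int N"
        by (rule block_residue)
      then have "j \<le> g" using N by simp
      from commutator_band_step[OF generator_band[OF this] D comm[OF this] IH d j(3)]
      show ?thesis .
    qed
    have "entry D r s = 0" if "\<bar>r - s\<bar> > int (g - Suc e)" for r s
    proof -
      from that consider "\<bar>r - s\<bar> > int d" | "s = r + int d" | "r = s + int d"
        using Suc.prems by (fastforce simp: d_def)
      then show ?thesis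
        using IH up sym by cases metis+
    qed
    then show ?case by blast
  qed
  from this[of g] ne show ?thesis by simp
qed

text \<open>A diagonal \<open>D\<close> commuting with \<open>A\<close> takes equal values at indices linked by a nonzero entry of \<open>A\<close>. If
  the position \<open>i < g\<close> in a block were linked neither to the last position of this block nor to that of the
  preceding one, then \<open>p i = q i = 0\<close>, and a basis vector would be an eigenvector of \<open>A\<close> with eigenvalue \<open>C ! i\<close>, against the invertibility of \<open>C ! i - A\<close>.\<close>

lemma diagonal_commutant_scalar:
  assumes per: "periodic_GMP C A" and D: "bounded_clinear D"
    and comm: "\<And>x. A (D x) = D (A x)"
    and diag: "\<And>r s. r \<noteq> s \<Longrightarrow> entry D r s = 0"
  shows "entry D r r = entry D s s"
proof -
  let ?d = "\<lambda>r. entry D r r"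
  note AB = GMP_bounded[OF A g N]
  have bandA: "tip_band N (int g) A"
    using generator_band[of g] g by (simp add: generator_def)
  have link: "?d r = ?d s" if nz: "entry A r s \<noteq> 0" for r s
  proof -
    have near: "\<bar>r - s\<bar> \<le> int N"
      using tip_bandD(3)[OF bandA] nz by (meson not_le)
    have "entry (\<lambda>x. A (D x)) r s = (\<Sum>l\<in>{s}. entry A r l * entry D l s)"
      by (rule entry_compose[OF AB]) (auto simp: diag)
    moreover have "entry (\<lambda>x. D (A x)) r s = (\<Sum>l\<in>{s - int N..s + int N}. entry D r l * entry A l s)"
      by (rule entry_compose[OF D]) (auto intro!: tip_bandD(3)[OF bandA])
    moreover have "\<dots> = (\<Sum>l\<in>{r}. entry D r l * entry A l s)"
      by (rule sum.mono_neutral_right) (use near in \<open>auto simp: diag\<close>)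
    ultimately show ?thesis
      using nz comm by simp
  qed
  obtain p q where pq: "generating_coeffs C A (\<lambda>_. p) (\<lambda>_. q)"
    using per by (auto simp: periodic_GMP_def)
  note E = generating_coeffsD(2)[OF pq g]
  have pg: "p g > 0" by (rule generating_coeffsD(1)[OF pq g])
  have step: "?d (int (g + 1) * j + int g) = ?d (int (g + 1) * (j + 1) + int g)" for j
    by (rule link, subst E) (use pg in \<open>auto simp: block_entry_def block_A_def outer_def g\<close>)
  have last: "?d (int (g + 1) * j + int g) = ?d (int g)" for j
  proof (induction j rule: int_induct[where k = 0])
    case (step1 i)
    then show ?case using step[of i] by simp
  next
    case (step2 i)
    then show ?case using step[of "i - 1"] by simp
  qed simp
  have all: "?d (int (g + 1) * j + int i) = ?d (int g)" if i: "i \<le> g" for i j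
  proof -
    consider "i = g" | "i < g" "p i \<noteq> 0" | "i < g" "q i \<noteq> 0" | "i < g" "p i = 0" "q i = 0"
      using i by linarith
    then show ?thesis
    proof cases
      case 1
      then show ?thesis using last by simp
    next
      case 2
      have "?d (int (g + 1) * (j - 1) + int g) = ?d (int (g + 1) * j + int i)"
        by (rule link, subst E) (use 2 in \<open>auto simp: block_entry_def block_A_def outer_def g\<close>)
      then show ?thesis using last by simp
    next
      case 3
      have "?d (int (g + 1) * j + int g) = ?d (int (g + 1) * j + int i)"
        by (rule link, subst E)
           (use 3 pg in \<open>auto simp: block_entry_def block_B_def strict_upper_def lower_def outer_def g\<close>)
      then show ?thesis using last by simp
    next
      case 4
      let ?e = "unit_vec (int (g + 1) * j + int i)"
      have "entry A r (int (g + 1) * j + int i) = (if r = int (g + 1) * j + int i then of_real (C ! i) else 0)" for r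
      proof -
        obtain k l where r: "r = int (g + 1) * k + int l" "l \<le> g" by (rule block_index)
        have same: "r = int (g + 1) * j + int i \<longleftrightarrow> k = j \<and> l = i"
        proof
          assume eq: "r = int (g + 1) * j + int i"
          have "k = r div int (g + 1)" "l = nat (r mod int (g + 1))" using r by auto
          moreover have "j = r div int (g + 1)" "i = nat (r mod int (g + 1))" using eq 4 by auto
          ultimately show "k = j \<and> l = i" by simp
        qed (use r in auto)
        have "entry A r (int (g + 1) * j + int i) = of_real (block_entry C (\<lambda>_. p) (\<lambda>_. q) k j l i)"
          using E[OF r(2) \<open>i \<le> g\<close>, of k j] r(1) by simp
        also have "block_entry C (\<lambda>_. p) (\<lambda>_. q) k j l i = (if k = j \<and> l = i then C ! i else 0)"
          using 4 by (auto simp: block_entry_def block_A_def block_B_def strict_upper_def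
              lower_def outer_def g nth_append Let_def)
        finally show ?thesis unfolding same by simp
      qed
      then have "A ?e = of_real (C ! i) *\<^sub>C ?e"
        by (intro l2Z_eqI) (simp add: entry_def)
      then have "resolvent (C ! i) A 0 = ?e"
        using GMP_resolvent(3)[OF A g N 4(1), of ?e] by simp
      then have "?e = 0"
        using bounded_clinear_simps(3)[OF GMP_resolvent(1)[OF A g N 4(1)]] by simp
      then have "coord ?e (int (g + 1) * j + int i) = coord 0 (int (g + 1) * j + int i)" by (rule arg_cong)
      then show ?thesis by simp
    qed
  qed
  obtain j i where r: "r = int (g + 1) * j + int i" "i \<le> g" by (rule block_index)
  obtain k l where s: "s = int (g + 1) * k + int l" "l \<le> g" by (rule block_index)
  show ?thesis
    unfolding r(1) s(1) all[OF r(2)] all[OF s(2)] ..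
qed

lemma entry_weighted_sum:
  "entry (\<lambda>x. (\<Sum>j\<in>F. a j *\<^sub>R M j x) - T x) r s =
     (\<Sum>j\<in>F. of_real (a j) * entry (M j) r s) - entry T r s"
  by (simp add: entry_def)

lemma periodic_magic_formula:
  assumes per: "periodic_GMP C A"
  obtains l0 c0 l where "l0 > 0" "\<And>j. j < g \<Longrightarrow> l j > 0"
    "rational_op l0 c0 l C A = two_sided_shift N"
proof -
  let ?X = "generator C A"
  have "\<exists>x>0. entry (?X j) (int j) (int j + int N) = complex_of_real x" if "j \<le> g" for j
    using tip_bandD(4)[OF generator_band[OF that]] by blast
  then obtain t where t: "\<And>j. j \<le> g \<Longrightarrow> t j > 0"
    "\<And>j. j \<le> g \<Longrightarrow> entry (?X j) (int j) (int j + int N) = complex_of_real (t j)"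
    by metis
  \<comment> \<open>The weights make the extreme entries of the sum equal to 1, as in \<open>T\<close>.\<close>
  define l where "l j = 1 / t j" for j
  define D where "D = (\<lambda>x. (\<Sum>j\<le>g. l j *\<^sub>R ?X j x) - two_sided_shift N x)"
  have D: "bounded_clinear D"
    unfolding D_def
    by (intro bounded_clinear_sub bounded_clinear_cmul bounded_clinear_sum
        generator_bounded[OF A g N] bounded_clinear_two_sided_shift) auto
  have ent: "entry D r s = (\<Sum>j\<le>g. of_real (l j) * entry (?X j) r s) - entry (two_sided_shift N) r s" for r s
    unfolding D_def by (rule entry_weighted_sum)
  have sym: "entry D r s = entry D s r" for r s
    unfolding ent entry_two_sided_shift
    by (intro arg_cong2[of _ _ _ _ "(-)"] sum.cong arg_cong2[of _ _ _ _ "(*)"] tip_bandD(2)[OF generator_band])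
       auto
  have tip: "entry D r (r + int N) = 0" for r
  proof -
    have "N > 0" using N by simp
    then obtain j k where j: "j < N" "r = int j + k * int N" "r mod int N = int j mod int N"
      by (rule block_residue)
    have "entry (?X j) r (r + int N) = entry (?X j) (int j + k * int N) ((int j + int N) + k * int N)"
      unfolding j(2) by (simp add: algebra_simps)
    also have "\<dots> = entry (?X j) (int j) (int j + int N)"
      by (rule shift_commute_entry_mult) (use j(1) N generator_periodic[OF A g N per] in simp)
    also have "\<dots> = complex_of_real (t j)"
      using t j(1) N by simp
    finally have "of_real (l j) * entry (?X j) r (r + int N) = 1"
      using t(1)[of j] j(1) N by (simp add: l_def)
    moreover have "(\<Sum>i\<le>g. of_real (l i) * entry (?X i) r (r + int N)) =
        (\<Sum>i\<in>{j}. of_real (l i) * entry (?X i) r (r + int N))"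
    proof (rule sum.mono_neutral_right)
      show "\<forall>i\<in>{..g} - {j}. of_real (l i) * entry (?X i) r (r + int N) = 0"
      proof
        fix i assume i: "i \<in> {..g} - {j}"
        then have "r mod int N \<noteq> int i mod int N"
          using j N by auto
        then show "of_real (l i) * entry (?X i) r (r + int N) = 0"
          using tip_bandD(5)[OF generator_band[of i]] i by simp
      qed
    qed (use j N in auto)
    ultimately show ?thesis
      unfolding ent entry_two_sided_shift using N by simp
  qed
  have far: "entry D r s = 0" if "\<bar>r - s\<bar> > int g" for r s
  proof -
    from that consider "\<bar>r - s\<bar> > int N" | "s = r + int N" | "r = s + int N"
      using N by force
    then show ?thesis
    proof cases
      case 1
      have "entry (?X j) r s = 0" if "j \<le> g" for j
        by (rule tip_bandD(3)[OF generator_band[OF that] 1])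
      then show ?thesis unfolding ent entry_two_sided_shift using 1 by auto
    qed (use tip sym in metis)+
  qed
  have comm: "?X j (D x) = D (?X j x)" if j: "j \<le> g" for j x
  proof -
    note b = bounded_clinear_simps[OF generator_bounded[OF A g N j]]
    have 1: "?X j ((rshift ^^ N) x) = (rshift ^^ N) (?X j x)" for x
      by (rule generator_periodic[OF A g N per j, symmetric])
    have 2: "?X j ((inv rshift ^^ N) x) = (inv rshift ^^ N) (?X j x)"
      using arg_cong[OF 1[of "(inv rshift ^^ N) x"], of "inv rshift ^^ N"] by simp
    have "?X j (?X i x) = ?X i (?X j x)" if "i \<le> g" for i
      by (rule generator_generator_commute[OF A g N j that])
    then show ?thesis
      unfolding D_def two_sided_shift_def by (simp add: b 1 2)
  qed
  have commA: "A (D x) = D (A x)" for x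
    using comm[of g] g by (simp add: generator_def)
  note diag = banded_commutant_diagonal[OF D comm sym far]
  have real: "entry D 0 0 \<in> \<real>"
    unfolding ent entry_two_sided_shift
    using tip_bandD(6)[OF generator_band] by (intro Reals_diff sum_in_Reals Reals_mult Reals_add) auto
  then obtain c where c: "entry D 0 0 = of_real c"
    by (auto elim!: Reals_cases)
  have "D = (\<lambda>x. of_real c *\<^sub>C x)"
  proof (rule operator_eqI[OF D bounded_clinear_scaleC])
    fix r s
    show "entry D r s = entry (\<lambda>x. complex_of_real c *\<^sub>C x) r s"
    proof (cases "r = s")
      case True
      then show ?thesis
        using diagonal_commutant_scalar[OF per D commA diag, of r 0] c by (simp add: entry_def)
    next
      case False
      then show ?thesis using diag by (simp add: entry_def)
    qed
  qed
  then have "(\<Sum>j\<le>g. l j *\<^sub>R ?X j x) - two_sided_shift N x = c *\<^sub>R x" for x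
    unfolding D_def scaleR_eq_scaleC by (rule fun_cong)
  then have "rational_op (l g) (- c) l C A x = two_sided_shift N x" for x
    unfolding rational_op_alt[OF A g N]
    by (auto simp: lessThan_Suc_atMost[symmetric] algebra_simps)
  then show ?thesis
    using that[of "l g" l "-c"] t(1) by (auto simp: l_def)
qed

lemma magic_formula_periodic:
  assumes magic: "rational_op l0 c0 l C A = two_sided_shift N"
  shows "periodic_GMP C A" and "(rshift ^^ N) (A x) = A ((rshift ^^ N) x)"
proof -
  note AB = GMP_bounded[OF A g N]
  have bandA: "tip_band N (int g) A"
    using generator_band[of g] g by (simp add: generator_def)
  have "A (rational_op l0 c0 l C A x) = rational_op l0 c0 l C A (A x)" for x
    unfolding rational_op_alt[OF A g N]
    by (simp add: bounded_clinear_simps[OF AB] A_generator_commute[OF A g N])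
  then have comm: "A (two_sided_shift N x) = two_sided_shift N (A x)" for x
    by (simp add: magic)
  let ?X = "\<lambda>r s. entry A (r - int N) s - entry A r (s + int N)"
  \<comment> \<open>The matrix \<open>?X\<close> of \<open>S\<^sup>N A - A S\<^sup>N\<close> is constant along antidiagonals in steps of \<open>N\<close>; being banded, it vanishes.\<close>
  have X1: "?X r s = ?X (r + int N) (s - int N)" for r s
    using arg_cong[OF comm[of "unit_vec s"], of "\<lambda>x. coord x r"]
    by (simp add: two_sided_shift_def bounded_clinear_simps[OF AB] entry_def
        coord_rshift_power coord_inv_rshift_power algebra_simps)
  have X: "?X r s = ?X (r + int k * int N) (s - int k * int N)" for r s k
  proof (induction k)
    case (Suc k)
    have *: "r + int (Suc k) * int N = r + int k * int N + int N"
      "s - int (Suc k) * int N = s - int k * int N - int N"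
      by (auto simp: algebra_simps)
    show ?case
      unfolding * Suc using X1[of "r + int k * int N" "s - int k * int N"] by simp
  qed simp
  have per: "entry A (r - int N) s = entry A r (s + int N)" for r s
  proof -
    \<comment> \<open>With this number of steps both entries of \<open>A\<close> lie outside the band.\<close>
    define k where "k = nat \<bar>r - s\<bar> + 3"
    have k: "int k \<le> int k * int N" using N mult_left_mono[of 1 "int N" "int k"] by simp
    then have "int k + int N \<le> int k * int N + int N"  by simp
    moreover have "3 * int N \<le> int k * int N"
      by (rule mult_right_mono) (simp_all add: k_def)
    moreover have "2 * (int k * int N) \<ge> int k + 3 * int N" using k calculation by linarith
    moreover have "int k > \<bar>r - s\<bar>" by (simp add: k_def)
    ultimately have "\<bar>(r + int k * int N - int N) - (s - int k * int N)\<bar> > int N"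
      "\<bar>(r + int k * int N) - (s - int k * int N + int N)\<bar> > int N"
      by linarith+
    then have "?X (r + int k * int N) (s - int k * int N) = 0"
      using tip_bandD(3)[OF bandA] by simp
    then show ?thesis using X[of r s k] by simp
  qed
  then have "(\<lambda>x. (rshift ^^ N) (A x)) = (\<lambda>x. A ((rshift ^^ N) x))"
    by (intro operator_eqI bounded_clinear_compose[OF bounded_clinear_rshift_power AB]
          bounded_clinear_compose[OF AB bounded_clinear_rshift_power])
       (simp add: entry_def coord_rshift_power)
  then have shift: "(rshift ^^ N) (A x) = A ((rshift ^^ N) x)" for x
    by (rule fun_cong)
  then show "(rshift ^^ N) (A x) = A ((rshift ^^ N) x)" .
  obtain p q where pq: "generating_coeffs C A p q"
    using A by (auto simp: GMP_def class_A_def)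
  note E = generating_coeffsD[OF pq g]
  have ent: "entry A (int (g + 1) * (j + m) + int i) (int (g + 1) * (k + m) + int l) =
     entry A (int (g + 1) * j + int i) (int (g + 1) * k + int l)" for i j k l m
    using shift_commute_entry_mult[where M = A and N = N and k = m, OF shift,
        of "int (g + 1) * j + int i" "int (g + 1) * k + int l"] N
    by (simp add: algebra_simps)
  have be: "block_entry C p q (j + m) (k + m) i l = block_entry C p q j k i l" if "i \<le> g" "l \<le> g" for i j k l m
    using ent[of j m i k l] by (simp only: E(2)[OF that] of_real_eq_iff)
  have p: "p j i = p 0 i" if "i \<le> g" for i j
    using be[of g i "-1" j 0] that by (simp add: block_entry_def block_A_def outer_def g)
  have q: "q j i = q 0 i" if "i \<le> g" for i j
    using be[of g i 0 j 0] that p[of g j] E(1)[of 0]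
    by (auto simp: block_entry_def block_B_def strict_upper_def lower_def outer_def g)
  have "block_entry C p q j k i l = block_entry C (\<lambda>_. p 0) (\<lambda>_. q 0) j k i l" if "i \<le> g" "l \<le> g" for j k i l
    using p[OF that(1), of j] p[OF that(2), of j] p[OF that(1), of "j + 1"] p[OF that(2), of "j + 1"]
      q[OF that(1), of j] q[OF that(2), of j]
    by (auto simp: block_entry_def block_A_def block_B_def strict_upper_def lower_def outer_def Let_def)
  then have "generating_coeffs C A (\<lambda>_. p 0) (\<lambda>_. q 0)"
    using E unfolding generating_coeffs_def Let_def g by simp
  then show "periodic_GMP C A"
    by (auto simp: periodic_GMP_def)
qed

end

section \<open>The two-sided shift\<close>

lemma isometry_neumann:
  assumes U: "bounded_clinear U" and iso: "\<And>x. norm (U x) = norm x" and mu: "cmod \<mu> < 1"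
  obtains B where "bounded_clinear B" "\<And>x. B x - \<mu> *\<^sub>C U (B x) = x" "\<And>x. B (x - \<mu> *\<^sub>C U x) = x"
proof -
  note u = bounded_clinear_simps[OF U]
  have "\<exists>!y. x + \<mu> *\<^sub>C U y = y" for x
  proof -
    have "dist (x + \<mu> *\<^sub>C U y) (x + \<mu> *\<^sub>C U z) = cmod \<mu> * dist y z" for y z
    proof -
      have "x + \<mu> *\<^sub>C U y - (x + \<mu> *\<^sub>C U z) = \<mu> *\<^sub>C U (y - z)"
        by (simp add: u)
      then show ?thesis by (simp add: dist_norm iso)
    qed
    then show ?thesis
      by (intro banach_fix_type[OF _ mu]) auto
  qed
  then obtain B where B: "\<And>x. x + \<mu> *\<^sub>C U (B x) = B x"
    and uniq: "\<And>x y. x + \<mu> *\<^sub>C U y = y \<Longrightarrow> y = B x"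
    by metis
  have "norm (B x) \<le> norm x * (1 / (1 - cmod \<mu>))" for x
    using norm_triangle_ineq[of x "\<mu> *\<^sub>C U (B x)"] mu by (simp add: B iso field_simps)
  moreover have "B (x + y) = B x + B y" for x y
    using B[of x] B[of y] by (intro uniq[symmetric]) (simp add: u, metis add.assoc add.commute)
  moreover have "B (c *\<^sub>C x) = c *\<^sub>C B x" for c x
  proof (intro uniq[symmetric])
    have "c *\<^sub>C x + \<mu> *\<^sub>C U (c *\<^sub>C B x) = c *\<^sub>C (x + \<mu> *\<^sub>C U (B x))"
      by (simp add: u mult.commute)
    then show "c *\<^sub>C x + \<mu> *\<^sub>C U (c *\<^sub>C B x) = c *\<^sub>C B x" by (simp only: B)
  qed
  ultimately have "bounded_clinear B"
    by (intro bounded_clinearI)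
  moreover have "B x - \<mu> *\<^sub>C U (B x) = x" for x
    using B[of x] by (simp add: algebra_simps)
  moreover have "B (x - \<mu> *\<^sub>C U x) = x" for x
    by (rule uniq[symmetric]) simp
  ultimately show ?thesis using that by blast
qed

lemma joukowski_preimage:
  assumes "w \<notin> of_real ` {-2..2}"
  obtains \<mu> where "cmod \<mu> < 1" "\<mu> \<noteq> 0" "\<mu>\<^sup>2 + 1 = \<mu> * w"
proof -
  define r where "r = csqrt (w\<^sup>2 - 4)"
  have r: "r\<^sup>2 = w\<^sup>2 - 4" by (simp add: r_def)
  define a b where "a = (w - r) / 2" and "b = (w + r) / 2"
  have ab: "a * b = 1" "a + b = w"
    using r by (auto simp: a_def b_def field_simps power2_eq_square)
  have q: "a\<^sup>2 + 1 = a * w" "b\<^sup>2 + 1 = b * w"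
    using ab by (auto simp: power2_eq_square algebra_simps simp flip: ab(2))
  have prod: "cmod a * cmod b = 1" using ab(1) by (metis norm_mult norm_one)
  have "cmod a \<noteq> 1"
  proof
    assume a: "cmod a = 1"
    then have "a * cnj a = 1" by (simp add: complex_norm_square[symmetric])
    then have "b = cnj a" using ab(1) a
      by (metis mult_cancel_left norm_eq_zero zero_neq_one)
    then have "w = of_real (2 * Re a)" using ab(2) complex_add_cnj[of a] by simp
    moreover have "2 * Re a \<in> {-2..2}" using a abs_Re_le_cmod[of a] by auto
    ultimately show False using assms by blast
  qed
  moreover have False if "cmod a > 1" "cmod b \<ge> 1"
    using mult_left_mono[OF that(2), of "cmod a"] that(1) prod by simp
  ultimately consider "cmod a < 1" | "cmod b < 1"
    by fastforce
  then show ?thesis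
    using that[of a] that[of b] q prod by cases fastforce+
qed

text \<open>For \<open>w = \<mu> + 1 / \<mu>\<close> with \<open>\<bar>\<mu>\<bar> < 1\<close> the operator \<open>S\<^sup>N + S\<^sup>-\<^sup>N - w\<close> is a multiple of the product
  of \<open>1 - \<mu> S\<^sup>N\<close> and \<open>1 - \<mu> S\<^sup>-\<^sup>N\<close>.\<close>

lemma two_sided_shift_inverse:
  assumes "w \<notin> of_real ` {-2..2}"
  obtains B where "bounded_clinear B" "\<And>x. two_sided_shift N (B x) - w *\<^sub>C B x = x"
    "\<And>x. B (two_sided_shift N x - w *\<^sub>C x) = x"
proof -
  obtain \<mu> where mu: "cmod \<mu> < 1" "\<mu> \<noteq> 0" "\<mu>\<^sup>2 + 1 = \<mu> * w"
    using joukowski_preimage[OF assms] by blast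
  let ?S = "rshift ^^ N" and ?R = "inv rshift ^^ N"
  obtain B1 where B1: "bounded_clinear B1" "\<And>x. B1 x - \<mu> *\<^sub>C ?S (B1 x) = x" "\<And>x. B1 (x - \<mu> *\<^sub>C ?S x) = x"
    using isometry_neumann[OF bounded_clinear_rshift_power _ mu(1)] by (metis norm_rshift_power)
  obtain B2 where B2: "bounded_clinear B2" "\<And>x. B2 x - \<mu> *\<^sub>C ?R (B2 x) = x" "\<And>x. B2 (x - \<mu> *\<^sub>C ?R x) = x"
    using isometry_neumann[OF bounded_clinear_inv_rshift_power _ mu(1)] by (metis norm_inv_rshift_power)
  have factor: "(x - \<mu> *\<^sub>C ?R x) - \<mu> *\<^sub>C ?S (x - \<mu> *\<^sub>C ?R x) = - \<mu> *\<^sub>C (two_sided_shift N x - w *\<^sub>C x)" for x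
  proof -
    have "(x - \<mu> *\<^sub>C ?R x) - \<mu> *\<^sub>C ?S (x - \<mu> *\<^sub>C ?R x) = (\<mu>\<^sup>2 + 1) *\<^sub>C x - \<mu> *\<^sub>C two_sided_shift N x"
      by (rule l2Z_eqI) (simp add: coord_rshift_power coord_inv_rshift_power two_sided_shift_def algebra_simps power2_eq_square)
    also have "\<dots> = - \<mu> *\<^sub>C (two_sided_shift N x - w *\<^sub>C x)"
      unfolding mu(3) by (rule l2Z_eqI) (simp add: algebra_simps)
    finally show ?thesis .
  qed
  define B where "B x = - \<mu> *\<^sub>C B2 (B1 x)" for x
  show ?thesis
  proof (rule that[of B])
    show "bounded_clinear B"
      unfolding B_def[abs_def] by (intro bounded_clinear_cmul bounded_clinear_compose[OF B2(1) B1(1)])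
    show "B (two_sided_shift N x - w *\<^sub>C x) = x" for x
    proof -
      have "B2 (B1 (- \<mu> *\<^sub>C (two_sided_shift N x - w *\<^sub>C x))) = x"
        by (simp only: factor[symmetric] B1 B2)
      then show ?thesis
        unfolding B_def by (simp add: bounded_clinear_simps[OF B1(1)] bounded_clinear_simps[OF B2(1)] del: scaleC_simps(2))
    qed
    show "two_sided_shift N (B x) - w *\<^sub>C B x = x" for x
    proof -
      have "- \<mu> *\<^sub>C (two_sided_shift N (B2 (B1 x)) - w *\<^sub>C B2 (B1 x)) = x"
        by (simp only: factor[symmetric] B1 B2)
      then show ?thesis
        unfolding B_def bounded_clinear_simps[OF bounded_clinear_two_sided_shift]
        by (simp add: mult.commute)
    qed
  qed
qed

text \<open>Truncated plane waves supported on one residue class are Weyl sequences: applying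
  \<open>S\<^sup>N + S\<^sup>-\<^sup>N - w\<close> leaves only four boundary terms.\<close>

lemma two_sided_shift_weyl:
  fixes \<mu> :: complex and m :: int and N :: nat
  assumes "cmod \<mu> = 1"
  defines "f \<equiv> \<lambda>L. \<Sum>j<L. \<mu> ^ j *\<^sub>C unit_vec (m + int j * int N)"
  shows "norm (two_sided_shift N (f L) - (\<mu> + 1 / \<mu>) *\<^sub>C f L) \<le> 4"
proof -
  have mu: "\<mu> \<noteq> 0" using assms by auto
  let ?e = "\<lambda>j::int. unit_vec (m + j * int N)"
  note T = bounded_clinear_simps[OF bounded_clinear_two_sided_shift]
  have Te: "two_sided_shift N (?e j) = ?e (j + 1) + ?e (j - 1)" for j
    by (simp add: two_sided_shift_def algebra_simps)
  have e1: "norm (unit_vec n) = 1" for n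
  proof -
    have "(norm (unit_vec n))\<^sup>2 = (\<Sum>\<^sub>\<infinity>k\<in>{n}. 1)"
      unfolding norm_l2Z_power2 by (rule infsum_cong_neutral) auto
    then show ?thesis using norm_ge_zero[of "unit_vec n"] by (auto simp: power2_eq_1_iff)
  qed
  have "two_sided_shift N (f L) - (\<mu> + 1 / \<mu>) *\<^sub>C f L =
      ((\<mu> ^ L / \<mu>) *\<^sub>C ?e (int L) - (1 / \<mu>) *\<^sub>C ?e 0) + (?e (- 1) - \<mu> ^ L *\<^sub>C ?e (int L - 1))"
  proof (induction L)
    case 0
    then show ?case using mu by (simp add: f_def T)
  next
    case (Suc L)
    have "f (Suc L) = f L + \<mu> ^ L *\<^sub>C ?e (int L)"
      by (simp add: f_def)
    then have "two_sided_shift N (f (Suc L)) - (\<mu> + 1 / \<mu>) *\<^sub>C f (Suc L) =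
       (two_sided_shift N (f L) - (\<mu> + 1 / \<mu>) *\<^sub>C f L) +
       (\<mu> ^ L *\<^sub>C (?e (int L + 1) + ?e (int L - 1)) - ((\<mu> + 1 / \<mu>) * \<mu> ^ L) *\<^sub>C ?e (int L))"
      by (simp add: T Te)
    also have "\<dots> = ((\<mu> ^ Suc L / \<mu>) *\<^sub>C ?e (int (Suc L)) - (1 / \<mu>) *\<^sub>C ?e 0) +
        (?e (- 1) - \<mu> ^ Suc L *\<^sub>C ?e (int (Suc L) - 1))"
      unfolding Suc using mu by (intro l2Z_eqI) (simp add: field_simps)
    finally show ?case .
  qed
  also have "norm \<dots> \<le> norm ((\<mu> ^ L / \<mu>) *\<^sub>C ?e (int L) - (1 / \<mu>) *\<^sub>C ?e 0) + norm (?e (- 1) - \<mu> ^ L *\<^sub>C ?e (int L - 1))"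
    by (rule norm_triangle_ineq)
  also have "\<dots> \<le> (1 + 1) + (1 + 1)"
    by (intro add_mono order.trans[OF norm_triangle_ineq4])
       (simp_all add: e1 norm_divide norm_power assms)
  finally show ?thesis by simp
qed


text \<open>If \<open>K Y = S\<^sup>N + S\<^sup>-\<^sup>N - w\<close> with \<open>Y\<close> periodic and banded, then \<open>K\<close> is not bounded below. For
  \<open>w = \<mu> + 1 / \<mu>\<close> with \<open>\<bar>\<mu>\<bar> = 1\<close>, the Weyl sequence is the image under \<open>Y\<close> of a truncated plane wave on
  the class of \<open>m\<close>. Along the class of some row \<open>r\<close> with \<open>entry Y r m \<noteq> 0\<close> it is, away
  from the ends, a multiple of a plane wave, and the factor is nonzero for at least one of the two
  possible \<open>\<mu>\<close>. This is where \<open>\<bar>w\<bar> < 2\<close> is used.\<close>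

lemma weyl_sequence:
  assumes Y: "bounded_clinear Y" and shift: "\<And>x. (rshift ^^ N) (Y x) = Y ((rshift ^^ N) x)"
    and N: "N > 0"
    and K: "\<And>x. K (Y x) = two_sided_shift N x - of_real w *\<^sub>C x" and K0: "K 0 = 0"
    and near: "\<And>r. \<bar>r - m\<bar> \<ge> int N \<Longrightarrow> entry Y r m = 0"
    and w: "\<bar>w\<bar> < 2" and c: "c > 0"
  shows "\<exists>x. norm (K x) < c * norm x"
proof (rule ccontr)
  assume "\<not> ?thesis"
  then have lower: "c * norm x \<le> norm (K x)" for x by (meson not_le)
  \<comment> \<open>The two solutions of \<open>\<mu> + 1 / \<mu> = w\<close> are \<open>cis \<theta>\<close> and \<open>cis (- \<theta>)\<close>.\<close>
  define \<theta> where "\<theta> = arccos (w / 2)"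
  have \<theta>: "cos \<theta> = w / 2" "sin \<theta> \<noteq> 0"
    using w by (auto simp: \<theta>_def sin_arccos_nonzero)
  have "\<exists>r. entry Y r m \<noteq> 0"
  proof (rule ccontr)
    assume "\<not> ?thesis"
    then have "Y (unit_vec m) = 0" by (intro l2Z_eqI) (simp add: entry_def)
    then have "coord (two_sided_shift N (unit_vec m) - of_real w *\<^sub>C unit_vec m) (m + int N) = 0"
      using K[of "unit_vec m"] K0 by simp
    then show False using N by (simp add: two_sided_shift_def)
  qed
  then obtain r where r: "entry Y r m \<noteq> 0" by blast
  define y where "y j = entry Y r (m + j * int N)" for j
  have yalt: "y j = entry Y (r - j * int N) m" for j
    using shift_commute_entry_mult[where M = Y and N = N and k = j, OF shift, of "r - j * int N" m]
    by (simp add: y_def)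
  have y0: "y 0 \<noteq> 0" using r by (simp add: y_def)
  have rm: "\<bar>r - m\<bar> < int N" using near r by (meson not_le)
  \<comment> \<open>Besides \<open>y 0\<close>, at most one neighbouring entry \<open>y \<sigma>\<close> can be nonzero, since all entries of column \<open>m\<close> lie at distance less than \<open>N\<close>.\<close>
  define \<sigma> :: int where "\<sigma> = (if r > m then 1 else -1)"
  have yz: "y j = 0" if "j \<noteq> 0" "j \<noteq> \<sigma>" for j
  proof -
    have "\<bar>r - j * int N - m\<bar> \<ge> int N"
    proof (cases "r > m")
      case True
      then have "j \<le> -1 \<or> j \<ge> 2" using that by (auto simp: \<sigma>_def)
      then have "j * int N \<le> - 1 * int N \<or> j * int N \<ge> 2 * int N"
        by (metis mult_right_mono of_nat_0_le_iff)
      then show ?thesis using True rm by linarith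
    next
      case False
      then have "j \<le> -2 \<or> j \<ge> 1" using that by (auto simp: \<sigma>_def)
      then have "j * int N \<le> - 2 * int N \<or> j * int N \<ge> 1 * int N"
        by (metis mult_right_mono of_nat_0_le_iff)
      then show ?thesis using False rm by linarith
    qed
    then show ?thesis unfolding yalt by (rule near)
  qed
  obtain \<mu> where mu: "cmod \<mu> = 1" "\<mu> + 1 / \<mu> = of_real w" "y 0 + y \<sigma> * (\<mu> powi \<sigma>) \<noteq> 0"
  proof (rule ccontr)
    assume "\<not> thesis"
    then have neg': "y 0 + y \<sigma> * (\<mu> powi \<sigma>) = 0" if "cmod \<mu> = 1" "\<mu> + 1 / \<mu> = of_real w" for \<mu>
      using that \<open>\<And>\<mu>. cmod \<mu> = 1 \<Longrightarrow> \<mu> + 1 / \<mu> = of_real w \<Longrightarrow>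
        y 0 + y \<sigma> * (\<mu> powi \<sigma>) \<noteq> 0 \<Longrightarrow> thesis\<close> by metis
    have zero: "y 0 + y \<sigma> * (cis t powi \<sigma>) = 0" if "cos t = w / 2" for t
    proof -
      have "1 / cis t = cis (- t)" by (simp add: divide_inverse)
      then have "cis t + 1 / cis t = of_real w"
        using that by (intro complex_eqI) simp_all
      then show ?thesis by (intro neg') simp
    qed
    have "y \<sigma> * (cis \<theta> powi \<sigma> - cis (- \<theta>) powi \<sigma>) =
        (y 0 + y \<sigma> * (cis \<theta> powi \<sigma>)) - (y 0 + y \<sigma> * (cis (- \<theta>) powi \<sigma>))"
      by (simp add: algebra_simps)
    also have "\<dots> = 0"
      using zero[of \<theta>] zero[of "- \<theta>"] \<theta>(1) by simp
    finally have "y \<sigma> * (cis \<theta> powi \<sigma> - cis (- \<theta>) powi \<sigma>) = 0" .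
    moreover have "cis \<theta> powi \<sigma> - cis (- \<theta>) powi \<sigma> \<noteq> 0"
      using \<theta>(2) by (auto simp: \<sigma>_def complex_eq_iff power_int_minus)
    ultimately have "y \<sigma> = 0" by simp
    then show False using zero[OF \<theta>(1)] y0 by simp
  qed
  have mu0: "\<mu> \<noteq> 0" using mu by auto
  define \<rho> where "\<rho> = cmod (y 0 + y \<sigma> * (\<mu> powi \<sigma>))"
  define f where "f L = (\<Sum>j<L. \<mu> ^ j *\<^sub>C unit_vec (m + int j * int N))" for L :: nat
  have coordY: "cmod (coord (Y (f L)) (r + int i * int N)) = \<rho>" if i: "1 \<le> i" "i + 1 < L" for i L
  proof -
    have ent: "entry Y (r + int i * int N) (m + int j * int N) = y (int j - int i)" for j
      using shift_commute_entry_mult[where M = Y and N = N and k = "int i", OF shift,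
          of r "m + (int j - int i) * int N"]
      by (simp add: y_def algebra_simps)
    have "coord (Y (f L)) (r + int i * int N) = (\<Sum>j<L. \<mu> ^ j * y (int j - int i))"
      by (simp add: f_def bounded_clinear_simps[OF Y] ent[symmetric] entry_def)
    also have "\<dots> = (\<Sum>j\<in>{i, nat (int i + \<sigma>)}. \<mu> ^ j * y (int j - int i))"
    proof (rule sum.mono_neutral_right)
      show "\<forall>j\<in>{..<L} - {i, nat (int i + \<sigma>)}. \<mu> ^ j * y (int j - int i) = 0"
        using yz by (auto simp: \<sigma>_def)
    qed (use i in \<open>auto simp: \<sigma>_def\<close>)
    also have "\<dots> = \<mu> ^ i * (y 0 + y \<sigma> * (\<mu> powi \<sigma>))"
      using i mu0 by (auto simp: \<sigma>_def nat_add_distrib nat_diff_distrib power_int_minus field_simps power_diff)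
    finally show ?thesis
      by (simp add: \<rho>_def norm_mult norm_power mu(1))
  qed
  have bound: "c\<^sup>2 * (real L * \<rho>\<^sup>2) \<le> 16" for L
  proof -
    let ?F = "(\<lambda>i. r + int i * int N) ` {1..L}"
    have inj: "inj_on (\<lambda>i. r + int i * int N) {1..L}"
      using N by (auto simp: inj_on_def)
    have "real L * \<rho>\<^sup>2 = (\<Sum>n\<in>?F. (cmod (coord (Y (f (L + 2))) n))\<^sup>2)"
      by (subst sum.reindex[OF inj]) (simp add: coordY)
    also have "\<dots> \<le> (norm (Y (f (L + 2))))\<^sup>2"
      by (rule sum_coord_le_norm) simp
    finally have "c\<^sup>2 * (real L * \<rho>\<^sup>2) \<le> (c * norm (Y (f (L + 2))))\<^sup>2"
      by (simp add: power_mult_distrib mult_left_mono)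
    also have "\<dots> \<le> (norm (K (Y (f (L + 2)))))\<^sup>2"
      using lower c by (intro power_mono) auto
    also have "\<dots> \<le> 4\<^sup>2"
      using two_sided_shift_weyl[OF mu(1), where N = N and L = "L + 2" and m = m]
      unfolding K mu(2)[symmetric] f_def by (intro power_mono) auto
    finally show ?thesis by simp
  qed
  have "c\<^sup>2 * \<rho>\<^sup>2 > 0" using c mu(3) by (simp add: \<rho>_def)
  then obtain L where "real L * (c\<^sup>2 * \<rho>\<^sup>2) > 16"
    using reals_Archimedean3 by blast
  then show False using bound[of L] by (simp add: algebra_simps)
qed


section \<open>Rational functions of Herglotz type\<close>

text \<open>The scalar function belonging to \<open>rational_op\<close>, over the reals and over the complex numbers. At a pole
  \<open>C ! j\<close> the corresponding term has the default value 0; statements about values exclude the poles.\<close>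

definition rational_fun ::
    "real \<Rightarrow> real \<Rightarrow> (nat \<Rightarrow> real) \<Rightarrow> real list \<Rightarrow> 'a::real_normed_field \<Rightarrow> 'a" where
  "rational_fun l0 c0 l C z = of_real l0 * z + of_real c0
     + (\<Sum>j<length C. of_real (l j) / (of_real (C ! j) - z))"

lemma rational_fun_of_real: "rational_fun l0 c0 l C (of_real x) = complex_of_real (rational_fun l0 c0 l C x)"
  by (simp add: rational_fun_def)

lemma Im_rational_fun:
  "Im (rational_fun l0 c0 l C z) = Im z * (l0 + (\<Sum>j<length C. l j / (cmod (of_real (C ! j) - z))\<^sup>2))"
proof -
  have "Im (of_real a / (of_real c - z)) = Im z * (a / (cmod (of_real c - z))\<^sup>2)" for a c :: real
    by (simp add: Im_divide cmod_power2 power2_commute)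
  then show ?thesis
    by (simp add: rational_fun_def algebra_simps sum_distrib_left)
qed

lemma rational_fun_real_value:
  assumes "l0 > 0" "\<And>j. j < length C \<Longrightarrow> l j > 0" "rational_fun l0 c0 l C z = complex_of_real w"
  shows "z = of_real (Re z)"
proof -
  have "l0 + (\<Sum>j<length C. l j / (cmod (of_real (C ! j) - z))\<^sup>2) > 0"
    using assms by (intro add_pos_nonneg sum_nonneg divide_nonneg_nonneg) (auto intro: less_imp_le)
  moreover have "Im (rational_fun l0 c0 l C z) = 0"
    using assms by simp
  ultimately have "Im z = 0"
    unfolding Im_rational_fun by auto
  then show ?thesis by (simp add: complex_eq_iff)
qed

lemma rational_fun_deriv:
  fixes x :: real
  assumes "x \<notin> set C"
  shows "(rational_fun l0 c0 l C has_real_derivative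
           l0 + (\<Sum>j<length C. l j / (C ! j - x)\<^sup>2)) (at x)"
proof -
  have "C ! j - x \<noteq> 0" if "j < length C" for j
    using assms that nth_mem by fastforce
  then show ?thesis
    unfolding rational_fun_def[abs_def]
    by (auto intro!: derivative_eq_intros sum.cong simp: power2_eq_square divide_simps)
qed

lemma rational_fun_increasing:
  fixes x :: real
  assumes "l0 > 0" "\<And>j. j < length C \<Longrightarrow> l j > 0" "x \<notin> set C"
  obtains d where "d > 0" "\<And>h. 0 < h \<Longrightarrow> h < d \<Longrightarrow> rational_fun l0 c0 l C x < rational_fun l0 c0 l C (x + h)"
    "\<And>h. 0 < h \<Longrightarrow> h < d \<Longrightarrow> rational_fun l0 c0 l C (x - h) < rational_fun l0 c0 l C x"
proof -
  have pos: "0 < l0 + (\<Sum>j<length C. l j / (C ! j - x)\<^sup>2)"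
    using assms by (intro add_pos_nonneg sum_nonneg divide_nonneg_nonneg) (auto intro: less_imp_le)
  note D = rational_fun_deriv[OF assms(3), of l0 c0 l]
  obtain d1 d2 where "d1 > 0" "\<forall>h>0. h < d1 \<longrightarrow> rational_fun l0 c0 l C x < rational_fun l0 c0 l C (x + h)"
    "d2 > 0" "\<forall>h>0. h < d2 \<longrightarrow> rational_fun l0 c0 l C (x - h) < rational_fun l0 c0 l C x"
    using DERIV_pos_inc_right[OF D pos] DERIV_pos_inc_left[OF D pos] by blast
  then show ?thesis
    by (intro that[of "min d1 d2"]) auto
qed

lemma rational_fun_near:
  fixes x :: real
  assumes "x \<notin> set C" "e > 0"
  obtains d where "d > 0" "\<And>y. \<bar>y - x\<bar> < d \<Longrightarrow> y \<notin> set C \<and>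
    \<bar>rational_fun l0 c0 l C y - rational_fun l0 c0 l C x\<bar> < e"
proof -
  have "isCont (rational_fun l0 c0 l C) x"
    by (rule DERIV_isCont[OF rational_fun_deriv[OF assms(1)]])
  then obtain d1 where d1: "d1 > 0" "\<And>y. \<bar>y - x\<bar> < d1 \<Longrightarrow>
    \<bar>rational_fun l0 c0 l C y - rational_fun l0 c0 l C x\<bar> < e"
    using assms(2) unfolding continuous_at_eps_delta dist_real_def by blast
  have "open (- set C)" by (intro open_Compl finite_imp_closed) simp
  then obtain d2 where d2: "d2 > 0" "\<And>y. \<bar>y - x\<bar> < d2 \<Longrightarrow> y \<notin> set C"
    using assms(1) unfolding open_dist dist_real_def by force
  show ?thesis
    using d1 d2 by (intro that[of "min d1 d2"]) auto
qed

text \<open>Points with value \<open>2\<close> or \<open>-2\<close> are limits of points with values strictly between.\<close>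

lemma rational_fun_approx:
  fixes x :: real
  assumes "l0 > 0" "\<And>j. j < length C \<Longrightarrow> l j > 0" "x \<notin> set C" "\<bar>rational_fun l0 c0 l C x\<bar> \<le> 2" "e > 0"
  shows "\<exists>y. \<bar>y - x\<bar> < e \<and> y \<notin> set C \<and> \<bar>rational_fun l0 c0 l C y\<bar> < 2"
proof -
  let ?f = "rational_fun l0 c0 l C"
  obtain d where d: "d > 0" "\<And>h. 0 < h \<Longrightarrow> h < d \<Longrightarrow> ?f x < ?f (x + h)"
    "\<And>h. 0 < h \<Longrightarrow> h < d \<Longrightarrow> ?f (x - h) < ?f x"
    using rational_fun_increasing[where ?c0.0 = c0 and l = l, OF assms(1-3)] by blast
  obtain d' where d': "d' > 0" "\<And>y. \<bar>y - x\<bar> < d' \<Longrightarrow> y \<notin> set C \<and> \<bar>?f y - ?f x\<bar> < 1"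
    using rational_fun_near[OF assms(3), of 1] by (metis zero_less_one)
  define h where "h = min (e / 2) (min (d / 2) (d' / 2))"
  have h: "0 < h" "h < e" "h < d" "h < d'"
    using assms(5) d d' by (auto simp: h_def min_def)
  show ?thesis
  proof (cases "?f x \<ge> 0")
    case True
    then show ?thesis
      using h d(3)[of h] d'(2)[of "x - h"] assms(4) by (intro exI[of _ "x - h"]) auto
  next
    case False
    then show ?thesis
      using h d(2)[of h] d'(2)[of "x + h"] assms(4) by (intro exI[of _ "x + h"]) auto
  qed
qed

section \<open>The spectrum under a magic formula\<close>

context
  fixes C :: "real list" and A :: "l2Z \<Rightarrow> l2Z" and g N :: nat
  assumes A: "A \<in> GMP C" and g: "length C = g" and N: "N = g + 1"
begin

text \<open>The operator \<open>(t(A) - t(z)) / (A - z)\<close>, where \<open>t\<close> is the rational function with the coefficients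
  \<open>l\<^sub>0\<close> and \<open>l\<close>; the constant term of \<open>t\<close> plays no role.\<close>

definition cofactor :: "real \<Rightarrow> (nat \<Rightarrow> real) \<Rightarrow> complex \<Rightarrow> l2Z \<Rightarrow> l2Z" where
  "cofactor l0 l z x = l0 *\<^sub>R x +
     (\<Sum>j<g. (of_real (l j) / (of_real (C ! j) - z)) *\<^sub>C resolvent (C ! j) A x)"

lemma bounded_cofactor: "bounded_clinear (cofactor l0 l z)"
  unfolding cofactor_def[abs_def]
  by (intro bounded_clinear_add bounded_clinear_cmul bounded_clinear_sum bounded_clinear_id
      GMP_resolvent(1)[OF A g N]) auto

lemma A_resolvent:
  assumes "j < g"
  shows "A (resolvent (C ! j) A x) = of_real (C ! j) *\<^sub>C resolvent (C ! j) A x - x"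
    "resolvent (C ! j) A (A x) = A (resolvent (C ! j) A x)"
  using GMP_resolvent(2)[OF A g N assms, of x] A_generator_commute[OF A g N, of j x] assms g
  by (auto simp: algebra_simps generator_def)

lemma cofactor_commute: "A (cofactor l0 l z x) = cofactor l0 l z (A x)"
  by (simp add: cofactor_def bounded_clinear_simps[OF GMP_bounded[OF A g N]] A_resolvent(2))

lemma cofactor_factorization:
  assumes z: "z \<notin> of_real ` set C"
  shows "A (cofactor l0 l z x) - z *\<^sub>C cofactor l0 l z x =
    rational_op l0 c0 l C A x - rational_fun l0 c0 l C z *\<^sub>C x"
proof -
  have nz: "complex_of_real (C ! j) - z \<noteq> 0" if "j < g" for j
    using z that g nth_mem by fastforce
  show ?thesis
  proof (rule l2Z_eqI)
    fix n
    have "coord (A (cofactor l0 l z x) - z *\<^sub>C cofactor l0 l z x) n =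
        of_real l0 * (coord (A x) n - z * coord x n) +
        (\<Sum>j<g. (of_real (l j) / (of_real (C ! j) - z)) *
           ((of_real (C ! j) - z) * coord (resolvent (C ! j) A x) n - coord x n))"
      by (simp add: cofactor_def bounded_clinear_simps[OF GMP_bounded[OF A g N]] A_resolvent(1)
          algebra_simps sum_distrib_left sum.distrib[symmetric] sum_subtractf[symmetric])
    also have "(\<Sum>j<g. (of_real (l j) / (of_real (C ! j) - z)) *
           ((of_real (C ! j) - z) * coord (resolvent (C ! j) A x) n - coord x n)) =
        (\<Sum>j<g. of_real (l j) * coord (resolvent (C ! j) A x) n
           - of_real (l j) / (of_real (C ! j) - z) * coord x n)"
      using nz by (intro sum.cong) (auto simp: right_diff_distrib)
    finally show "coord (A (cofactor l0 l z x) - z *\<^sub>C cofactor l0 l z x) n =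
        coord (rational_op l0 c0 l C A x - rational_fun l0 c0 l C z *\<^sub>C x) n"
      by (simp add: rational_op_def rational_fun_def g sum_subtractf sum_distrib_right
            sum_distrib_left algebra_simps)
  qed
qed

lemma not_in_spectrum:
  assumes z: "z \<notin> of_real ` set C"
    and magic: "rational_op l0 c0 l C A = two_sided_shift N"
    and w: "rational_fun l0 c0 l C z \<notin> of_real ` {-2..2}"
  shows "z \<notin> op_spectrum A"
proof -
  let ?Y = "cofactor l0 l z"
  note AB = GMP_bounded[OF A g N]
  have fact: "A (?Y x) - z *\<^sub>C ?Y x = two_sided_shift N x - rational_fun l0 c0 l C z *\<^sub>C x" for x
    using cofactor_factorization[OF z, of l0 l x c0] magic by simp
  obtain B where B: "bounded_clinear B"
    "\<And>x. two_sided_shift N (B x) - rational_fun l0 c0 l C z *\<^sub>C B x = x"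
    "\<And>x. B (two_sided_shift N x - rational_fun l0 c0 l C z *\<^sub>C x) = x"
    using two_sided_shift_inverse[OF w] by blast
  note b = bounded_clinear_simps[OF B(1)] and y = bounded_clinear_simps[OF bounded_cofactor]
  define L where "L x = (-1) *\<^sub>C B (?Y x)" for x
  define R where "R x = (-1) *\<^sub>C ?Y (B x)" for x
  have neg: "(-1) *\<^sub>C (x - y) = y - x" for x y :: l2Z
    by (rule l2Z_eqI) simp
  have left: "L (shifted_op z A x) = x" for x
  proof -
    have "L (shifted_op z A x) = B ((-1) *\<^sub>C (?Y (z *\<^sub>C x) - ?Y (A x)))"
      by (simp add: L_def shifted_op_def y b)
    also have "(-1) *\<^sub>C (?Y (z *\<^sub>C x) - ?Y (A x)) = A (?Y x) - z *\<^sub>C ?Y x"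
      by (simp only: neg cofactor_commute y)
    finally show ?thesis by (simp only: fact B)
  qed
  have right: "shifted_op z A (R x) = x" for x
  proof -
    have "shifted_op z A (R x) = (-1) *\<^sub>C (z *\<^sub>C ?Y (B x) - A (?Y (B x)))"
      by (simp only: R_def shifted_op_def bounded_clinear_simps[OF AB] scaleC_simps mult.commute)
    then show ?thesis by (simp only: neg fact B)
  qed
  have "L = R"
  proof
    fix x show "L x = R x" using left[of "R x"] right[of x] by simp
  qed
  then have "shifted_op z A \<circ> L = id" "L \<circ> shifted_op z A = id"
    using left right by (auto simp: fun_eq_iff)
  moreover have "bounded_clinear L"
    unfolding L_def[abs_def]
    by (intro bounded_clinear_cmul bounded_clinear_compose[OF B(1) bounded_cofactor])
  moreover have "bounded_clinear (shifted_op z A)"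
    unfolding shifted_op_def by (intro bounded_clinear_sub bounded_clinear_scaleC AB)
  ultimately show ?thesis
    by (auto simp: op_spectrum_def invertible_op_def)
qed

lemma no_lower_bound:
  assumes z: "z \<notin> set C" and pos: "c > 0"
    and magic: "rational_op l0 c0 l C A = two_sided_shift N"
    and w: "\<bar>rational_fun l0 c0 l C z\<bar> < 2"
  shows "\<exists>x. norm (A x - of_real z *\<^sub>C x) < c * norm x"
proof (rule weyl_sequence[where Y = "cofactor l0 l (of_real z)"
        and K = "\<lambda>x. A x - of_real z *\<^sub>C x" and N = N
        and w = "rational_fun l0 c0 l C z" and m = "int g"])
  note AB = GMP_bounded[OF A g N]
  have zc: "complex_of_real z \<notin> of_real ` set C" using z by auto
  show "bounded_clinear (cofactor l0 l (of_real z))" by (rule bounded_cofactor)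
  show "(rshift ^^ N) (cofactor l0 l (of_real z) x) = cofactor l0 l (of_real z) ((rshift ^^ N) x)" for x
  proof -
    have "(rshift ^^ N) (resolvent (C ! j) A y) = resolvent (C ! j) A ((rshift ^^ N) y)" if "j < g" for j y
      using generator_periodic[OF A g N magic_formula_periodic(1)[OF A g N magic], of j y] that g
      by (simp add: generator_def)
    then show ?thesis
      by (simp add: cofactor_def bounded_clinear_simps[OF bounded_clinear_rshift_power])
  qed
  show "A (cofactor l0 l (of_real z) x) - of_real z *\<^sub>C cofactor l0 l (of_real z) x =
      two_sided_shift N x - of_real (rational_fun l0 c0 l C z) *\<^sub>C x" for x
    using cofactor_factorization[OF zc, of l0 l x c0] magic by (simp add: rational_fun_of_real)
  show "A 0 - of_real z *\<^sub>C 0 = 0" by (simp add: bounded_clinear_simps[OF AB])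
  show "entry (cofactor l0 l (of_real z)) r (int g) = 0" if far: "\<bar>r - int g\<bar> \<ge> int N" for r
  proof -
    have "entry (resolvent (C ! j) A) r (int g) = 0" if "j < g" for j
    proof -
      have band: "tip_band N (int j) (resolvent (C ! j) A)"
        using GMP_generator_tip_band[OF A g N, of j] that g by (simp add: generator_def)
      have ne: "int g mod int N \<noteq> int j mod int N" "(int g - int N) mod int N \<noteq> int j mod int N"
        unfolding minus_mod_self2 using that N by simp_all
      from far consider "\<bar>r - int g\<bar> > int N" | "r = int g + int N" | "r = int g - int N"
        by linarith
      then show ?thesis
      proof cases
        case 1
        then show ?thesis by (rule tip_bandD(3)[OF band])
      next
        case 2
        then show ?thesis
          using tip_bandD(5)[OF band ne(1)] tip_bandD(2)[OF band, of r "int g"] by simp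
      next
        case 3
        then show ?thesis
          using tip_bandD(5)[OF band ne(2)] by simp
      qed
    qed
    moreover have "coord (unit_vec (int g)) r = 0" using far N by auto
    ultimately show ?thesis
      by (simp add: entry_def cofactor_def del: coord_simps(7))
  qed
qed (use N w pos in auto)

text \<open>Values \<open>t(z)\<close> in the open interval yield Weyl sequences for \<open>A\<close>; the two end points of the interval are
  reached by approximation, because being bounded below is stable under small shifts.\<close>

theorem spectrum_of_magic_formula:
  assumes magic: "rational_op l0 c0 l C A = two_sided_shift N"
    and l0: "l0 > 0" and l: "\<And>j. j < g \<Longrightarrow> l j > 0"
  shows "op_spectrum A = of_real ` {x. x \<notin> set C \<and> \<bar>rational_fun l0 c0 l C x\<bar> \<le> 2}"
proof (intro equalityI subsetI)
  fix z assume z: "z \<in> op_spectrum A"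
  have zC: "z \<notin> of_real ` set C"
  proof
    assume "z \<in> of_real ` set C"
    then obtain j where "j < g" "z = of_real (C ! j)"
      by (auto simp: in_set_conv_nth g)
    then show False
      using GMP_invertible[OF A g N, of j] z by (simp add: op_spectrum_def)
  qed
  then have "rational_fun l0 c0 l C z \<in> of_real ` {-2..2}"
    using not_in_spectrum[OF zC magic] z by blast
  then obtain w :: real where "w \<in> {-2..2}" and w2: "rational_fun l0 c0 l C z = of_real w"
    by blast
  then have w: "\<bar>w\<bar> \<le> 2" "rational_fun l0 c0 l C z = of_real w" by auto
  have zr: "z = of_real (Re z)"
    using rational_fun_real_value[OF l0 _ w(2)] l g by simp
  then have "rational_fun l0 c0 l C (Re z) = w"
    using w(2) rational_fun_of_real[of l0 c0 l C "Re z"] by simp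
  moreover have "Re z \<notin> set C" using zC zr by (metis imageI)
  ultimately have "Re z \<in> {x. x \<notin> set C \<and> \<bar>rational_fun l0 c0 l C x\<bar> \<le> 2}"
    using w(1) by simp
  then show "z \<in> of_real ` {x. x \<notin> set C \<and> \<bar>rational_fun l0 c0 l C x\<bar> \<le> 2}"
    using zr by (rule rev_image_eqI)
next
  fix z :: complex
  assume "z \<in> of_real ` {x. x \<notin> set C \<and> \<bar>rational_fun l0 c0 l C x\<bar> \<le> 2}"
  then obtain x where x: "z = of_real x" "x \<notin> set C" "\<bar>rational_fun l0 c0 l C x\<bar> \<le> 2"
    by auto
  show "z \<in> op_spectrum A"
  proof (rule ccontr)
    assume "z \<notin> op_spectrum A"
    then obtain B where B: "bounded_clinear B" "B \<circ> shifted_op z A = id"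
      by (auto simp: op_spectrum_def invertible_op_def)
    obtain K where K: "K > 0" "\<And>x. norm (B x) \<le> norm x * K"
      using bounded_clinear_bound[OF B(1)] by blast
    have lower: "norm y \<le> norm (A y - z *\<^sub>C y) * K" for y
      using K(2)[of "shifted_op z A y"] pointfree_idE[OF B(2), of y]
      by (simp add: shifted_op_def norm_minus_commute)
    have "1 / (2 * K) > 0" using K by simp
    from rational_fun_approx[OF l0 _ x(2,3) this] l g obtain x'
      where x': "\<bar>x' - x\<bar> < 1 / (2 * K)" "x' \<notin> set C" "\<bar>rational_fun l0 c0 l C x'\<bar> < 2"
      by blast
    obtain y where y: "norm (A y - of_real x' *\<^sub>C y) < 1 / (2 * K) * norm y"
      using no_lower_bound[OF x'(2) _ magic x'(3)] \<open>1 / (2 * K) > 0\<close> by blast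
    have split: "A y - z *\<^sub>C y = (A y - of_real x' *\<^sub>C y) + of_real (x' - x) *\<^sub>C y"
      by (rule l2Z_eqI) (simp add: x(1) algebra_simps)
    have "norm (A y - z *\<^sub>C y) \<le> norm (A y - of_real x' *\<^sub>C y) + \<bar>x' - x\<bar> * norm y"
      unfolding split using norm_triangle_ineq[of "A y - of_real x' *\<^sub>C y" "of_real (x' - x) *\<^sub>C y"]
      by (simp del: of_real_diff)
    also have "\<dots> < 1 / (2 * K) * norm y + 1 / (2 * K) * norm y"
      using y x'(1) by (intro add_less_le_mono mult_right_mono) auto
    also have "\<dots> = norm y / K" by simp
    finally have "norm (A y - z *\<^sub>C y) * K < norm y"
      using K(1) by (simp add: pos_less_divide_eq)
    then show False using lower[of y] by simp
  qed
qed

end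

section \<open>Partial fractions\<close>

lemma poly_factor_distinct_roots:
  fixes p :: "real poly"
  assumes "finite A" "\<And>a. a \<in> A \<Longrightarrow> poly p a = 0"
  shows "\<exists>M. p = M * (\<Prod>a\<in>A. [:a, -1:])"
  using assms
proof (induction A rule: finite_induct)
  case (insert b A)
  then obtain M where M: "p = M * (\<Prod>a\<in>A. [:a, -1:])" by auto
  have "poly (\<Prod>a\<in>A. [:a, -1:]) b \<noteq> 0"
    using insert.hyps by (auto simp: poly_prod)
  then have "poly M b = 0"
    using insert.prems[of b] by (simp add: M)
  then obtain M' where "M = [:- b, 1:] * M'"
    by (auto simp: poly_eq_0_iff_dvd dvd_def)
  also have "\<dots> = (- M') * [:b, -1:]" by simp
  finally have "p = (- M') * (\<Prod>a\<in>insert b A. [:a, -1:])"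
    by (simp only: M prod.insert[OF insert.hyps(1,2)] mult.assoc)
  then show ?case by blast
qed simp

text \<open>The product of the linear factors \<open>C ! j - x\<close> with \<open>j \<in> J\<close>.\<close>

definition node_poly :: "real list \<Rightarrow> nat set \<Rightarrow> real poly" where
  "node_poly C J = (\<Prod>j\<in>J. [:C ! j, -1:])"

lemma poly_node_poly: "poly (node_poly C J) x = (\<Prod>j\<in>J. C ! j - x)"
  by (simp add: node_poly_def poly_prod)

lemma degree_node_poly: "finite J \<Longrightarrow> degree (node_poly C J) = card J"
  unfolding node_poly_def by (subst degree_prod_sum_eq) auto

lemma node_poly_nonzero:
  assumes "distinct C" "j < length C"
  shows "poly (node_poly C ({..<length C} - {j})) (C ! j) \<noteq> 0"
  using assms by (auto simp: poly_node_poly nth_eq_iff_index_eq)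

text \<open>The numerator of \<open>rational_fun l0 c0 l C\<close> over the common denominator given by all linear factors.\<close>

definition numerator_poly :: "real \<Rightarrow> real \<Rightarrow> (nat \<Rightarrow> real) \<Rightarrow> real list \<Rightarrow> real poly" where
  "numerator_poly l0 c0 l C = [:c0, l0:] * node_poly C {..<length C}
     + (\<Sum>j<length C. smult (l j) (node_poly C ({..<length C} - {j})))"

lemma degree_numerator_poly:
  "degree (numerator_poly l0 c0 l C) \<le> Suc (length C)"
  unfolding numerator_poly_def
  by (intro degree_add_le degree_sum_le order.trans[OF degree_mult_le] order.trans[OF degree_smult_le])
     (auto simp: degree_node_poly)

lemma poly_numerator_at_node:
  assumes "j < length C"
  shows "poly (numerator_poly l0 c0 l C) (C ! j) = l j * poly (node_poly C ({..<length C} - {j})) (C ! j)"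
proof -
  have zero: "(\<Prod>i<length C. C ! i - C ! j) = 0"
    using assms by (intro prod_zero) auto
  have "poly (numerator_poly l0 c0 l C) (C ! j) =
      (\<Sum>i<length C. l i * (\<Prod>k\<in>{..<length C} - {i}. C ! k - C ! j))"
    by (simp add: numerator_poly_def poly_sum poly_node_poly zero)
  also have "\<dots> = (\<Sum>i\<in>{j}. l i * (\<Prod>k\<in>{..<length C} - {i}. C ! k - C ! j))"
    using assms by (intro sum.mono_neutral_right) auto
  finally show ?thesis by (simp add: poly_node_poly)
qed

lemma numerator_poly_eq_0:
  assumes "distinct C" "numerator_poly l0 c0 l C = 0"
  shows "l0 = 0 \<and> c0 = 0 \<and> (\<forall>j<length C. l j = 0)"
proof -
  have l: "l j = 0" if "j < length C" for j
    using poly_numerator_at_node[OF that, of l0 c0 l] node_poly_nonzero[OF assms(1) that] assms(2) by simp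
  then have "[:c0, l0:] * node_poly C {..<length C} = 0"
    using assms(2) by (simp add: numerator_poly_def)
  moreover have "node_poly C {..<length C} \<noteq> 0"
    by (simp add: node_poly_def)
  ultimately have "[:c0, l0:] = 0" by (metis mult_eq_0_iff)
  then show ?thesis using l by simp
qed

lemma numerator_poly_diff:
  "numerator_poly l0 c0 l C - numerator_poly l0' c0' l' C =
     numerator_poly (l0 - l0') (c0 - c0') (\<lambda>j. l j - l' j) C"
proof -
  have "numerator_poly l0 c0 l C = numerator_poly (l0 - l0') (c0 - c0') (\<lambda>j. l j - l' j) C
     + numerator_poly l0' c0' l' C"
    by (rule poly_eq_poly_eq_iff[THEN iffD1], rule ext)
       (simp add: numerator_poly_def poly_sum algebra_simps sum.distrib[symmetric])
  then show ?thesis by simp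
qed

lemma rational_fun_numerator:
  fixes z :: "'a::real_normed_field"
  assumes "z \<notin> of_real ` set C"
  shows "rational_fun l0 c0 l C z * (\<Prod>j<length C. of_real (C ! j) - z) =
    (of_real c0 + of_real l0 * z) * (\<Prod>j<length C. of_real (C ! j) - z)
     + (\<Sum>j<length C. of_real (l j) * (\<Prod>i\<in>{..<length C} - {j}. of_real (C ! i) - z))"
proof -
  have "of_real (l j) / (of_real (C ! j) - z) * (\<Prod>i<length C. of_real (C ! i) - z) =
     of_real (l j) * (\<Prod>i\<in>{..<length C} - {j}. of_real (C ! i) - z)" if "j < length C" for j
  proof -
    have "of_real (C ! j) - z \<noteq> 0" using assms that nth_mem by fastforce
    then show ?thesis
      using that by (subst prod.remove[of "{..<length C}" j]) auto
  qed
  then show ?thesis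
    by (simp add: rational_fun_def distrib_right sum_distrib_right)
qed

text \<open>The difference of the numerators has degree at most \<open>length C + 1\<close>.\<close>

lemma rational_fun_eqI:
  assumes C: "distinct C" and X: "finite X" "card X \<ge> length C + 2" "X \<inter> set C = {}"
    and eq: "\<And>x. x \<in> X \<Longrightarrow> rational_fun l0 c0 l C x = rational_fun l0' c0' l' C (x::real)"
  shows "l0 = l0' \<and> c0 = c0' \<and> (\<forall>j<length C. l j = l' j)"
proof -
  have num: "poly (numerator_poly l0 c0 l C) x = rational_fun l0 c0 l C x * (\<Prod>j<length C. C ! j - x)"
    if "x \<notin> set C" for x l0 c0 and l :: "nat \<Rightarrow> real"
    using rational_fun_numerator[of x C l0 c0 l] that
    by (simp add: numerator_poly_def poly_node_poly poly_sum algebra_simps)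
  let ?D = "numerator_poly (l0 - l0') (c0 - c0') (\<lambda>j. l j - l' j) C"
  have roots: "X \<subseteq> {x. poly ?D x = 0}"
  proof
    fix x assume "x \<in> X"
    then have "x \<notin> set C" using X(3) by blast
    then show "x \<in> {x. poly ?D x = 0}"
      using num[of x l0 c0 l] num[of x l0' c0' l'] eq[OF \<open>x \<in> X\<close>]
      by (auto simp: numerator_poly_diff[symmetric])
  qed
  have "?D = 0"
  proof (rule ccontr)
    assume nz: "?D \<noteq> 0"
    have "card X \<le> card {x. poly ?D x = 0}"
      by (intro card_mono poly_roots_finite nz roots)
    also have "\<dots> \<le> degree ?D" by (rule card_poly_roots_bound[OF nz])
    also have "\<dots> \<le> Suc (length C)" by (rule degree_numerator_poly)
    finally show False using X by simp
  qed
  from numerator_poly_eq_0[OF C this] show ?thesis by simp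
qed

lemma partial_fractions:
  assumes C: "distinct C" and deg: "degree P \<le> Suc (length C)"
  shows "\<exists>l0 c0 l. P = numerator_poly l0 c0 l C"
proof -
  let ?n = "length C"
  let ?Q = "\<lambda>j. node_poly C ({..<?n} - {j})"
  define l where "l j = poly P (C ! j) / poly (?Q j) (C ! j)" for j
  define R where "R = P - numerator_poly 0 0 l C"
  have "poly R a = 0" if "a \<in> set C" for a
    using that node_poly_nonzero[OF C]
    by (auto simp: R_def in_set_conv_nth poly_numerator_at_node l_def)
  then obtain M where M: "R = M * (\<Prod>a\<in>set C. [:a, -1:])"
    using poly_factor_distinct_roots[of "set C" R] by auto
  have Q: "(\<Prod>a\<in>set C. [:a, -1:]) = node_poly C {..<?n}"
    unfolding node_poly_def
    by (rule prod.reindex_bij_betw[symmetric]) (rule bij_betw_nth[OF C], auto)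
  have "degree R \<le> Suc ?n"
    unfolding R_def by (intro degree_diff_le deg degree_numerator_poly)
  moreover have "degree R = degree M + ?n" if "M \<noteq> 0"
  proof -
    have "node_poly C {..<?n} \<noteq> 0" by (simp add: node_poly_def)
    then show ?thesis
      unfolding M Q using degree_mult_eq[OF that] by (simp add: degree_node_poly)
  qed
  ultimately have "degree M \<le> 1" by (cases "M = 0") auto
  then have "M = [:coeff M 0, coeff M 1:]"
    by (intro poly_eqI) (auto simp: coeff_pCons coeff_eq_0 split: nat.split)
  then obtain c0 l0 where "M = [:c0, l0:]" by blast
  then have "P = numerator_poly l0 c0 l C"
    using M by (simp add: R_def Q numerator_poly_def algebra_simps)
  then show ?thesis by blast
qed

section \<open>Finite gap sets and the ratio of the edge polynomials\<close>

text \<open>A finite gap set as the union of its bands \<open>[\<beta> j, \<alpha> j]\<close>, \<open>j \<le> g\<close>, listed from left to right. In the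
  definition of \<open>finite_gap_set\<close> the right end point of the last band has index 0; here it is \<open>\<alpha> g\<close>.\<close>

locale bands =
  fixes g :: nat and \<beta> \<alpha> :: "nat \<Rightarrow> real" and E :: "real set"
  assumes band: "j \<le> g \<Longrightarrow> \<beta> j < \<alpha> j" and gap: "j < g \<Longrightarrow> \<alpha> j < \<beta> (Suc j)"
    and E: "E = (\<Union>j\<le>g. {\<beta> j..\<alpha> j})"
begin

lemma beta_mono: "i \<le> j \<Longrightarrow> j \<le> g \<Longrightarrow> \<beta> i \<le> \<beta> j"
proof (induction j)
  case (Suc j)
  then show ?case using band[of j] gap[of j] by (cases "i = Suc j") auto
qed simp

lemma bands_ordered: "i < j \<Longrightarrow> j \<le> g \<Longrightarrow> \<alpha> i < \<beta> j"
  using gap[of i] beta_mono[of "Suc i" j] by simp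

lemma alpha_strict: "i < j \<Longrightarrow> j \<le> g \<Longrightarrow> \<alpha> i < \<alpha> j"
  using bands_ordered[of i j] band[of j] by simp

text \<open>The monic polynomials with the left and with the right end points of the bands as zeros, over the
  reals and over the complex numbers.\<close>

definition PB :: "'a::real_normed_field \<Rightarrow> 'a" where "PB z = (\<Prod>j\<le>g. z - of_real (\<beta> j))"
definition PA :: "'a::real_normed_field \<Rightarrow> 'a" where "PA z = (\<Prod>j\<le>g. z - of_real (\<alpha> j))"

lemma of_real_PAB: "of_real (PA x) = PA (of_real x)" "of_real (PB x) = PB (of_real x)" for x :: real
  by (simp_all add: PA_def PB_def)

lemma cnj_PAB: "cnj (PA z) = PA (cnj z)" "cnj (PB z) = PB (cnj z)"
  by (simp_all add: PA_def PB_def)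

lemma PA_PB_sign: "x \<in> E \<longleftrightarrow> PA x * PB x \<le> (0::real)"
proof -
  have prod: "PA x * PB x = (\<Prod>j\<le>g. (x - \<alpha> j) * (x - \<beta> j))"
    by (simp add: PA_def PB_def prod.distrib)
  have pos: "(x - \<alpha> j) * (x - \<beta> j) > 0" if "x \<notin> {\<beta> j..\<alpha> j}" "j \<le> g" for j
    using that band[OF that(2)] by (auto simp: zero_less_mult_iff)
  show ?thesis
  proof
    assume "x \<in> E"
    then obtain i where i: "i \<le> g" "x \<in> {\<beta> i..\<alpha> i}" unfolding E by auto
    have "(x - \<alpha> j) * (x - \<beta> j) > 0" if "j \<le> g" "j \<noteq> i" for j
      using that i bands_ordered[of i j] bands_ordered[of j i]
      by (intro pos) (auto simp: neq_iff)
    then have "(\<Prod>j\<in>{..g} - {i}. (x - \<alpha> j) * (x - \<beta> j)) \<ge> 0"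
      by (intro prod_nonneg) (auto intro: less_imp_le)
    moreover have "(x - \<alpha> i) * (x - \<beta> i) \<le> 0"
      using i by (auto simp: mult_le_0_iff)
    ultimately show "PA x * PB x \<le> 0"
      unfolding prod using i by (subst prod.remove[of _ i]) (auto intro: mult_nonpos_nonneg)
  next
    assume le: "PA x * PB x \<le> 0"
    show "x \<in> E"
    proof (rule ccontr)
      assume "x \<notin> E"
      then have "PA x * PB x > 0"
        unfolding prod E using pos by (intro prod_pos) auto
      then show False using le by simp
    qed
  qed
qed

lemma PA_eq_0: "PA z = 0 \<longleftrightarrow> (\<exists>j\<le>g. z = of_real (\<alpha> j))"
  and PB_eq_0: "PB z = 0 \<longleftrightarrow> (\<exists>j\<le>g. z = of_real (\<beta> j))"
  by (auto simp: PA_def PB_def)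

lemma endpoints_in_E: "j \<le> g \<Longrightarrow> \<alpha> j \<in> E" "j \<le> g \<Longrightarrow> \<beta> j \<in> E"
  unfolding E using band by (auto intro: less_imp_le bexI[of _ j])

lemma PA_PB_nonzero: "z \<notin> of_real ` E \<Longrightarrow> PA z \<noteq> 0" "z \<notin> of_real ` E \<Longrightarrow> PB z \<noteq> 0"
  using endpoints_in_E by (auto simp: PA_eq_0 PB_eq_0)

lemma PA_PB_distinct: "PA z \<noteq> 0 \<or> PB z \<noteq> 0"
proof (rule ccontr)
  assume "\<not> ?thesis"
  then obtain i j where "i \<le> g" "j \<le> g" "(of_real (\<alpha> i) :: 'a) = of_real (\<beta> j)"
    by (auto simp: PA_eq_0 PB_eq_0)
  then show False
    using bands_ordered[of i j] band[of i] bands_ordered[of j i] band[of j]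
    by (cases i j rule: linorder_cases) auto
qed

text \<open>The argument, in \<open>(0, \<pi>)\<close>, of \<open>z - x\<close> for real \<open>x\<close> and \<open>z\<close> in the upper half-plane, in a form that shows
  its monotonicity in \<open>x\<close>.\<close>

definition angle :: "complex \<Rightarrow> real \<Rightarrow> real" where
  "angle z x = pi / 2 - arctan ((Re z - x) / Im z)"

lemma angle_bounds: "0 < angle z x" "angle z x < pi"
  using arctan_lbound[of "(Re z - x) / Im z"] arctan_ubound[of "(Re z - x) / Im z"]
  by (auto simp: angle_def)

lemma angle_less: "Im z > 0 \<Longrightarrow> x < y \<Longrightarrow> angle z x < angle z y"
  by (simp add: angle_def arctan_less_iff divide_strict_right_mono)

lemma polar_angle:
  assumes "Im z > 0"
  shows "z - of_real x = of_real (cmod (z - of_real x)) * cis (angle z x)"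
proof -
  define t where "t = (Re z - x) / Im z"
  have re: "Re z - x = t * Im z" using assms by (simp add: t_def)
  have s: "sqrt (1 + t\<^sup>2) > 0" by (simp add: add_pos_nonneg)
  have "cmod (z - of_real x) = sqrt ((t * Im z)\<^sup>2 + (Im z)\<^sup>2)"
    by (simp add: cmod_def re)
  also have "(t * Im z)\<^sup>2 + (Im z)\<^sup>2 = (Im z)\<^sup>2 * (1 + t\<^sup>2)"
    by (simp add: power_mult_distrib algebra_simps)
  also have "sqrt \<dots> = Im z * sqrt (1 + t\<^sup>2)"
    using assms by (simp add: real_sqrt_mult)
  finally have c: "cmod (z - of_real x) = Im z * sqrt (1 + t\<^sup>2)" .
  have "cos (angle z x) = t / sqrt (1 + t\<^sup>2)" "sin (angle z x) = 1 / sqrt (1 + t\<^sup>2)"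
    unfolding angle_def t_def[symmetric] by (simp_all add: cos_diff sin_diff sin_arctan cos_arctan)
  then show ?thesis
    using s unfolding c by (simp add: complex_eq_iff re)
qed

text \<open>The quotient of the edge polynomials. It takes positive values on the real line outside \<open>E\<close> and
  negative values inside the bands.\<close>

definition ratio :: "complex \<Rightarrow> complex" where "ratio z = PB z / PA z"

text \<open>The argument of the ratio is minus the sum of the angles under which the bands are seen from \<open>z\<close>. As the
  bands are disjoint, this sum is less than \<open>\<pi>\<close>.\<close>

lemma Im_ratio_neg:
  assumes z: "Im z > 0"
  shows "Im (ratio z) < 0"
proof -
  define S where "S = (\<Sum>j\<le>g. angle z (\<alpha> j) - angle z (\<beta> j))"
  have "S > 0"
    unfolding S_def using angle_less[OF z band] by (intro sum_pos) auto
  have "(\<Sum>j\<le>n. angle z (\<alpha> j) - angle z (\<beta> j)) \<le> angle z (\<alpha> n) - angle z (\<beta> 0)" if "n \<le> g" for n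
    using that
  proof (induction n)
    case (Suc n)
    then show ?case using angle_less[OF z gap[of n]] by simp
  qed simp
  from this[of g] have "S < pi"
    using angle_bounds[of z "\<alpha> g"] angle_bounds[of z "\<beta> 0"] by (simp add: S_def)
  have nz: "z - of_real x \<noteq> 0" for x using z by auto
  define P where "P = (\<Prod>j\<le>g. cmod (z - of_real (\<beta> j)) / cmod (z - of_real (\<alpha> j)))"
  have prod_cis: "(\<Prod>j\<le>n. cis (f j)) = cis (\<Sum>j\<le>n. f j)" for n and f :: "nat \<Rightarrow> real"
    by (induction n) (auto simp: cis_mult)
  have "ratio z = (\<Prod>j\<le>g. of_real (cmod (z - of_real (\<beta> j)) / cmod (z - of_real (\<alpha> j)))
      * cis (- (angle z (\<alpha> j) - angle z (\<beta> j))))"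
    unfolding ratio_def PA_def PB_def prod_dividef[symmetric]
    by (intro prod.cong refl, subst polar_angle[OF z], subst (2) polar_angle[OF z])
       (simp add: cis_divide[symmetric])
  also have "\<dots> = of_real P * cis (- S)"
    by (simp only: prod.distrib prod_cis of_real_prod S_def sum_negf P_def)
  finally have "Im (ratio z) = - (P * sin S)"
    by simp
  moreover have "P > 0"
    unfolding P_def using nz by (intro prod_pos) auto
  moreover have "sin S > 0" using \<open>S > 0\<close> \<open>S < pi\<close> by (rule sin_gt_zero)
  ultimately show ?thesis by simp
qed

lemma ratio_cnj: "ratio (cnj z) = cnj (ratio z)"
  by (simp add: ratio_def cnj_PAB)

lemma ratio_of_real: "ratio (of_real x) = of_real (PB x / PA x)"
  by (simp add: ratio_def of_real_PAB)

lemma ratio_slit: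
  assumes "z \<notin> of_real ` E"
  shows "ratio z \<notin> \<real>\<^sub>\<le>\<^sub>0"
proof -
  consider "Im z > 0" | "Im z < 0" | "Im z = 0" by linarith
  then show ?thesis
  proof cases
    case 1
    then show ?thesis using Im_ratio_neg[OF 1] by (auto simp: complex_nonpos_Reals_iff)
  next
    case 2
    then show ?thesis
      using Im_ratio_neg[of "cnj z"] by (auto simp: ratio_cnj complex_nonpos_Reals_iff)
  next
    case 3
    define x where "x = Re z"
    have x: "z = of_real x" using 3 by (simp add: x_def complex_eq_iff)
    then have "x \<notin> E" using assms by auto
    then have "PB x / PA x > 0"
      using PA_PB_sign[of x] by (auto simp: zero_less_divide_iff zero_less_mult_iff not_le)
    then show ?thesis
      unfolding x ratio_of_real by (simp add: nonpos_Reals_of_real_iff del: of_real_divide)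
  qed
qed

end

lemma finite_gap_set_bands:
  assumes "finite_gap_set g E"
  obtains \<beta> \<alpha> where "bands g \<beta> \<alpha> E"
proof -
  obtain a b :: "nat \<Rightarrow> real" where ab: "\<And>j. j < g \<Longrightarrow> b j < a (Suc j)" "\<And>j. j < g \<Longrightarrow> a (Suc j) < b (Suc j)"
    "b g < a 0" and gapset: "E = {b 0..a 0} - (\<Union>j\<in>{1..g}. {a j<..<b j})"
    using assms unfolding finite_gap_set_def by blast
  define \<alpha> where "\<alpha> j = (if j < g then a (Suc j) else a 0)" for j
  define U where "U = (\<Union>j\<le>g. {b j..\<alpha> j})"
  interpret bands g b \<alpha> U
    by standard (use ab in \<open>auto simp: \<alpha>_def U_def\<close>)
  have "E = U"
  proof (intro equalityI subsetI)
    fix x assume x: "x \<in> E"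
    define j where "j = (GREATEST j. j \<le> g \<and> b j \<le> x)"
    have ex: "0 \<le> g \<and> b 0 \<le> x" using x by (auto simp: gapset)
    have j: "j \<le> g \<and> b j \<le> x"
      unfolding j_def by (rule GreatestI_nat[of _ 0 g]) (use ex in auto)
    have max: "k \<le> j" if "k \<le> g" "b k \<le> x" for k
      unfolding j_def by (rule Greatest_le_nat[of _ _ g]) (use that in auto)
    have "x \<le> \<alpha> j"
    proof (cases "j < g")
      case True
      then have "x < b (Suc j)" using max[of "Suc j"] by fastforce
      moreover have "x \<notin> {a (Suc j)<..<b (Suc j)}" using x True by (auto simp: gapset)
      ultimately show ?thesis using True by (auto simp: \<alpha>_def)
    next
      case False
      then show ?thesis using x j by (auto simp: \<alpha>_def gapset)
    qed
    then show "x \<in> U" using j by (auto simp: U_def)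
  next
    fix x assume "x \<in> U"
    then obtain j where j: "j \<le> g" "b j \<le> x" "x \<le> \<alpha> j" by (auto simp: U_def)
    have "\<alpha> j \<le> \<alpha> g" using alpha_strict[of j g] j by (cases "j = g") auto
    then have "x \<in> {b 0..a 0}"
      using j beta_mono[of 0 j] by (simp add: \<alpha>_def split: if_splits)
    moreover have "x \<notin> {a i<..<b i}" if i: "i \<in> {1..g}" for i
    proof (cases "i \<le> j")
      case True
      then show ?thesis using beta_mono[of i j] j by auto
    next
      case False
      then consider "j = i - 1" | "j < i - 1" by linarith
      moreover have "i - 1 \<le> g" using i by auto
      ultimately have "\<alpha> j \<le> \<alpha> (i - 1)" using alpha_strict[of j "i - 1"] by cases auto
      moreover have "i - 1 < g" "Suc (i - 1) = i" using i by auto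
      then have "\<alpha> (i - 1) = a i" by (simp add: \<alpha>_def)
      ultimately show ?thesis using j by auto
    qed
    ultimately show "x \<in> E" by (auto simp: gapset)
  qed
  then show ?thesis using that bands_axioms by blast
qed

section \<open>The rational form of the Ahlfors function\<close>

lemma complex_poly_eq_of_reals:
  fixes p q :: "complex poly"
  assumes "\<And>x::real. poly p (of_real x) = poly q (of_real x)"
  shows "p = q"
proof (rule ccontr)
  assume "p \<noteq> q"
  then have "finite {x. poly (p - q) x = 0}" by (intro poly_roots_finite) simp
  moreover have "range complex_of_real \<subseteq> {x. poly (p - q) x = 0}"
    using assms by auto
  moreover have "infinite (range complex_of_real)"
    by (simp add: finite_image_iff infinite_UNIV_char_0 inj_of_real)
  ultimately show False using finite_subset by blast
qed

text \<open>The coefficients are recovered from the imaginary part by letting \<open>z = \<i>y\<close> tend to infinity and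
  \<open>z = C ! j + \<i>y\<close> tend to \<open>C ! j\<close>.\<close>

lemma rational_fun_coeffs_nonneg:
  assumes C: "distinct C" "j < length C"
    and pos: "\<And>z. Im z > 0 \<Longrightarrow> Im (rational_fun l0 c0 l C z) > 0"
  shows "l0 \<ge> 0" "l j \<ge> 0"
proof -
  have pos': "l0 + (\<Sum>i<length C. l i / (cmod (of_real (C ! i) - z))\<^sup>2) \<ge> 0" if "Im z > 0" for z
    using pos[OF that] that unfolding Im_rational_fun by (simp add: zero_less_mult_iff)
  have norm: "(cmod (of_real c - Complex a y))\<^sup>2 = (c - a)\<^sup>2 + y\<^sup>2" for a c y
    by (simp add: cmod_power2)
  have lim0: "((\<lambda>y. l0 + (\<Sum>i<length C. l i / ((C ! i - 0)\<^sup>2 + y\<^sup>2))) \<longlongrightarrow> l0 + (\<Sum>i<length C. 0)) at_top"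
    by (intro tendsto_intros real_tendsto_divide_at_top[OF tendsto_const]
        filterlim_tendsto_add_at_top[OF tendsto_const] filterlim_pow_at_top filterlim_ident) auto
  have ev0: "eventually (\<lambda>y. 0 \<le> l0 + (\<Sum>i<length C. l i / ((C ! i - 0)\<^sup>2 + y\<^sup>2))) at_top"
    using eventually_gt_at_top[of 0]
    by eventually_elim (use pos'[of "Complex 0 y" for y] in \<open>simp add: norm\<close>)
  show "l0 \<ge> 0"
    using tendsto_lowerbound[OF lim0 ev0] by simp
  let ?c = "C ! j"
  let ?h = "\<lambda>y. y\<^sup>2 * l0 + (\<Sum>i\<in>{..<length C} - {j}. y\<^sup>2 * l i / ((C ! i - ?c)\<^sup>2 + y\<^sup>2)) + l j"
  have nz: "(C ! i - ?c)\<^sup>2 + 0\<^sup>2 \<noteq> 0" if "i \<in> {..<length C} - {j}" for i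
    using C that by (simp add: nth_eq_iff_index_eq)
  have "(?h \<longlongrightarrow> 0\<^sup>2 * l0 + (\<Sum>i\<in>{..<length C} - {j}. 0\<^sup>2 * l i / ((C ! i - ?c)\<^sup>2 + 0\<^sup>2)) + l j) (at_right 0)"
    by (intro tendsto_intros nz)
  moreover have "eventually (\<lambda>y. 0 \<le> ?h y) (at_right (0::real))"
    unfolding eventually_at_right_field
  proof (intro exI[of _ 1] conjI allI impI)
    fix y :: real assume y: "y > 0" "y < 1"
    have "0 \<le> y\<^sup>2 * (l0 + (\<Sum>i<length C. l i / ((C ! i - ?c)\<^sup>2 + y\<^sup>2)))"
      using pos'[of "Complex ?c y"] y by (simp add: norm)
    also have "(\<Sum>i<length C. l i / ((C ! i - ?c)\<^sup>2 + y\<^sup>2)) =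
        l j / y\<^sup>2 + (\<Sum>i\<in>{..<length C} - {j}. l i / ((C ! i - ?c)\<^sup>2 + y\<^sup>2))"
      using C by (subst sum.remove[of _ j]) auto
    also have "y\<^sup>2 * (l0 + (l j / y\<^sup>2 + (\<Sum>i\<in>{..<length C} - {j}. l i / ((C ! i - ?c)\<^sup>2 + y\<^sup>2)))) = ?h y"
      using y by (simp add: distrib_left sum_distrib_left)
    finally show "0 \<le> ?h y" .
  qed simp
  ultimately show "l j \<ge> 0"
    using tendsto_lowerbound[of ?h "l j" "at_right 0" 0] by simp
qed

context bands
begin

text \<open>The Ahlfors function of the complement of \<open>E\<close>. The principal square root is analytic there, because the
  ratio avoids the negative half-axis.\<close>

definition ahlfors_formula :: "complex \<Rightarrow> complex" where
  "ahlfors_formula z = (csqrt (ratio z) - 1) / (csqrt (ratio z) + 1)"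

lemma Re_csqrt_ratio:
  assumes "z \<notin> of_real ` E"
  shows "Re (csqrt (ratio z)) > 0"
proof (rule ccontr)
  define s where "s = csqrt (ratio z)"
  assume "\<not> ?thesis"
  then have "Re s = 0" using csqrt_principal[of "ratio z"] by (simp add: s_def not_less)
  then have "s\<^sup>2 = - of_real ((Im s)\<^sup>2)" by (simp add: complex_eq_iff power2_eq_square)
  then have "s\<^sup>2 \<in> \<real>\<^sub>\<le>\<^sub>0" by (simp add: complex_nonpos_Reals_iff)
  then show False using ratio_slit[OF assms] by (simp add: s_def)
qed

lemma csqrt_ratio_add_1:
  assumes "z \<notin> of_real ` E" shows "csqrt (ratio z) + 1 \<noteq> 0"
proof
  assume "csqrt (ratio z) + 1 = 0"
  then have "Re (csqrt (ratio z)) = Re (- 1)" by (metis eq_neg_iff_add_eq_0)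
  then show False using Re_csqrt_ratio[OF assms] by (simp del: csqrt.sel)
qed

lemma ratio_identity:
  assumes z: "z \<notin> of_real ` E" and nz: "ahlfors_formula z \<noteq> 0"
  shows "PB z \<noteq> PA z" "ahlfors_formula z + 1 / ahlfors_formula z = 2 * (PB z + PA z) / (PB z - PA z)"
proof -
  define s where "s = csqrt (ratio z)"
  have s2: "s\<^sup>2 = ratio z" by (simp add: s_def)
  have s1: "s + 1 \<noteq> 0" using csqrt_ratio_add_1[OF z] by (simp add: s_def)
  have s3: "s - 1 \<noteq> 0" using nz by (auto simp: ahlfors_formula_def s_def)
  note PA = PA_PB_nonzero(1)[OF z]
  have PB: "PB z = s\<^sup>2 * PA z" using PA by (simp add: s2 ratio_def)
  have "s\<^sup>2 - 1 = (s - 1) * (s + 1)" by (simp add: power2_eq_square algebra_simps)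
  then have s4: "s\<^sup>2 - 1 \<noteq> 0" using s1 s3 by simp
  then show "PB z \<noteq> PA z" using PA by (auto simp: PB)
  have "ahlfors_formula z + 1 / ahlfors_formula z = ((s - 1)\<^sup>2 + (s + 1)\<^sup>2) / ((s - 1) * (s + 1))"
    using s1 s3 by (simp add: ahlfors_formula_def s_def[symmetric] field_simps power2_eq_square)
  also have "\<dots> = 2 * (s\<^sup>2 + 1) / (s\<^sup>2 - 1)"
    by (simp add: power2_eq_square algebra_simps)
  also have "\<dots> = 2 * (s\<^sup>2 + 1) * PA z / ((s\<^sup>2 - 1) * PA z)"
    using PA by simp
  also have "\<dots> = 2 * (PB z + PA z) / (PB z - PA z)"
    unfolding PB by (simp add: algebra_simps)
  finally show "ahlfors_formula z + 1 / ahlfors_formula z = 2 * (PB z + PA z) / (PB z - PA z)" .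
qed

lemma Im_ratio_moebius:
  assumes z: "Im z > 0"
  shows "Im (2 * (PB z + PA z) / (PB z - PA z)) > 0"
proof -
  have zE: "z \<notin> of_real ` E" using z by auto
  note PA = PA_PB_nonzero(1)[OF zE]
  define f where "f = ratio z"
  have f: "Im f < 0" unfolding f_def by (rule Im_ratio_neg[OF z])
  define h where "h = (f + 1) / (f - 1)"
  have "2 * (PB z + PA z) / (PB z - PA z) = 2 * h"
    using PA by (simp add: h_def f_def ratio_def divide_simps)
  then have "Im (2 * (PB z + PA z) / (PB z - PA z)) = 2 * Im h" by simp
  moreover have "Im h = - 2 * Im f / ((Re f - 1)\<^sup>2 + (Im f)\<^sup>2)"
    by (simp add: h_def Im_divide algebra_simps)
  moreover have "(Re f - 1)\<^sup>2 + (Im f)\<^sup>2 > 0" using f by (simp add: add_nonneg_pos)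
  ultimately show ?thesis using f by (simp add: divide_neg_pos)
qed

text \<open>The monic polynomial with the zeros \<open>e 0, \<dots>, e g\<close>.\<close>

definition band_poly :: "(nat \<Rightarrow> real) \<Rightarrow> real poly" where
  "band_poly e = (\<Prod>j\<le>g. [:- e j, 1:])"

lemma poly_band_poly: "poly (band_poly \<beta>) x = PB x" "poly (band_poly \<alpha>) x = PA x"
  by (simp_all add: band_poly_def poly_prod PB_def PA_def)

lemma degree_band_poly: "degree (band_poly e) = Suc g"
  unfolding band_poly_def by (subst degree_prod_sum_eq) auto

lemma lead_coeff_band_poly: "coeff (band_poly e) (Suc g) = 1"
  using lead_coeff_prod[of "\<lambda>j. [:- e j, 1:]" "{..g}"]
  unfolding degree_band_poly[of e, symmetric] by (simp add: band_poly_def)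

text \<open>The difference of the two edge polynomials has degree at most \<open>g\<close>, so its \<open>g\<close> known zeros determine it up
  to a factor, and the quotient has a partial fraction expansion with these poles. Positivity of the
  coefficients follows from the sign of the imaginary part. None of the \<open>l j\<close> is zero, because the
  numerator does not vanish at the poles.\<close>

lemma moebius_rational_fun:
  assumes C: "length C = g" "distinct C" and zeros: "\<And>c. c \<in> set C \<Longrightarrow> PB c = PA c"
    and CE: "set C \<inter> E = {}" and g: "g \<ge> 1"
  shows "\<exists>l0 c0 l. l0 > 0 \<and> (\<forall>j<g. l j > 0) \<and>
    (\<forall>z::complex. z \<notin> of_real ` set C \<longrightarrow> PB z \<noteq> PA z \<and>
       rational_fun l0 c0 l C z = 2 * (PB z + PA z) / (PB z - PA z))"
proof -
  define D where "D = band_poly \<beta> - band_poly \<alpha>"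
  have "degree D \<le> g"
  proof (rule degree_le, intro allI impI)
    fix i assume "g < i"
    then consider "i = Suc g" | "i > Suc g" by linarith
    then show "coeff D i = 0"
      by cases (simp_all add: D_def lead_coeff_band_poly coeff_eq_0 degree_band_poly)
  qed
  have "D \<noteq> 0"
  proof
    assume "D = 0"
    then have "PB (\<alpha> 0) = PA (\<alpha> 0)" 
      by (metis D_def eq_iff_diff_eq_0 poly_band_poly)
    moreover have "PA (\<alpha> 0) = 0" by (auto simp: PA_eq_0)
    ultimately show False using PA_PB_distinct[of "\<alpha> 0"] by simp
  qed
  obtain M where M: "D = M * (\<Prod>a\<in>set C. [:a, -1:])"
    using poly_factor_distinct_roots[of "set C" D] zeros by (auto simp: D_def poly_band_poly)
  have Q: "(\<Prod>a\<in>set C. [:a, -1:]) = node_poly C {..<g}"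
    unfolding node_poly_def
    by (rule prod.reindex_bij_betw[symmetric]) (rule bij_betw_nth[OF C(2)], auto simp: C)
  have "M \<noteq> 0" "node_poly C {..<g} \<noteq> 0" using \<open>D \<noteq> 0\<close> M Q by auto
  then have "degree D = degree M + g"
    unfolding M Q by (simp add: degree_mult_eq degree_node_poly)
  then have "degree M = 0" using \<open>degree D \<le> g\<close> by simp
  then obtain \<kappa> where \<kappa>: "M = [:\<kappa>:]" by (metis degree_0_id)
  have k0: "\<kappa> \<noteq> 0" using \<open>M \<noteq> 0\<close> \<kappa> by simp
  define P where "P = smult (2 / \<kappa>) (band_poly \<beta> + band_poly \<alpha>)"
  have "degree P \<le> Suc (length C)"
    unfolding P_def C using degree_add_le[of "band_poly \<beta>" "Suc g" "band_poly \<alpha>"]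
    by (simp add: degree_band_poly)
  then obtain l0 c0 l where P: "P = numerator_poly l0 c0 l C"
    using partial_fractions[OF C(2)] by blast
  have realD: "PB x - PA x = \<kappa> * (\<Prod>j<g. C ! j - x)" for x
    using arg_cong[OF M, of "\<lambda>p. poly p x"] by (simp add: D_def poly_band_poly \<kappa> Q poly_node_poly)
  have realP: "2 / \<kappa> * (PB x + PA x) = poly (numerator_poly l0 c0 l C) x" for x
    using arg_cong[OF P, of "\<lambda>p. poly p x"] by (simp add: P_def poly_band_poly)
  let ?Q = "\<lambda>J. \<Prod>j\<in>J. [:complex_of_real (C ! j), -1:]"
  let ?pb = "\<lambda>e. \<Prod>j\<le>g. [:- complex_of_real (e j), 1:]"
  have "?pb \<beta> - ?pb \<alpha> = smult (of_real \<kappa>) (?Q {..<g})"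
  proof (rule complex_poly_eq_of_reals)
    fix x :: real
    show "poly (?pb \<beta> - ?pb \<alpha>) (of_real x) = poly (smult (of_real \<kappa>) (?Q {..<g})) (of_real x)"
      using arg_cong[OF realD[of x], of complex_of_real]
      by (simp add: PB_def PA_def poly_prod)
  qed
  from arg_cong[OF this, of "\<lambda>p. poly p z" for z]
  have D: "PB z - PA z = of_real \<kappa> * (\<Prod>j<g. of_real (C ! j) - z)" for z :: complex
    by (simp add: PB_def PA_def poly_prod)
  have "smult (of_real (2 / \<kappa>)) (?pb \<beta> + ?pb \<alpha>) =
     [:of_real c0, of_real l0:] * ?Q {..<g} + (\<Sum>j<g. smult (of_real (l j)) (?Q ({..<g} - {j})))"
  proof (rule complex_poly_eq_of_reals)
    fix x :: real
    show "poly (smult (of_real (2 / \<kappa>)) (?pb \<beta> + ?pb \<alpha>)) (of_real x) =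
      poly ([:of_real c0, of_real l0:] * ?Q {..<g} + (\<Sum>j<g. smult (of_real (l j)) (?Q ({..<g} - {j})))) (of_real x)"
      using arg_cong[OF realP[of x], of complex_of_real]
      by (simp add: PB_def PA_def poly_prod poly_sum numerator_poly_def poly_node_poly C)
  qed
  from arg_cong[OF this, of "\<lambda>p. poly p z" for z]
  have N: "of_real (2 / \<kappa>) * (PB z + PA z) = (of_real c0 + of_real l0 * z) * (\<Prod>j<g. of_real (C ! j) - z)
     + (\<Sum>j<g. of_real (l j) * (\<Prod>i\<in>{..<g} - {j}. of_real (C ! i) - z))" for z :: complex
    by (simp add: PB_def PA_def poly_prod poly_sum algebra_simps)
  have eq: "PB z \<noteq> PA z \<and> rational_fun l0 c0 l C z = 2 * (PB z + PA z) / (PB z - PA z)"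
    if z: "z \<notin> of_real ` set C" for z :: complex
  proof -
    let ?q = "\<Prod>j<g. complex_of_real (C ! j) - z"
    have "of_real (C ! j) - z \<noteq> 0" if "j < g" for j
      using z C that nth_mem by fastforce
    then have q: "?q \<noteq> 0" by simp
    have "rational_fun l0 c0 l C z * ?q = of_real (2 / \<kappa>) * (PB z + PA z)"
      using rational_fun_numerator[OF z, of l0 c0 l] N[of z] C by simp
    then have "rational_fun l0 c0 l C z = of_real (2 / \<kappa>) * (PB z + PA z) / ?q"
      by (rule nonzero_eq_divide_eq[OF q, THEN iffD2])
    also have "\<dots> = 2 * (PB z + PA z) / (of_real \<kappa> * ?q)" by simp
    also have "of_real \<kappa> * ?q = PB z - PA z" by (rule D[symmetric])
    finally have "rational_fun l0 c0 l C z = 2 * (PB z + PA z) / (PB z - PA z)" .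
    moreover have "PB z - PA z \<noteq> 0" unfolding D using q k0 by simp
    ultimately show ?thesis by simp
  qed
  have pos: "Im (rational_fun l0 c0 l C z) > 0" if "Im z > 0" for z
  proof -
    have "z \<notin> of_real ` set C" using that by auto
    then show ?thesis using eq[of z] Im_ratio_moebius[OF that] by simp
  qed
  have "l0 \<ge> 0"
    using rational_fun_coeffs_nonneg(1)[OF C(2) _ pos, of 0] g C by simp
  moreover have "l0 \<noteq> 0"
  proof
    assume "l0 = 0"
    then have "degree P \<le> g"
      unfolding P numerator_poly_def using C
      by (intro degree_add_le degree_sum_le order.trans[OF degree_mult_le] order.trans[OF degree_smult_le])
         (auto simp: degree_node_poly)
    then have "coeff P (Suc g) = 0" by (intro coeff_eq_0) simp
    then show False using k0 by (simp add: P_def lead_coeff_band_poly)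
  qed
  moreover have "l j > 0" if j: "j < g" for j
  proof -
    have "l j \<ge> 0"
      using rational_fun_coeffs_nonneg(2)[OF C(2) _ pos, of j] C j by simp
    moreover have "l j \<noteq> 0"
    proof
      assume "l j = 0"
      then have "2 / \<kappa> * (PB (C ! j) + PA (C ! j)) = 0"
        unfolding realP using poly_numerator_at_node[of j C l0 c0 l] j C by simp
      moreover have cj: "C ! j \<in> set C" using j C by simp
      ultimately have "PA (C ! j) = 0" using zeros[OF cj] k0 by simp
      then have "C ! j \<in> E" using PA_PB_sign by simp
      then show False using CE cj by blast
    qed
    ultimately show ?thesis by simp
  qed
  ultimately have "l0 > 0 \<and> (\<forall>j<g. l j > 0) \<and>
    (\<forall>z::complex. z \<notin> of_real ` set C \<longrightarrow> PB z \<noteq> PA z \<and>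
       rational_fun l0 c0 l C z = 2 * (PB z + PA z) / (PB z - PA z))"
    using eq by auto
  then show ?thesis by blast
qed

theorem Delta_rational:
  assumes Psi: "\<And>z. z \<notin> of_real ` E \<Longrightarrow> \<Psi> z = ahlfors_formula z"
    and g: "g \<ge> 1" and C: "length C = g" "distinct C" and zeros: "of_real ` set C = finite_zeros E \<Psi>"
  obtains l0 c0 l where "l0 > 0" "\<And>j. j < g \<Longrightarrow> l j > 0"
    "\<And>z. z \<notin> of_real ` E \<Longrightarrow> z \<notin> finite_zeros E \<Psi> \<Longrightarrow> Delta \<Psi> z = rational_fun l0 c0 l C z"
    "E = {x. x \<notin> set C \<and> \<bar>rational_fun l0 c0 l C x\<bar> \<le> 2}"
proof -
  have cz: "complex_of_real c \<notin> of_real ` E" "\<Psi> (of_real c) = 0" if "c \<in> set C" for c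
  proof -
    have "complex_of_real c \<in> finite_zeros E \<Psi>" using that zeros by blast
    then show "complex_of_real c \<notin> of_real ` E" "\<Psi> (of_real c) = 0"
      by (auto simp: finite_zeros_def)
  qed
  have CE: "set C \<inter> E = {}" using cz(1) by blast
  have "PB c = PA c" if "c \<in> set C" for c
  proof -
    have "ahlfors_formula (of_real c) = 0" using cz[OF that] Psi by simp
    moreover have "csqrt (ratio (of_real c)) + 1 \<noteq> 0"
      by (rule csqrt_ratio_add_1[OF cz(1)[OF that]])
    ultimately have "csqrt (ratio (of_real c)) = 1" by (simp add: ahlfors_formula_def)
    then have "ratio (of_real c) = 1" by (metis power2_csqrt one_power2)
    then have "PB (complex_of_real c) = PA (complex_of_real c)"
      using PA_PB_nonzero(1)[OF cz(1)[OF that]] by (simp add: ratio_def)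
    then show ?thesis by (metis of_real_PAB of_real_eq_iff)
  qed
  from moebius_rational_fun[OF C this CE g] obtain l0 c0 l where
    pos: "l0 > 0" "\<And>j. j < g \<Longrightarrow> l j > 0" and
    eq: "\<And>z::complex. z \<notin> of_real ` set C \<Longrightarrow> PB z \<noteq> PA z \<and>
       rational_fun l0 c0 l C z = 2 * (PB z + PA z) / (PB z - PA z)"
    by blast
  have "Delta \<Psi> z = rational_fun l0 c0 l C z" if z: "z \<notin> of_real ` E" "z \<notin> finite_zeros E \<Psi>" for z
  proof -
    have "ahlfors_formula z \<noteq> 0" using z Psi[OF z(1)] by (auto simp: finite_zeros_def)
    then show ?thesis
      using ratio_identity[OF z(1)] Psi[OF z(1)] eq[of z] z zeros by (simp add: Delta_def)
  qed
  moreover have "x \<in> E \<longleftrightarrow> x \<notin> set C \<and> \<bar>rational_fun l0 c0 l C x\<bar> \<le> 2" for x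
  proof (cases "x \<in> set C")
    case True
    then show ?thesis using CE by blast
  next
    case False
    then have "complex_of_real x \<notin> of_real ` set C" by auto
    note eqx = eq[OF this]
    then have ne: "PB x - PA x \<noteq> 0"
      by (metis of_real_PAB right_minus_eq)
    have "complex_of_real (2 * (PB x + PA x) / (PB x - PA x)) =
        2 * (PB (of_real x) + PA (of_real x)) / (PB (of_real x) - PA (of_real x))"
      by (simp add: of_real_PAB)
    then have "complex_of_real (rational_fun l0 c0 l C x) = of_real (2 * (PB x + PA x) / (PB x - PA x))"
      using eqx by (simp only: rational_fun_of_real)
    then have v: "rational_fun l0 c0 l C x = 2 * (PB x + PA x) / (PB x - PA x)"
      by (simp only: of_real_eq_iff)
    have "\<bar>rational_fun l0 c0 l C x\<bar> \<le> 2 \<longleftrightarrow> \<bar>PB x + PA x\<bar> \<le> \<bar>PB x - PA x\<bar>"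
      unfolding v using ne by (simp add: divide_le_eq) (auto simp: abs_if)
    also have "\<dots> \<longleftrightarrow> (PB x + PA x)\<^sup>2 \<le> (PB x - PA x)\<^sup>2"
      by (rule abs_le_square_iff)
    also have "\<dots> \<longleftrightarrow> PA x * PB x \<le> 0"
      by (simp add: power2_eq_square algebra_simps)
    finally show ?thesis using False PA_PB_sign by simp
  qed
  ultimately show ?thesis using that[of l0 l c0] pos by blast
qed

end

section \<open>A maximum principle in the upper half-plane\<close>

text \<open>No boundary values are assumed; only the upper limits of the modulus at the real points and at infinity
  are controlled.\<close>

lemma upper_half_plane_max:
  assumes hol: "G holomorphic_on {z. Im z > 0}"
    and inf: "\<And>e. e > 0 \<Longrightarrow> \<exists>R. \<forall>z. Im z > 0 \<longrightarrow> cmod z > R \<longrightarrow> cmod (G z) \<le> 1 + e"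
    and bd: "\<And>e x. e > 0 \<Longrightarrow> \<exists>d>0. \<forall>z. Im z > 0 \<longrightarrow> dist z (of_real x) < d \<longrightarrow> cmod (G z) \<le> 1 + e"
    and z0: "Im z0 > 0"
  shows "cmod (G z0) \<le> 1"
proof (rule ccontr)
  define H where "H = {z. Im z > 0}"
  have H: "open H" "connected H"
    unfolding H_def by (auto intro: open_halfspace_Im_gt convex_connected convex_halfspace_Im_gt)
  assume "\<not> ?thesis"
  then have m: "cmod (G z0) > 1" by simp
  define e where "e = (cmod (G z0) - 1) / 2"
  have e: "e > 0" "1 + e < cmod (G z0)" using m by (auto simp: e_def field_simps)
  have cont: "continuous_on H G"
    using holomorphic_on_imp_continuous_on[OF hol] by (simp add: H_def)
  define K where "K = {z \<in> H. cmod (G z0) \<le> cmod (G z)}"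
  obtain R where R: "\<And>z. Im z > 0 \<Longrightarrow> cmod z > R \<Longrightarrow> cmod (G z) \<le> 1 + e"
    using inf[OF e(1)] by blast
  have "K \<subseteq> cball 0 R"
  proof
    fix z assume "z \<in> K"
    then have "\<not> cmod (G z) \<le> 1 + e" "Im z > 0" using e by (auto simp: K_def H_def)
    then show "z \<in> cball 0 R" using R[of z] by (auto simp: not_less[symmetric])
  qed
  then have "bounded K" using bounded_subset by blast
  moreover have "closed K"
  proof (rule closed_sequential_limits[THEN iffD2, rule_format])
    fix x l assume "(\<forall>n. x n \<in> K) \<and> x \<longlonglongrightarrow> l"
    then have x: "\<And>n. x n \<in> K" "x \<longlonglongrightarrow> l" by auto
    have "Im l \<ge> 0"
      by (rule LIMSEQ_le_const[OF tendsto_Im[OF x(2)]]) (use x(1) in \<open>auto simp: K_def H_def intro: less_imp_le\<close>)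
    show "l \<in> K"
    proof (cases "Im l = 0")
      case True
      obtain d where d: "d > 0" "\<And>z. Im z > 0 \<Longrightarrow> dist z (of_real (Re l)) < d \<Longrightarrow> cmod (G z) \<le> 1 + e"
        using bd[OF e(1), of "Re l"] by blast
      have l: "l = of_real (Re l)" using True by (simp add: complex_eq_iff)
      obtain n where "dist (x n) l < d"
        using x(2) d(1) unfolding lim_sequentially by blast
      then have "cmod (G (x n)) \<le> 1 + e"
        using x(1)[of n] d(2)[of "x n"] l by (simp add: K_def H_def)
      then show ?thesis using x(1)[of n] e(2) by (simp add: K_def)
    next
      case False
      then have lH: "l \<in> H" using \<open>Im l \<ge> 0\<close> by (simp add: H_def)
      then have "isCont G l" using cont H(1) continuous_on_eq_continuous_at by blast
      then have "(\<lambda>n. cmod (G (x n))) \<longlonglongrightarrow> cmod (G l)"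
        by (intro tendsto_norm isCont_tendsto_compose[OF _ x(2)])
      then have "cmod (G z0) \<le> cmod (G l)"
        by (rule LIMSEQ_le_const) (use x(1) in \<open>auto simp: K_def\<close>)
      then show ?thesis using lH by (simp add: K_def)
    qed
  qed
  ultimately have "compact K" by (simp add: compact_eq_bounded_closed)
  moreover have z0K: "z0 \<in> K" using z0 by (simp add: K_def H_def)
  moreover have "continuous_on K (\<lambda>z. cmod (G z))"
    by (intro continuous_on_norm continuous_on_subset[OF cont]) (auto simp: K_def)
  ultimately obtain z1 where z1: "z1 \<in> K" "\<And>z. z \<in> K \<Longrightarrow> cmod (G z) \<le> cmod (G z1)"
    using continuous_attains_sup[of K "\<lambda>z. cmod (G z)"] by blast
  have "G constant_on H"
  proof (rule maximum_modulus_principle[of G H H z1])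
    show "cmod (G z) \<le> cmod (G z1)" if "z \<in> H" for z
      using z1(2)[of z] z1(2)[OF z0K] that by (cases "z \<in> K") (auto simp: K_def)
  qed (use hol H z1 in \<open>auto simp: H_def K_def\<close>)
  then obtain c where c: "\<And>z. z \<in> H \<Longrightarrow> G z = c" by (auto simp: constant_on_def)
  \<comment> \<open>A constant of modulus above \<open>1 + e\<close> contradicts the bound near infinity.\<close>
  define w where "w = Complex 0 (\<bar>R\<bar> + 1)"
  have "Im w > 0" "cmod w > R" by (auto simp: w_def cmod_def)
  then have "cmod c \<le> 1 + e" using R[of w] c[of w] by (simp add: H_def)
  then show False using c[of z0] z0 e by (simp add: H_def)
qed

text \<open>A bounded function may violate the boundary condition at finitely many points: a power of it is multiplied
  by a product of factors of modulus at most 1 that vanish at these points, and afterwards the exponent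
  tends to infinity.\<close>

lemma upper_half_plane_max_exceptional:
  assumes hol: "G holomorphic_on {z. Im z > 0}" and X: "finite X"
    and M: "\<And>z. Im z > 0 \<Longrightarrow> cmod (G z) \<le> M"
    and inf: "\<And>e. e > 0 \<Longrightarrow> \<exists>R. \<forall>z. Im z > 0 \<longrightarrow> cmod z > R \<longrightarrow> cmod (G z) \<le> 1 + e"
    and bd: "\<And>e x. e > 0 \<Longrightarrow> x \<notin> X \<Longrightarrow> \<exists>d>0. \<forall>z. Im z > 0 \<longrightarrow> dist z (of_real x) < d \<longrightarrow> cmod (G z) \<le> 1 + e"
    and z0: "Im z0 > 0"
  shows "cmod (G z0) \<le> 1"
proof (rule ccontr)
  assume "\<not> ?thesis"
  then have m: "cmod (G z0) > 1" by simp
  define b where "b x z = (z - of_real x) / (z - of_real x + \<i>)" for x z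
  define B where "B z = (\<Prod>x\<in>X. b x z)" for z
  have den: "z - of_real x + \<i> \<noteq> 0" if "Im z > 0" for x z
    using that by (auto simp: complex_eq_iff)
  have b1: "cmod (b x z) \<le> 1" if "Im z > 0" for x z
  proof -
    have "cmod (z - of_real x) \<le> cmod (z - of_real x + \<i>)"
      using that by (simp add: cmod_def power2_eq_square algebra_simps)
    then show ?thesis using den[OF that] by (simp add: b_def norm_divide divide_le_eq)
  qed
  have B1: "cmod (B z) \<le> 1" if "Im z > 0" for z
    unfolding B_def prod_norm[symmetric] using b1[OF that] by (intro prod_le_1) auto
  have Bz: "B z0 \<noteq> 0"
    using X z0 den[OF z0] by (auto simp: B_def b_def)
  have root: "\<exists>d>0. (1 + d) ^ n \<le> 1 + e" if "e > 0" for e :: real and n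
  proof (cases "n = 0")
    case False
    define d where "d = root n (1 + e) - 1"
    have "d > 0" using that False by (simp add: d_def)
    moreover have "(1 + d) ^ n = 1 + e" using that False by (simp add: d_def)
    ultimately show ?thesis by (intro exI[of _ d]) auto
  qed (use that in \<open>auto intro!: exI[of _ 1]\<close>)
  have "cmod (G z0 ^ n * B z0) \<le> 1" for n
  proof (rule upper_half_plane_max[where G = "\<lambda>z. G z ^ n * B z"])
    show "(\<lambda>z. G z ^ n * B z) holomorphic_on {z. Im z > 0}"
      unfolding B_def b_def using den by (intro holomorphic_intros hol) auto
    show "Im z0 > 0" by (rule z0)
    have prod: "cmod (G z ^ n * B z) \<le> (1 + d) ^ n" if "Im z > 0" "cmod (G z) \<le> 1 + d" for z d
    proof -
      have "cmod (G z ^ n * B z) \<le> cmod (G z) ^ n * 1"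
        unfolding norm_mult norm_power using B1[OF that(1)] by (intro mult_left_mono) auto
      also have "\<dots> \<le> (1 + d) ^ n" using that(2) by (simp add: power_mono)
      finally show ?thesis .
    qed
    show "\<exists>R. \<forall>z. Im z > 0 \<longrightarrow> cmod z > R \<longrightarrow> cmod (G z ^ n * B z) \<le> 1 + e" if e: "e > 0" for e
    proof -
      obtain d where d: "d > 0" "(1 + d) ^ n \<le> 1 + e" using root[OF e] by blast
      then show ?thesis using inf[OF d(1)] prod[of _ d] by (meson order.trans)
    qed
    show "\<exists>d>0. \<forall>z. Im z > 0 \<longrightarrow> dist z (of_real x) < d \<longrightarrow> cmod (G z ^ n * B z) \<le> 1 + e"
      if e: "e > 0" for e x
    proof (cases "x \<in> X")
      case False
      obtain d where d: "d > 0" "(1 + d) ^ n \<le> 1 + e" using root[OF e] by blast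
      then show ?thesis using bd[OF d(1) False] prod[of _ d] by (meson order.trans)
    next
      case True
      define M' where "M' = \<bar>M\<bar> + 1"
      have M': "M' \<ge> 1" "\<And>z. Im z > 0 \<Longrightarrow> cmod (G z) \<le> M'"
      proof -
        show "M' \<ge> 1" by (simp add: M'_def)
        show "cmod (G z) \<le> M'" if "Im z > 0" for z
          using M[OF that] unfolding M'_def by linarith
      qed
      have "cmod (G z ^ n * B z) \<le> 1 + e" if z: "Im z > 0" "dist z (of_real x) < 1 / M' ^ n" for z
      proof -
        have "cmod (z - of_real x + \<i>) \<ge> 1"
          using abs_Im_le_cmod[of "z - of_real x + \<i>"] z(1) by simp
        then have "cmod (b x z) \<le> cmod (z - of_real x)"
          unfolding b_def norm_divide
          by (simp add: divide_le_eq mult_le_cancel_left1 less_le_trans[OF zero_less_one])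
        moreover have "cmod (B z) \<le> cmod (b x z)"
        proof -
          have "cmod (B z) = cmod (b x z) * (\<Prod>x\<in>X - {x}. cmod (b x z))"
            unfolding B_def prod_norm[symmetric] using True X by (subst prod.remove[of _ x]) auto
          also have "\<dots> \<le> cmod (b x z) * 1"
            using b1[OF z(1)] by (intro mult_left_mono prod_le_1) auto
          finally show ?thesis by simp
        qed
        ultimately have "cmod (B z) \<le> 1 / M' ^ n" using z(2) by (simp add: dist_norm)
        then have "cmod (G z ^ n * B z) \<le> M' ^ n * (1 / M' ^ n)"
          unfolding norm_mult norm_power using M'(2)[OF z(1)] M'(1) by (intro mult_mono power_mono) auto
        then show ?thesis using M'(1) e by simp
      qed
      then show ?thesis using M'(1) by (intro exI[of _ "1 / M' ^ n"]) auto
    qed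
  qed
  then have le: "cmod (G z0) ^ n * cmod (B z0) \<le> 1" for n
    by (simp add: norm_mult norm_power)
  obtain n where "1 / cmod (B z0) < cmod (G z0) ^ n"
    using real_arch_pow[OF m] by blast
  then have "1 < cmod (G z0) ^ n * cmod (B z0)" using Bz by (simp add: divide_less_eq)
  then show False using le[of n] by simp
qed

section \<open>The extremal problem\<close>

lemma tendsto_over_at_infinity:
  assumes "((\<lambda>z. z * (u z - c)) \<longlongrightarrow> d) (at_infinity :: complex filter)"
  shows "(u \<longlongrightarrow> c) at_infinity"
proof -
  have lim: "((\<lambda>z. (z * (u z - c)) * inverse z) \<longlongrightarrow> d * 0) at_infinity"
    by (intro tendsto_mult assms tendsto_inverse_0)
  have "eventually (\<lambda>z. (z * (u z - c)) * inverse z = u z - c) at_infinity"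
    using eventually_not_equal_at_infinity[of "0::complex"] by eventually_elim simp
  from Lim_transform_eventually[OF lim this] have "((\<lambda>z. u z - c) \<longlongrightarrow> 0) at_infinity"
    by simp
  then show ?thesis by (simp add: LIM_zero_iff)
qed

lemma tendsto_compose_first_order:
  fixes F :: "complex \<Rightarrow> complex"
  assumes F: "(F has_field_derivative D) (at c)" and F0: "F c = e"
    and u: "((\<lambda>z. z * (u z - c)) \<longlongrightarrow> d) at_infinity"
  shows "((\<lambda>z. z * (F (u z) - e)) \<longlongrightarrow> D * d) at_infinity"
proof -
  obtain q where q: "\<And>z. F z - F c = q z * (z - c)" "isCont q c" "q c = D"
    using F unfolding CARAT_DERIV by blast
  have "((\<lambda>z. q (u z)) \<longlongrightarrow> D) at_infinity"
    using isCont_tendsto_compose[OF q(2) tendsto_over_at_infinity[OF u]] q(3) by simp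
  from tendsto_mult[OF this u]
  have "((\<lambda>z. q (u z) * (z * (u z - c))) \<longlongrightarrow> D * d) at_infinity" .
  moreover have "z * (F (u z) - e) = q (u z) * (z * (u z - c))" for z
    unfolding F0[symmetric] q(1) by (rule mult.left_commute)
  ultimately show ?thesis by presburger
qed

lemma cnj_sgn_mult: "cnj (sgn w) * w = of_real (cmod w)" for w :: complex
proof -
  have "cnj w * w = of_real ((cmod w)\<^sup>2)"
    by (metis complex_norm_square mult.commute)
  then show ?thesis
    by (cases "w = 0") (simp_all add: sgn_div_norm scaleR_conv_of_real power2_eq_square mult.assoc)
qed

context bands
begin

text \<open>The total length of the bands; one quarter of it is the analytic capacity of \<open>E\<close>.\<close>

definition total_length :: real where "total_length = (\<Sum>j\<le>g. \<alpha> j - \<beta> j)"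

lemma E_compact: "compact E"
  unfolding E by (intro compact_UN) auto

lemma open_complement: "open (- complex_of_real ` E)"
proof -
  have "compact (complex_of_real ` E)"
    by (intro compact_continuous_image E_compact continuous_intros)
  then show ?thesis by (simp add: compact_imp_closed open_Compl)
qed

lemma complement_near_infinity: "\<exists>R>0. \<forall>z. cmod z \<ge> R \<longrightarrow> z \<notin> complex_of_real ` E"
proof -
  obtain R where R: "R > 0" "\<And>x. x \<in> E \<Longrightarrow> \<bar>x\<bar> \<le> R"
    using E_compact compact_imp_bounded bounded_pos[of E] by auto
  then show ?thesis by (intro exI[of _ "R + 1"]) fastforce
qed

lemma ratio_asymptotics: "((\<lambda>z. z * (ratio z - 1)) \<longlongrightarrow> of_real total_length) at_infinity"
proof -
  define q where "q j z = (z - complex_of_real (\<beta> j)) / (z - of_real (\<alpha> j))" for j z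
  have single: "((\<lambda>z. z * (q j z - 1)) \<longlongrightarrow> of_real (\<alpha> j - \<beta> j)) at_infinity" for j
  proof -
    have "((\<lambda>z. of_real (\<alpha> j - \<beta> j) / (1 - of_real (\<alpha> j) * inverse z)) \<longlongrightarrow>
        of_real (\<alpha> j - \<beta> j) / (1 - of_real (\<alpha> j) * 0)) (at_infinity :: complex filter)"
      by (intro tendsto_intros tendsto_inverse_0) auto
    moreover have "eventually (\<lambda>z. of_real (\<alpha> j - \<beta> j) / (1 - of_real (\<alpha> j) * inverse z) = z * (q j z - 1)) at_infinity"
      using eventually_not_equal_at_infinity[of "0::complex"] eventually_not_equal_at_infinity[of "complex_of_real (\<alpha> j)"]
      by eventually_elim (simp add: q_def field_simps)
    ultimately show ?thesis
      using Lim_transform_eventually by force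
  qed
  have "((\<lambda>z. z * ((\<Prod>j\<le>n. q j z) - 1)) \<longlongrightarrow> of_real (\<Sum>j\<le>n. \<alpha> j - \<beta> j)) at_infinity" for n
  proof (induction n)
    case 0
    then show ?case using single[of 0] by simp
  next
    case (Suc n)
    have "((\<lambda>z. (\<Prod>j\<le>n. q j z) * (z * (q (Suc n) z - 1)) + z * ((\<Prod>j\<le>n. q j z) - 1)) \<longlongrightarrow>
        1 * of_real (\<alpha> (Suc n) - \<beta> (Suc n)) + of_real (\<Sum>j\<le>n. \<alpha> j - \<beta> j)) at_infinity"
      by (intro tendsto_add tendsto_mult single Suc.IH tendsto_over_at_infinity[OF Suc.IH])
    then show ?case by (simp add: algebra_simps)
  qed
  from this[of g] show ?thesis
    by (simp add: total_length_def ratio_def PA_def PB_def q_def prod_dividef)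
qed

lemma csqrt_ratio_asymptotics:
  "((\<lambda>z. z * (csqrt (ratio z) - 1)) \<longlongrightarrow> of_real (total_length / 2)) at_infinity"
proof -
  have "(csqrt has_field_derivative inverse (2 * csqrt 1)) (at 1)"
    by (rule has_field_derivative_csqrt) simp
  from tendsto_compose_first_order[OF this _ ratio_asymptotics, of 1]
  show ?thesis by simp
qed

lemma ahlfors_formula_asymptotics:
  "((\<lambda>z. z * ahlfors_formula z) \<longlongrightarrow> of_real (total_length / 4)) at_infinity"
proof -
  have "((\<lambda>s. (s - 1) / (s + 1)) has_field_derivative 1 / 2) (at (1::complex))"
    by (auto intro!: derivative_eq_intros)
  from tendsto_compose_first_order[OF this _ csqrt_ratio_asymptotics, of 0]
  show ?thesis by (simp add: ahlfors_formula_def)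
qed

lemma ratio_holomorphic: "ratio holomorphic_on - of_real ` E"
  unfolding ratio_def[abs_def] PA_def PB_def
  by (intro holomorphic_intros) (use PA_PB_nonzero in \<open>auto simp: PA_def\<close>)

lemma csqrt_ratio_holomorphic: "(\<lambda>z. csqrt (ratio z)) holomorphic_on - of_real ` E"
  using ratio_slit by (intro holomorphic_on_csqrt' ratio_holomorphic) auto

lemma ahlfors_formula_admissible: "ahlfors_admissible E ahlfors_formula"
proof -
  have "ahlfors_formula holomorphic_on - of_real ` E"
    unfolding ahlfors_formula_def[abs_def]
    by (intro holomorphic_intros csqrt_ratio_holomorphic) (use csqrt_ratio_add_1 in auto)
  moreover have "(ahlfors_formula \<longlongrightarrow> 0) at_infinity"
    using tendsto_over_at_infinity[of ahlfors_formula 0] ahlfors_formula_asymptotics by auto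
  moreover have "cmod (ahlfors_formula z) \<le> 1" if "z \<notin> of_real ` E" for z
  proof -
    define s where "s = csqrt (ratio z)"
    have "Re s > 0" unfolding s_def by (rule Re_csqrt_ratio[OF that])
    then have "cmod (s - 1) \<le> cmod (s + 1)"
      by (simp add: cmod_def power2_eq_square algebra_simps)
    moreover have "s + 1 \<noteq> 0" unfolding s_def by (rule csqrt_ratio_add_1[OF that])
    ultimately show ?thesis
      by (simp add: ahlfors_formula_def s_def[symmetric] norm_divide divide_le_eq)
  qed
  ultimately show ?thesis by (simp add: ahlfors_admissible_def)
qed

text \<open>Let \<open>k = (1 + \<phi>) / (1 - \<phi>)\<close> and \<open>s = \<surd>ratio\<close>; both have positive real part, and at infinity
  \<open>Ln k\<close> and \<open>Ln s\<close> behave like \<open>2 M / z\<close> and \<open>total_length / (2 z)\<close>. In the upper half-plane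
  \<open>Im (Ln s) \<le> Im (Ln k)\<close>, by the maximum principle applied to \<open>exp (\<i> (Ln k - Ln s))\<close>: inside the bands
  \<open>Im (Ln s)\<close> has the boundary value \<open>-\<pi>/2\<close>, the least possible one, and on the rest of the real line both
  imaginary parts vanish. Comparing the two asymptotics along the imaginary axis gives the bound.\<close>

lemma symmetric_bound:
  assumes hol: "\<phi> holomorphic_on - of_real ` E" and le: "\<And>z. z \<notin> of_real ` E \<Longrightarrow> cmod (\<phi> z) \<le> r"
    and r: "r < 1" and sym: "\<And>z. \<phi> (cnj z) = cnj (\<phi> z)"
    and lim: "((\<lambda>z. z * \<phi> z) \<longlongrightarrow> of_real M) at_infinity"
  shows "M \<le> total_length / 4"
proof -
  define k where "k z = (1 + \<phi> z) / (1 - \<phi> z)" for z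
  define s where "s z = csqrt (ratio z)" for z
  \<comment> \<open>Its modulus is \<open>exp (Im (Ln (s z)) - Im (Ln (k z)))\<close>.\<close>
  define G where "G z = exp (\<i> * (Ln (k z) - Ln (s z)))" for z
  have nz: "1 - \<phi> z \<noteq> 0" if "z \<notin> of_real ` E" for z
    using le[OF that] r by auto
  have Rek: "Re (k z) > 0" if "z \<notin> of_real ` E" for z
  proof -
    have "Re (k z) = (1 - (cmod (\<phi> z))\<^sup>2) / (cmod (1 - \<phi> z))\<^sup>2"
      unfolding k_def Re_divide cmod_power2 by (simp add: power2_eq_square algebra_simps)
    moreover have "(cmod (\<phi> z))\<^sup>2 < 1"
      using le[OF that] r by (simp add: abs_square_less_1)
    ultimately show ?thesis using nz[OF that] by simp
  qed
  have Res: "Re (s z) > 0" if "z \<notin> of_real ` E" for z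
    unfolding s_def by (rule Re_csqrt_ratio[OF that])
  have slit: "w \<notin> \<real>\<^sub>\<le>\<^sub>0" if "Re w > 0" for w :: complex
    using that by (simp add: complex_nonpos_Reals_iff)
  have khol: "k holomorphic_on - of_real ` E"
    unfolding k_def[abs_def] by (intro holomorphic_intros hol) (use nz in auto)
  have Ghol: "G holomorphic_on - of_real ` E"
    unfolding G_def[abs_def]
    by (intro holomorphic_intros holomorphic_on_Ln' khol csqrt_ratio_holomorphic[folded s_def])
       (use slit Rek Res in auto)
  have H: "z \<notin> of_real ` E" if "Im z > 0" for z using that by auto
  have normG: "cmod (G z) = exp (Im (Ln (s z)) - Im (Ln (k z)))" for z
    by (simp add: G_def norm_exp_eq_Re)
  have Imk: "\<bar>Im (Ln (k z))\<bar> < pi / 2" "\<bar>Im (Ln (s z))\<bar> < pi / 2" if "z \<notin> of_real ` E" for z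
    using Re_Ln_pos_lt_imp Rek[OF that] Res[OF that] by auto
  have phi0: "((\<lambda>z. z * (\<phi> z - 0)) \<longlongrightarrow> of_real M) at_infinity" using lim by simp
  have "((\<lambda>w. (1 + w) / (1 - w)) has_field_derivative 2) (at (0::complex))"
    by (auto intro!: derivative_eq_intros)
  from tendsto_compose_first_order[OF this _ phi0, of 1]
  have k1: "((\<lambda>z. z * (k z - 1)) \<longlongrightarrow> 2 * of_real M) at_infinity" by (simp add: k_def)
  have Ln1: "(Ln has_field_derivative 1) (at 1)"
    using has_field_derivative_Ln[of 1] by simp
  have Lnk: "((\<lambda>z. z * (Ln (k z) - 0)) \<longlongrightarrow> 1 * (2 * of_real M)) at_infinity"
    by (rule tendsto_compose_first_order[OF Ln1 _ k1]) simp
  have Lns: "((\<lambda>z. z * (Ln (s z) - 0)) \<longlongrightarrow> 1 * of_real (total_length / 2)) at_infinity"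
    by (rule tendsto_compose_first_order[OF Ln1 _ csqrt_ratio_asymptotics[folded s_def]]) simp
  have le1: "cmod (G z) \<le> 1" if "Im z > 0" for z
  proof (rule upper_half_plane_max_exceptional[where G = G and ?z0.0 = z and X = "\<alpha> ` {..g} \<union> \<beta> ` {..g}" and M = "exp pi"])
    show "G holomorphic_on {z. Im z > 0}"
      by (rule holomorphic_on_subset[OF Ghol]) auto
    show "cmod (G z) \<le> exp pi" if "Im z > 0" for z
      using Imk[OF H[OF that]] unfolding normG by simp
    show "Im z > 0" by fact
    show "\<exists>R. \<forall>z. Im z > 0 \<longrightarrow> cmod z > R \<longrightarrow> cmod (G z) \<le> 1 + e" if "e > 0" for e
    proof -
      have "((\<lambda>z. cmod (G z)) \<longlongrightarrow> cmod (exp (\<i> * (0 - 0)))) at_infinity"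
        unfolding G_def by (intro tendsto_intros tendsto_over_at_infinity[OF Lnk] tendsto_over_at_infinity[OF Lns])
      then have "eventually (\<lambda>z. cmod (G z) < 1 + e) at_infinity"
        by (rule order_tendstoD) (use that in simp)
      then show ?thesis by (auto simp: eventually_at_infinity intro: less_imp_le)
    qed
    show "\<exists>d>0. \<forall>z. Im z > 0 \<longrightarrow> dist z (of_real x) < d \<longrightarrow> cmod (G z) \<le> 1 + e"
      if e: "e > 0" and x: "x \<notin> \<alpha> ` {..g} \<union> \<beta> ` {..g}" for e x
    proof (cases "x \<in> E")
      case False
      then have xE: "complex_of_real x \<notin> of_real ` E" by auto
      have "cnj (\<phi> (of_real x)) = \<phi> (of_real x)" using sym[of "of_real x"] by simp
      then have "\<phi> (of_real x) \<in> \<real>" by (simp add: Reals_cnj_iff)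
      then have "k (of_real x) \<in> \<real>" by (auto simp: k_def)
      then have "Im (Ln (k (of_real x))) = 0"
        using Rek[OF xE] by (subst Im_Ln_eq_0) (auto simp: complex_is_Real_iff)
      moreover have "PB x / PA x > 0"
        using False PA_PB_sign[of x] by (auto simp: zero_less_divide_iff zero_less_mult_iff not_le)
      then have "s (of_real x) \<in> \<real>"
        unfolding s_def ratio_of_real by (subst of_real_sqrt[symmetric]) auto
      then have "Im (Ln (s (of_real x))) = 0"
        using Res[OF xE] by (subst Im_Ln_eq_0) (auto simp: complex_is_Real_iff)
      ultimately have G1: "cmod (G (of_real x)) = 1" by (simp add: normG)
      have "isCont G (of_real x)"
        using holomorphic_on_imp_continuous_on[OF Ghol] open_complement xE continuous_on_eq_continuous_at by blast
      then have "((\<lambda>z. cmod (G z)) \<longlongrightarrow> 1) (at (of_real x))"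
        using G1 tendsto_norm[of G "G (of_real x)" "at (of_real x)"] by (simp add: isCont_def)
      then have "eventually (\<lambda>z. cmod (G z) < 1 + e) (at (of_real x))"
        by (rule order_tendstoD) (use e in simp)
      then obtain d where d: "d > 0" "\<And>z. z \<noteq> of_real x \<Longrightarrow> dist z (of_real x) < d \<Longrightarrow> cmod (G z) < 1 + e"
        unfolding eventually_at by auto
      show ?thesis
      proof (intro exI[of _ d] conjI allI impI)
        fix z assume "Im z > 0" "dist z (of_real x) < d"
        then show "cmod (G z) \<le> 1 + e" using d(2)[of z] by (force intro: less_imp_le)
      qed (rule d)
    next
      case True
      have PAB: "PA (complex_of_real x) \<noteq> 0" "PB (complex_of_real x) \<noteq> 0"
        using x by (auto simp: PA_eq_0 PB_eq_0)
      then have "PB x / PA x < 0"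
        using True PA_PB_sign[of x] of_real_PAB[of x]
        by (auto simp: divide_less_0_iff divide_le_0_iff mult_le_0_iff less_le)
      then obtain v where v: "v < 0" "ratio (of_real x) = complex_of_real v"
        using ratio_of_real by blast
      have rlim: "(ratio \<longlongrightarrow> of_real v) (at (of_real x))"
        unfolding v(2)[symmetric] ratio_def PA_def PB_def
        by (intro tendsto_intros) (use PAB in \<open>auto simp: PA_def\<close>)
      \<comment> \<open>A majorant of the modulus of \<open>G\<close> that tends to 1 at \<open>x\<close>.\<close>
      define h where "h z = exp (pi / 2 - arccos (Re (ratio z) / cmod (ratio z)) / 2)" for z
      have "((\<lambda>z. Re (ratio z) / cmod (ratio z)) \<longlongrightarrow> Re (of_real v) / cmod (of_real v)) (at (of_real x))"
        by (intro tendsto_intros rlim) (use v in auto)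
      moreover have abs1: "\<bar>Re w / cmod w\<bar> \<le> 1" for w
        using abs_Re_le_cmod[of w] by (cases "w = 0") (auto simp: abs_divide divide_le_eq)
      have "Re w / cmod w \<in> {-1..1}" for w
        using abs1[of w] unfolding atLeastAtMost_iff by linarith
      ultimately have "((\<lambda>z. arccos (Re (ratio z) / cmod (ratio z))) \<longlongrightarrow> arccos (-1)) (at (of_real x))"
        using v by (intro continuous_on_tendsto_compose[OF continuous_on_arccos']) auto
      then have "(h \<longlongrightarrow> exp (pi / 2 - arccos (-1) / 2)) (at (of_real x))"
        unfolding h_def[abs_def] by (intro tendsto_intros) auto
      then have "(h \<longlongrightarrow> 1) (at (of_real x))" by simp
      then have "eventually (\<lambda>z. h z < 1 + e) (at (of_real x))"
        by (rule order_tendstoD) (use e in simp)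
      then obtain d where d: "d > 0" "\<And>z. z \<noteq> of_real x \<Longrightarrow> dist z (of_real x) < d \<Longrightarrow> h z < 1 + e"
        unfolding eventually_at by auto
      have "cmod (G z) \<le> h z" if z: "Im z > 0" for z
      proof -
        define A where "A = Arg (ratio z)"
        have f: "Im (ratio z) < 0" by (rule Im_ratio_neg[OF z])
        then have f0: "ratio z \<noteq> 0" by auto
        have A: "A < 0" "- pi < A"
          using f mpi_less_Arg[of "ratio z"] by (auto simp: A_def Arg_neg_iff)
        have "ratio z = of_real (cmod (ratio z)) * exp (\<i> * of_real A)"
          unfolding A_def by (rule Arg_eq[OF f0])
        then have "Re (ratio z) = Re (of_real (cmod (ratio z)) * exp (\<i> * of_real A))" by simp
        then have "Re (ratio z) = cmod (ratio z) * cos A"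
          by (simp add: Re_exp)
        then have "arccos (Re (ratio z) / cmod (ratio z)) = - A"
          using f0 A arccos_cos2[of A] by simp
        moreover have "s z \<noteq> 0" using Res[OF H[OF z]] by auto
        then have "Im (Ln (s z)) = A / 2"
          using Arg_eq_Im_Ln[of "s z"] by (simp add: s_def A_def)
        ultimately show ?thesis
          using Imk(1)[OF H[OF z]] by (simp add: normG h_def abs_less_iff)
      qed
      then show ?thesis
      proof (intro exI[of _ d] conjI allI impI)
        fix z assume z: "Im z > 0" "dist z (of_real x) < d"
        then have "cmod (G z) \<le> h z" using \<open>\<And>z. Im z > 0 \<Longrightarrow> cmod (G z) \<le> h z\<close> by simp
        moreover have "h z < 1 + e" using z by (intro d(2)) auto
        ultimately show "cmod (G z) \<le> 1 + e" by simp
      qed (rule d)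
    qed
  qed auto
  have inf: "filterlim (\<lambda>y. Complex 0 y) at_infinity at_top"
  proof -
    have "filterlim (\<lambda>y::real. norm (Complex 0 y)) at_top at_top"
      by (simp add: cmod_def filterlim_abs_real)
    then show ?thesis by (rule filterlim_norm_at_top_imp_at_infinity)
  qed
  have "Re (1 * (2 * of_real M)) \<le> Re (1 * complex_of_real (total_length / 2))"
  proof (rule tendsto_le)
    show "((\<lambda>y. Re (Complex 0 y * (Ln (k (Complex 0 y)) - 0))) \<longlongrightarrow> Re (1 * (2 * of_real M))) at_top"
      by (intro tendsto_Re filterlim_compose[OF Lnk inf])
    show "((\<lambda>y. Re (Complex 0 y * (Ln (s (Complex 0 y)) - 0))) \<longlongrightarrow> Re (1 * complex_of_real (total_length / 2))) at_top"
      by (intro tendsto_Re filterlim_compose[OF Lns inf])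
    show "eventually (\<lambda>y. Re (Complex 0 y * (Ln (k (Complex 0 y)) - 0)) \<le> Re (Complex 0 y * (Ln (s (Complex 0 y)) - 0))) at_top"
      using eventually_gt_at_top[of 0]
    proof eventually_elim
      case (elim y)
      then have "Im (Ln (s (Complex 0 y))) \<le> Im (Ln (k (Complex 0 y)))"
        using le1[of "Complex 0 y"] by (simp add: normG)
      then show ?case using elim by simp
    qed
  qed simp
  then show ?thesis by simp
qed


text \<open>The general case is reduced to the symmetric one by a rotation, by averaging \<open>\<phi>(z)\<close> with the conjugate of
  \<open>\<phi>\<close> at the conjugate point, and by multiplying with \<open>r < 1\<close>.\<close>

lemma admissible_bound:
  assumes adm: "ahlfors_admissible E \<phi>" and lim: "((\<lambda>z. z * \<phi> z) \<longlongrightarrow> M) at_infinity"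
  shows "cmod M \<le> total_length / 4"
proof -
  have hol: "\<phi> holomorphic_on - of_real ` E" and le: "\<And>z. z \<notin> of_real ` E \<Longrightarrow> cmod (\<phi> z) \<le> 1"
    using adm by (auto simp: ahlfors_admissible_def)
  obtain u where u: "cmod u = 1" "u * M = of_real (cmod M)"
  proof (cases "M = 0")
    case False
    then show ?thesis using that[of "cnj (sgn M)"] by (simp add: norm_sgn cnj_sgn_mult)
  qed (use that[of 1] in simp)
  have cnjE: "cnj z \<in> of_real ` E \<longleftrightarrow> z \<in> of_real ` E" for z
    by (metis (no_types, lifting) complex_cnj_cnj complex_cnj_complex_of_real image_iff)
  define \<omega> where omega_def: "\<omega> z = (u * \<phi> z + cnj (u * \<phi> (cnj z))) / 2" for z
  have cimg: "cnj ` (- of_real ` E) = - of_real ` E"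
    by (rule set_eqI) (simp only: image_cnj_conv_vimage_cnj vimage_eq Compl_iff cnjE)
  have "cnj \<circ> (\<lambda>z. u * \<phi> z) \<circ> cnj holomorphic_on - of_real ` E"
    by (intro holomorphic_on_compose_cnj_cnj open_complement) (unfold cimg, intro holomorphic_intros hol)
  then have "(\<lambda>z. cnj (u * \<phi> (cnj z))) holomorphic_on - of_real ` E"
    by (simp add: o_def)
  then have omegahol: "\<omega> holomorphic_on - of_real ` E"
    unfolding omega_def[abs_def] by (intro holomorphic_intros hol) auto
  have omegale: "cmod (\<omega> z) \<le> 1" if z: "z \<notin> of_real ` E" for z
  proof -
    have "cmod (u * \<phi> z + cnj (u * \<phi> (cnj z))) \<le> cmod (u * \<phi> z) + cmod (cnj (u * \<phi> (cnj z)))"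
      by (rule norm_triangle_ineq)
    also have "\<dots> \<le> 1 + 1"
      using le[OF z] le[of "cnj z"] z cnjE[of z]
      by (intro add_mono) (auto simp: norm_mult u simp del: complex_cnj_mult)
    finally show ?thesis by (simp add: omega_def norm_divide)
  qed
  have cinf: "filterlim cnj at_infinity at_infinity"
    by (rule filterlim_norm_at_top_imp_at_infinity) (simp add: filterlim_norm_at_top)
  have l1: "((\<lambda>z. u * (z * \<phi> z)) \<longlongrightarrow> u * M) at_infinity"
    by (intro tendsto_intros lim)
  have l2: "((\<lambda>z. cnj (u * (cnj z * \<phi> (cnj z)))) \<longlongrightarrow> cnj (u * M)) at_infinity"
    by (intro tendsto_cnj filterlim_compose[OF l1 cinf])
  have "((\<lambda>z. (u * (z * \<phi> z) + cnj (u * (cnj z * \<phi> (cnj z)))) / 2) \<longlongrightarrow> (u * M + cnj (u * M)) / 2) at_infinity"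
    by (rule tendsto_divide[OF tendsto_add[OF l1 l2] tendsto_const]) simp
  moreover have "(u * (z * \<phi> z) + cnj (u * (cnj z * \<phi> (cnj z)))) / 2 = z * \<omega> z" for z
    by (simp add: omega_def field_simps)
  ultimately have omegalim: "((\<lambda>z. z * \<omega> z) \<longlongrightarrow> of_real (cmod M)) at_infinity"
    by (simp add: u)
  show ?thesis
  proof (rule field_le_mult_one_interval)
    fix r :: real assume r: "0 < r" "r < 1"
    show "r * cmod M \<le> total_length / 4"
    proof (rule symmetric_bound[OF _ _ r(2)])
      show "(\<lambda>z. of_real r * \<omega> z) holomorphic_on - of_real ` E"
        by (intro holomorphic_intros omegahol)
      show "cmod (of_real r * \<omega> z) \<le> r" if "z \<notin> of_real ` E" for z
        using omegale[OF that] r by (simp add: norm_mult mult_left_le)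
      show "of_real r * \<omega> (cnj z) = cnj (of_real r * \<omega> z)" for z
        by (simp add: omega_def)
      have "((\<lambda>z. of_real r * (z * \<omega> z)) \<longlongrightarrow> of_real r * of_real (cmod M)) at_infinity"
        by (intro tendsto_intros omegalim)
      then show "((\<lambda>z. z * (of_real r * \<omega> z)) \<longlongrightarrow> of_real (r * cmod M)) at_infinity"
        by (simp add: mult.left_commute)
    qed
  qed
qed

lemma vanishes_near_infinity_imp_zero:
  assumes hol: "k holomorphic_on - of_real ` E" and R: "\<And>z. cmod z > R \<Longrightarrow> k z = 0"
    and z: "z \<notin> of_real ` E"
  shows "k z = 0"
proof -
  have half: "k z = 0" if nonreal: "Im z \<noteq> 0" for z
  proof -
    have big: "cmod w > R" if "\<bar>Im w\<bar> > \<bar>R\<bar>" for w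
      using abs_Im_le_cmod[of w] that by linarith
    have nE: "w \<notin> of_real ` E" if "Im w \<noteq> 0" for w using that by auto
    consider "Im z > 0" | "Im z < 0" using nonreal by linarith
    then show ?thesis
    proof cases
      case 1
      show ?thesis
      proof (rule analytic_continuation_open[where s = "{w. Im w > \<bar>R\<bar>}" and s' = "{w. Im w > 0}" and f = k and g = "\<lambda>_. 0"])
        show "{w. Im w > \<bar>R\<bar>} \<noteq> {}" by (auto intro!: exI[of _ "Complex 0 (\<bar>R\<bar> + 1)"])
        show "k holomorphic_on {w. Im w > 0}"
          by (rule holomorphic_on_subset[OF hol]) (use nE in auto)
        show "k w = 0" if "w \<in> {w. Im w > \<bar>R\<bar>}" for w
          using that by (intro R big) auto
      qed (use 1 in \<open>auto intro: open_halfspace_Im_gt convex_connected convex_halfspace_Im_gt\<close>)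
    next
      case 2
      show ?thesis
      proof (rule analytic_continuation_open[where s = "{w. Im w < - \<bar>R\<bar>}" and s' = "{w. Im w < 0}" and f = k and g = "\<lambda>_. 0"])
        show "{w. Im w < - \<bar>R\<bar>} \<noteq> {}" by (auto intro!: exI[of _ "Complex 0 (- \<bar>R\<bar> - 1)"])
        show "k holomorphic_on {w. Im w < 0}"
          by (rule holomorphic_on_subset[OF hol]) (use nE in auto)
        show "k w = 0" if "w \<in> {w. Im w < - \<bar>R\<bar>}" for w
          using that by (intro R big) auto
      qed (use 2 in \<open>auto intro: open_halfspace_Im_lt convex_connected convex_halfspace_Im_lt\<close>)
    qed
  qed
  show ?thesis
  proof (cases "Im z = 0")
    case True
    have "isCont k z"
      using holomorphic_on_imp_continuous_on[OF hol] open_complement z continuous_on_eq_continuous_at by blast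
    moreover have "(\<lambda>n. z + \<i> * of_real (inverse (real (Suc n)))) \<longlonglongrightarrow> z + \<i> * of_real 0"
      by (intro tendsto_intros LIMSEQ_inverse_real_of_nat)
    ultimately have "(\<lambda>n. k (z + \<i> * of_real (inverse (real (Suc n))))) \<longlonglongrightarrow> k z"
      using isCont_tendsto_compose[of z k] by simp
    moreover have "k (z + \<i> * of_real (inverse (real (Suc n)))) = 0" for n
      using True by (intro half) simp
    ultimately show ?thesis by (simp add: LIMSEQ_const_iff)
  qed (rule half)
qed

text \<open>Let \<open>f\<close> be the mean and \<open>k\<close> half the difference of two extremal functions. Then
  \<open>\<bar>f\<bar> + \<bar>k\<bar>\<^sup>2 / 2 \<le> 1\<close>. If \<open>k\<close> had a zero of finite order \<open>n\<close> at infinity, then the function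
  \<open>f + \<epsilon> c z\<^bsup>2n-1\<^esup> k\<^sup>2 / 2\<close> with a suitable unimodular \<open>c\<close> and a small \<open>\<epsilon> > 0\<close> would still be admissible, and
  its leading coefficient would be larger.\<close>

lemma extremal_unique:
  assumes adm: "ahlfors_admissible E f1" "ahlfors_admissible E f2"
    and lim: "((\<lambda>z. z * f1 z) \<longlongrightarrow> of_real L) at_infinity" "((\<lambda>z. z * f2 z) \<longlongrightarrow> of_real L) at_infinity"
    and L: "L > 0"
    and max: "\<And>f M. ahlfors_admissible E f \<Longrightarrow> ((\<lambda>z. z * f z) \<longlongrightarrow> M) at_infinity \<Longrightarrow> cmod M \<le> L"
    and z: "z \<notin> of_real ` E"
  shows "f1 z = f2 z"
proof -
  define f where "f z = (f1 z + f2 z) / 2" for z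
  define k where "k z = (f1 z - f2 z) / 2" for z
  have hol: "f1 holomorphic_on - of_real ` E" "f2 holomorphic_on - of_real ` E"
    and le: "\<And>z. z \<notin> of_real ` E \<Longrightarrow> cmod (f1 z) \<le> 1" "\<And>z. z \<notin> of_real ` E \<Longrightarrow> cmod (f2 z) \<le> 1"
    using adm by (auto simp: ahlfors_admissible_def)
  have fhol: "f holomorphic_on - of_real ` E" and khol: "k holomorphic_on - of_real ` E"
    unfolding f_def[abs_def] k_def[abs_def] by (auto intro!: holomorphic_intros hol)
  have fk: "cmod (f z) + (cmod (k z))\<^sup>2 / 2 \<le> 1" if "z \<notin> of_real ` E" for z
  proof -
    have "(cmod (f z))\<^sup>2 + (cmod (k z))\<^sup>2 = ((cmod (f1 z))\<^sup>2 + (cmod (f2 z))\<^sup>2) / 2"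
      unfolding f_def k_def cmod_power2 by (simp add: power2_eq_square field_simps)
    also have "\<dots> \<le> 1"
      using power_mono[OF le(1)[OF that], of 2] power_mono[OF le(2)[OF that], of 2] by simp
    finally have sq: "(cmod (f z))\<^sup>2 + (cmod (k z))\<^sup>2 \<le> 1" .
    have "(1 - (cmod (k z))\<^sup>2 / 2)\<^sup>2 = 1 - (cmod (k z))\<^sup>2 + ((cmod (k z))\<^sup>2 / 2)\<^sup>2"
      by (simp add: power2_diff)
    then have "(cmod (f z))\<^sup>2 \<le> (1 - (cmod (k z))\<^sup>2 / 2)\<^sup>2"
      using sq zero_le_power2[of "(cmod (k z))\<^sup>2 / 2"] by linarith
    moreover have "0 \<le> 1 - (cmod (k z))\<^sup>2 / 2"
      using sq zero_le_power2[of "cmod (f z)"] zero_le_power2[of "cmod (k z)"] by linarith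
    ultimately have "cmod (f z) \<le> 1 - (cmod (k z))\<^sup>2 / 2"
      by (rule power2_le_imp_le)
    then show ?thesis by simp
  qed
  have flim: "((\<lambda>z. z * f z) \<longlongrightarrow> of_real L) at_infinity"
  proof -
    have "((\<lambda>z. (z * f1 z + z * f2 z) / 2) \<longlongrightarrow> (of_real L + of_real L) / 2) at_infinity"
      by (intro tendsto_intros lim) simp
    then show ?thesis by (simp add: f_def distrib_left)
  qed
  have "((\<lambda>z. (z * f1 z - z * f2 z) / 2) \<longlongrightarrow> (of_real L - of_real L) / 2) at_infinity"
    by (intro tendsto_intros lim) simp
  then have "((\<lambda>z. z * (k z - 0)) \<longlongrightarrow> 0) at_infinity" by (simp add: k_def right_diff_distrib)
  from tendsto_over_at_infinity[OF this] have k0: "(k \<longlongrightarrow> 0) at_infinity" .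
  have f0: "(f \<longlongrightarrow> 0) at_infinity"
    using tendsto_over_at_infinity[of f 0] flim by auto
  obtain R0 where R0: "R0 > 0" "\<And>z. cmod z \<ge> R0 \<Longrightarrow> z \<notin> complex_of_real ` E"
    using complement_near_infinity by blast
  \<comment> \<open>The function \<open>k\<close> in the coordinate \<open>1 / z\<close> at infinity.\<close>
  define K where "K w = (if w = 0 then 0 else k (inverse w))" for w
  define D where "D = ball (0::complex) (1 / R0)"
  have D: "open D" "connected D" "0 \<in> D" using R0(1) by (auto simp: D_def)
  have "K holomorphic_on D"
  proof (rule no_isolated_singularity'[where K = "{0}"])
    show "(K \<longlongrightarrow> K w) (at w within D)" if "w \<in> {0}" for w
    proof -
      have "((\<lambda>w. k (inverse w)) \<longlongrightarrow> 0) (at 0 within D)"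
        by (rule tendsto_within_subset[OF filterlim_compose[OF k0 filterlim_inverse_at_infinity]]) simp
      moreover have "eventually (\<lambda>w. k (inverse w) = K w) (at 0 within D)"
        by (auto simp: eventually_at K_def intro!: exI[of _ 1])
      ultimately show ?thesis
        using that Lim_transform_eventually by (force simp: K_def)
    qed
    have "k \<circ> inverse holomorphic_on D - {0}"
    proof (rule holomorphic_on_compose)
      show "inverse holomorphic_on D - {0}" by (intro holomorphic_intros) auto
      show "k holomorphic_on inverse ` (D - {0})"
      proof (rule holomorphic_on_subset[OF khol], clarify)
        fix w x assume w: "w \<in> D" "w \<noteq> 0" "inverse w = complex_of_real x" "x \<in> E"
        have "cmod (inverse w) \<ge> R0"
        proof -
          have "cmod w > 0" "R0 * cmod w < 1" using w(1,2) R0(1) by (auto simp: D_def field_simps)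
          then show ?thesis unfolding norm_inverse by (simp add: inverse_eq_divide pos_le_divide_eq)
        qed
        then show False using R0(2) w by blast
      qed
    qed
    then show "K holomorphic_on D - {0}"
      by (rule holomorphic_transform) (auto simp: K_def)
  qed (use D in auto)
  have "K constant_on D"
  proof (rule ccontr)
    assume nonconst: "\<not> K constant_on D"
    have "K 0 = 0" by (simp add: K_def)
    then obtain G r n where n: "0 < n" and r: "0 < r" "ball 0 r \<subseteq> D" and Ghol: "G holomorphic_on ball 0 r"
      and KG: "\<And>w. w \<in> ball 0 r \<Longrightarrow> K w = (w - 0) ^ n * G w" and Gnz: "\<And>w. w \<in> ball 0 r \<Longrightarrow> G w \<noteq> 0"
      using holomorphic_factor_zero_nonconstant[OF \<open>K holomorphic_on D\<close> D _ nonconst] by metis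
    have Gcont: "isCont G 0"
      using holomorphic_on_imp_continuous_on[OF Ghol] r(1) continuous_on_eq_continuous_at[of "ball 0 r" G] by auto
    define B where "B = cmod (G 0) + 1"
    have B: "B \<ge> 1" by (simp add: B_def)
    obtain \<rho> where \<rho>: "\<rho> > 0" "\<And>w. cmod w < \<rho> \<Longrightarrow> cmod (G w) \<le> B"
    proof -
      obtain d where d: "d > 0" "\<And>w. dist w 0 < d \<Longrightarrow> dist (G w) (G 0) < 1"
        using Gcont unfolding continuous_at_eps_delta by (metis zero_less_one)
      have "cmod (G w) \<le> B" if "cmod w < d" for w
        using norm_triangle_ineq[of "G w - G 0" "G 0"] d(2)[of w] that by (simp add: dist_norm B_def)
      then show ?thesis using that d(1) by blast
    qed
    have "eventually (\<lambda>z. cmod (f z) < 1 / 2) at_infinity"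
      using tendsto_norm[OF f0] by (rule order_tendstoD) simp
    then obtain R1 where R1: "\<And>z. cmod z \<ge> R1 \<Longrightarrow> cmod (f z) < 1 / 2"
      by (auto simp: eventually_at_infinity)
    define R where "R = Max {R0, R1, 1, 2 / \<rho>, 2 / r}"
    have Rge: "R \<ge> R0" "R \<ge> R1" "R \<ge> 1" "R \<ge> 2 / \<rho>" "R \<ge> 2 / r" by (simp_all add: R_def)
    have far: "cmod (inverse z) < \<rho>" "cmod (inverse z) < r" "z \<noteq> 0" if "cmod z \<ge> R" for z
    proof -
      have "cmod z \<ge> 2 / \<rho>" "cmod z \<ge> 2 / r" "cmod z \<ge> 1" using Rge that by linarith+
      then have pos: "cmod z > 0" and "2 \<le> \<rho> * cmod z" "2 \<le> r * cmod z"
        using \<rho>(1) r(1) by (auto simp: pos_divide_le_eq mult.commute)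
      then show "cmod (inverse z) < \<rho>" "cmod (inverse z) < r" "z \<noteq> 0"
        unfolding norm_inverse unfolding inverse_eq_divide by (auto simp: pos_divide_less_eq[OF pos])
    qed
    have kz: "z ^ (2 * n - 1) * (k z)\<^sup>2 = (G (inverse z))\<^sup>2 * inverse z" if "cmod z \<ge> R" for z
    proof -
      have z0: "z \<noteq> 0" using far(3)[OF that] .
      have "k z = inverse z ^ n * G (inverse z)"
        using KG[of "inverse z"] far(2)[OF that] z0 by (simp add: K_def)
      then have "z ^ (2 * n - 1) * (k z)\<^sup>2 = z ^ (2 * n - 1) * inverse z ^ (2 * n) * (G (inverse z))\<^sup>2"
        by (simp add: power_mult_distrib power_mult[symmetric] mult.commute)
      also have "2 * n = Suc (2 * n - 1)" using n by simp
      then have "inverse z ^ (2 * n) = inverse z ^ (2 * n - 1) * inverse z"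
        by (metis power_Suc2)
      finally show ?thesis using z0 by (simp add: power_mult_distrib[symmetric] mult_ac flip: mult.assoc)
    qed
    \<comment> \<open>Then \<open>c\<close> has modulus 1 and \<open>c (G 0)\<^sup>2\<close> is positive.\<close>
    define c where "c = cnj (sgn ((G 0)\<^sup>2))"
    have G0: "G 0 \<noteq> 0" using Gnz r by simp
    have c: "cmod c = 1" "c * (G 0)\<^sup>2 = of_real ((cmod (G 0))\<^sup>2)"
    proof -
      show "cmod c = 1" using G0 by (simp add: c_def norm_sgn)
      show "c * (G 0)\<^sup>2 = of_real ((cmod (G 0))\<^sup>2)"
        by (simp add: c_def cnj_sgn_mult norm_power)
    qed
    define \<epsilon> where "\<epsilon> = min (1 / R ^ (2 * n - 1)) (1 / B\<^sup>2)"
    have eps: "\<epsilon> > 0" "\<epsilon> * R ^ (2 * n - 1) \<le> 1" "\<epsilon> * B\<^sup>2 \<le> 1"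
    proof -
      have "R ^ (2 * n - 1) > 0" "B\<^sup>2 > 0" using Rge B by auto
      then show "\<epsilon> > 0" "\<epsilon> * R ^ (2 * n - 1) \<le> 1" "\<epsilon> * B\<^sup>2 \<le> 1"
        by (auto simp: \<epsilon>_def min_def field_simps)
    qed
    define F where "F z = f z + of_real \<epsilon> * c * (z ^ (2 * n - 1) * (k z)\<^sup>2) / 2" for z
    have "cmod (F z) \<le> 1" if z: "z \<notin> of_real ` E" for z
    proof -
      have tri: "cmod (F z) \<le> cmod (f z) + \<epsilon> * cmod (z ^ (2 * n - 1) * (k z)\<^sup>2) / 2"
        unfolding F_def using eps(1) c(1)
        by (intro order.trans[OF norm_triangle_ineq]) (simp add: norm_mult norm_divide)
      show ?thesis
      proof (cases "cmod z \<ge> R")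
        case True
        have "cmod (inverse z) \<le> 1"
          using True Rge(3) far(3)[OF True] unfolding norm_inverse by (simp add: field_simps)
        then have "cmod (z ^ (2 * n - 1) * (k z)\<^sup>2) \<le> B\<^sup>2 * 1"
          unfolding kz[OF True] norm_mult norm_power using \<rho>(2)[OF far(1)[OF True]]
          by (intro mult_mono power_mono) auto
        then have "\<epsilon> * cmod (z ^ (2 * n - 1) * (k z)\<^sup>2) \<le> \<epsilon> * B\<^sup>2"
          using eps(1) by simp
        moreover have "cmod (f z) < 1 / 2" using R1 True Rge(2) by simp
        ultimately show ?thesis using tri eps(3) by linarith
      next
        case False
        have "\<epsilon> * cmod (z ^ (2 * n - 1) * (k z)\<^sup>2) = (\<epsilon> * cmod z ^ (2 * n - 1)) * (cmod (k z))\<^sup>2"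
          by (simp add: norm_mult norm_power)
        also have "\<dots> \<le> (\<epsilon> * R ^ (2 * n - 1)) * (cmod (k z))\<^sup>2"
          using False eps(1) by (intro mult_right_mono mult_left_mono power_mono) auto
        also have "\<dots> \<le> 1 * (cmod (k z))\<^sup>2"
          using eps(2) by (intro mult_right_mono) auto
        finally show ?thesis using tri fk[OF z] by simp
      qed
    qed
    moreover have "F holomorphic_on - of_real ` E"
      unfolding F_def[abs_def] by (intro holomorphic_intros fhol khol) auto
    moreover have Flim: "((\<lambda>z. z * F z) \<longlongrightarrow> of_real (L + \<epsilon> * (cmod (G 0))\<^sup>2 / 2)) at_infinity"
    proof -
      have "((\<lambda>z. G (inverse z)) \<longlongrightarrow> G 0) at_infinity"
        by (rule isCont_tendsto_compose[OF Gcont tendsto_inverse_0])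
      then have "((\<lambda>z. z * f z + of_real \<epsilon> * c * (G (inverse z))\<^sup>2 / 2) \<longlongrightarrow>
          of_real L + of_real \<epsilon> * c * (G 0)\<^sup>2 / 2) at_infinity"
        by (intro tendsto_intros flim) auto
      moreover have "eventually (\<lambda>z. z * f z + of_real \<epsilon> * c * (G (inverse z))\<^sup>2 / 2 = z * F z) at_infinity"
        unfolding eventually_at_infinity
      proof (intro exI[of _ R] allI impI)
        fix z assume z: "cmod z \<ge> R"
        have "z * F z = z * f z + of_real \<epsilon> * c * ((G (inverse z))\<^sup>2 * (inverse z * z)) / 2"
          unfolding F_def kz[OF z] by (simp add: algebra_simps)
        then show "z * f z + of_real \<epsilon> * c * (G (inverse z))\<^sup>2 / 2 = z * F z"
          using far(3)[OF z] by simp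
      qed
      ultimately have "((\<lambda>z. z * F z) \<longlongrightarrow> of_real L + of_real \<epsilon> * c * (G 0)\<^sup>2 / 2) at_infinity"
        by (rule Lim_transform_eventually)
      moreover have "of_real \<epsilon> * c * (G 0)\<^sup>2 = of_real (\<epsilon> * (cmod (G 0))\<^sup>2)"
        using c(2) by (simp add: mult.assoc)
      ultimately show ?thesis by simp
    qed
    moreover have "(F \<longlongrightarrow> 0) at_infinity"
      using tendsto_over_at_infinity[of F 0] Flim by auto
    ultimately have "ahlfors_admissible E F" by (simp add: ahlfors_admissible_def)
    from max[OF this Flim] have "\<bar>L + \<epsilon> * (cmod (G 0))\<^sup>2 / 2\<bar> \<le> L"
      by (simp only: norm_of_real)
    moreover have "\<epsilon> * (cmod (G 0))\<^sup>2 > 0" using eps(1) G0 by simp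
    ultimately show False by linarith
  qed
  then obtain y where "\<And>w. w \<in> D \<Longrightarrow> K w = y" by (auto simp only: constant_on_def)
  moreover have "K 0 = 0" by (simp add: K_def)
  ultimately have Kz: "K w = 0" if "w \<in> D" for w
    using that D(3) by metis
  have "k z = 0" if "cmod z > R0" for z
  proof -
    have "inverse z \<in> D" "inverse z \<noteq> 0"
      using that R0(1) by (auto simp: D_def norm_divide inverse_eq_divide divide_less_eq)
    then show ?thesis using Kz[of "inverse z"] by (simp add: K_def)
  qed
  from vanishes_near_infinity_imp_zero[OF khol this z] show ?thesis by (simp add: k_def)
qed

theorem ahlfors_function_unique:
  assumes "ahlfors_function E \<Psi>" "z \<notin> of_real ` E"
  shows "\<Psi> z = ahlfors_formula z"
proof -
  obtain L :: real where adm: "ahlfors_admissible E \<Psi>" and L: "L > 0"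
    and lim: "((\<lambda>z. z * \<Psi> z) \<longlongrightarrow> of_real L) at_infinity"
    and max: "\<And>f M. ahlfors_admissible E f \<Longrightarrow> ((\<lambda>z. z * f z) \<longlongrightarrow> M) at_infinity \<Longrightarrow> cmod M \<le> L"
    using assms(1) unfolding ahlfors_function_def by blast
  have "cmod (of_real (total_length / 4)) \<le> L"
    by (rule max[OF ahlfors_formula_admissible ahlfors_formula_asymptotics])
  moreover have "cmod (of_real L) \<le> total_length / 4"
    by (rule admissible_bound[OF adm lim])
  ultimately have "L = total_length / 4"
    unfolding norm_of_real by linarith
  then have lim': "((\<lambda>z. z * ahlfors_formula z) \<longlongrightarrow> of_real L) at_infinity"
    using ahlfors_formula_asymptotics by (simp only:)
  show ?thesis
    by (rule extremal_unique[OF adm ahlfors_formula_admissible lim lim' L _ assms(2)]) (rule max)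
qed

end

section \<open>The bands determine the coefficients\<close>

context bands
begin

lemma right_of_band: "j \<le> g \<Longrightarrow> \<exists>d>0. \<forall>h. 0 < h \<longrightarrow> h < d \<longrightarrow> \<alpha> j + h \<notin> E"
proof -
  assume j: "j \<le> g"
  \<comment> \<open>The length of the gap; to the right of the last band any positive number will do.\<close>
  define d where "d = (if j < g then \<beta> (Suc j) - \<alpha> j else 1)"
  have "\<alpha> j + h \<notin> E" if h: "0 < h" "h < d" for h
  proof
    assume "\<alpha> j + h \<in> E"
    then obtain i where i: "i \<le> g" "\<beta> i \<le> \<alpha> j + h" "\<alpha> j + h \<le> \<alpha> i" by (auto simp: E)
    show False
    proof (cases "i \<le> j")
      case True
      then have "\<alpha> i \<le> \<alpha> j" using alpha_strict[of i j] j by (cases "i = j") auto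
      then show False using i h by simp
    next
      case False
      then have "j < g" "\<beta> (Suc j) \<le> \<beta> i" using beta_mono[of "Suc j" i] i by auto
      then show False using i h by (simp add: d_def)
    qed
  qed
  moreover have "d > 0" using gap by (simp add: d_def)
  ultimately show ?thesis by blast
qed

lemma left_of_bands:
  assumes "x < \<beta> 0" shows "x \<notin> E"
proof
  assume "x \<in> E"
  then obtain j where "j \<le> g" "\<beta> j \<le> x" by (auto simp: E)
  then show False using beta_mono[of 0 j] assms by simp
qed

text \<open>To the right of a band the value leaves \<open>[-2, 2]\<close>; as the function increases, the value at the right edge
  is 2. The left edge of the first band is treated in the same way.\<close>

lemma rational_fun_at_edges:
  assumes pos: "l0 > 0" "\<And>j. j < length C \<Longrightarrow> l j > 0"
    and Eq: "E = {x. x \<notin> set C \<and> \<bar>rational_fun l0 c0 l C x\<bar> \<le> 2}"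
  shows "j \<le> g \<Longrightarrow> rational_fun l0 c0 l C (\<alpha> j) = 2" "rational_fun l0 c0 l C (\<beta> 0) = - 2"
proof -
  let ?t = "rational_fun l0 c0 l C"
  show "?t (\<alpha> j) = 2" if j: "j \<le> g"
  proof (rule ccontr)
    assume ne: "?t (\<alpha> j) \<noteq> 2"
    have mem: "\<alpha> j \<notin> set C" "\<bar>?t (\<alpha> j)\<bar> \<le> 2" using endpoints_in_E(1)[OF j] Eq by auto
    with ne have lt: "2 - ?t (\<alpha> j) > 0" by auto
    obtain d where d: "d > 0" "\<And>h. 0 < h \<Longrightarrow> h < d \<Longrightarrow> ?t (\<alpha> j) < ?t (\<alpha> j + h)"
      "\<And>h. 0 < h \<Longrightarrow> h < d \<Longrightarrow> ?t (\<alpha> j - h) < ?t (\<alpha> j)"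
      using rational_fun_increasing[where ?c0.0 = c0 and l = l, OF pos mem(1)] by blast
    obtain d' where d': "d' > 0" "\<And>y. \<bar>y - \<alpha> j\<bar> < d' \<Longrightarrow> y \<notin> set C \<and> \<bar>?t y - ?t (\<alpha> j)\<bar> < 2 - ?t (\<alpha> j)"
      using rational_fun_near[where ?l0.0 = l0 and ?c0.0 = c0 and l = l, OF mem(1) lt] by blast
    obtain d'' where d'': "d'' > 0" "\<And>h. 0 < h \<Longrightarrow> h < d'' \<Longrightarrow> \<alpha> j + h \<notin> E"
      using right_of_band[OF j] by blast
    define h where "h = min d (min d' d'') / 2"
    have h: "0 < h" "h < d" "h < d'" "h < d''" using d d' d'' by (auto simp: h_def min_def)
    have "?t (\<alpha> j) < ?t (\<alpha> j + h)" "\<alpha> j + h \<notin> set C" "?t (\<alpha> j + h) < 2"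
      using d(2)[of h] d'(2)[of "\<alpha> j + h"] h by auto
    then have "\<alpha> j + h \<in> E" using mem(2) unfolding Eq by auto
    then show False using d''(2) h by blast
  qed
  show "?t (\<beta> 0) = - 2"
  proof (rule ccontr)
    assume ne: "?t (\<beta> 0) \<noteq> - 2"
    have mem: "\<beta> 0 \<notin> set C" "\<bar>?t (\<beta> 0)\<bar> \<le> 2" using endpoints_in_E(2)[of 0] Eq by auto
    with ne have lt: "2 + ?t (\<beta> 0) > 0" by auto
    obtain d where d: "d > 0" "\<And>h. 0 < h \<Longrightarrow> h < d \<Longrightarrow> ?t (\<beta> 0) < ?t (\<beta> 0 + h)"
      "\<And>h. 0 < h \<Longrightarrow> h < d \<Longrightarrow> ?t (\<beta> 0 - h) < ?t (\<beta> 0)"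
      using rational_fun_increasing[where ?c0.0 = c0 and l = l, OF pos mem(1)] by blast
    obtain d' where d': "d' > 0" "\<And>y. \<bar>y - \<beta> 0\<bar> < d' \<Longrightarrow> y \<notin> set C \<and> \<bar>?t y - ?t (\<beta> 0)\<bar> < 2 + ?t (\<beta> 0)"
      using rational_fun_near[where ?l0.0 = l0 and ?c0.0 = c0 and l = l, OF mem(1) lt] by blast
    define h where "h = min d d' / 2"
    have h: "0 < h" "h < d" "h < d'" using d d' by (auto simp: h_def min_def)
    have "?t (\<beta> 0 - h) < ?t (\<beta> 0)" "\<beta> 0 - h \<notin> set C" "?t (\<beta> 0 - h) > - 2"
      using d(3)[of h] d'(2)[of "\<beta> 0 - h"] h by auto
    then have "\<beta> 0 - h \<in> E" using mem(2) unfolding Eq by auto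
    then show False using left_of_bands[of "\<beta> 0 - h"] h by simp
  qed
qed

text \<open>Two such functions agree at the \<open>g + 1\<close> right edges and at the first left edge, that is, at \<open>g + 2\<close>
  points.\<close>

lemma rational_fun_determined_by_bands:
  assumes C: "distinct C" "length C = g"
    and pos: "l0 > 0" "\<And>j. j < length C \<Longrightarrow> l j > 0" "l0' > 0" "\<And>j. j < length C \<Longrightarrow> l' j > 0"
    and Eq: "E = {x. x \<notin> set C \<and> \<bar>rational_fun l0 c0 l C x\<bar> \<le> 2}"
      "E = {x. x \<notin> set C \<and> \<bar>rational_fun l0' c0' l' C x\<bar> \<le> 2}"
  shows "l0 = l0' \<and> c0 = c0' \<and> (\<forall>j<length C. l j = l' j)"
proof (rule rational_fun_eqI[OF C(1), where X = "insert (\<beta> 0) (\<alpha> ` {..g})"])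
  have "inj_on \<alpha> {..g}"
    using alpha_strict by (intro linorder_inj_onI) (auto simp: less_imp_neq)
  then have "card (\<alpha> ` {..g}) = Suc g" by (simp add: card_image)
  moreover have "\<beta> 0 < \<alpha> j" if "j \<le> g" for j
    using band[OF that] beta_mono[of 0 j] that by simp
  then have "\<beta> 0 \<notin> \<alpha> ` {..g}" by (metis atMost_iff image_iff less_irrefl)
  ultimately show "card (insert (\<beta> 0) (\<alpha> ` {..g})) \<ge> length C + 2" by (simp add: C)
  show "insert (\<beta> 0) (\<alpha> ` {..g}) \<inter> set C = {}"
    using endpoints_in_E Eq(1) by auto
  show "rational_fun l0 c0 l C x = rational_fun l0' c0' l' C x" if "x \<in> insert (\<beta> 0) (\<alpha> ` {..g})" for x
    using that rational_fun_at_edges[where C = C, OF pos(1,2) Eq(1)] rational_fun_at_edges[where C = C, OF pos(3,4) Eq(2)]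
    by auto
qed simp

text \<open>The expansion is unique, since two expansions agree at all reals to the left of \<open>E\<close>.\<close>

lemma Delta_coeffs_eq:
  assumes C: "distinct C"
    and D: "\<And>z. z \<notin> of_real ` E \<Longrightarrow> z \<notin> finite_zeros E \<Psi> \<Longrightarrow> Delta \<Psi> z = rational_fun l0 c0 l C z"
    and zeros: "of_real ` set C = finite_zeros E \<Psi>"
  shows "Delta_coeffs E \<Psi> C = (l0, c0, map l [0..<length C])"
  unfolding Delta_coeffs_def
proof (rule the_equality)
  show "is_Delta_expansion E \<Psi> C (l0, c0, map l [0..<length C])"
    using D by (simp add: is_Delta_expansion_def rational_fun_def)
  fix cs assume cs: "is_Delta_expansion E \<Psi> C cs"
  obtain m0 d0 m where cs_eq: "cs = (m0, d0, m)" by (cases cs)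
  have len: "length m = length C"
    and m: "\<And>z. z \<notin> of_real ` E \<Longrightarrow> z \<notin> finite_zeros E \<Psi> \<Longrightarrow> Delta \<Psi> z = rational_fun m0 d0 (\<lambda>j. m ! j) C z"
    using cs by (auto simp: cs_eq is_Delta_expansion_def rational_fun_def)
  have "infinite ({..<\<beta> 0} - set C)" by (simp add: infinite_Iio)
  then obtain X where X: "finite X" "card X = length C + 2" "X \<subseteq> {..<\<beta> 0} - set C"
    using infinite_arbitrarily_large by blast
  have "l0 = m0 \<and> c0 = d0 \<and> (\<forall>j<length C. l j = m ! j)"
  proof (rule rational_fun_eqI[OF C X(1)])
    fix x assume x: "x \<in> X"
    have "complex_of_real x \<notin> of_real ` E" "complex_of_real x \<notin> finite_zeros E \<Psi>"
      using x X(3) left_of_bands[of x] unfolding zeros[symmetric] by auto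
    then have "rational_fun l0 c0 l C (complex_of_real x) = rational_fun m0 d0 (\<lambda>j. m ! j) C (of_real x)"
      using D m by metis
    then show "rational_fun l0 c0 l C x = rational_fun m0 d0 (\<lambda>j. m ! j) C x"
      by (simp only: rational_fun_of_real of_real_eq_iff)
  qed (use X in auto)
  then show "cs = (l0, c0, map l [0..<length C])"
    using len by (auto simp: cs_eq intro!: nth_equalityI)
qed

end

section \<open>The characterization of the isospectral class\<close>

theorem theorem1p6:
  fixes g :: nat and E :: "real set" and \<Psi> :: "complex \<Rightarrow> complex"
    and C :: "real list" and A :: "l2Z \<Rightarrow> l2Z"
  assumes "g \<ge> 1" and "finite_gap_set g E"
    and "ahlfors_function E \<Psi>"
    and "length C = g" and "distinct C" and "of_real ` set C = finite_zeros E \<Psi>"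
    and "A \<in> GMP C"
  shows "A \<in> isospectral_GMP E C \<longleftrightarrow>
    Delta_op E \<Psi> C A = (\<lambda>x. (rshift ^^ (g + 1)) x + (inv rshift ^^ (g + 1)) x)"
proof -
  obtain \<beta> \<alpha> where "bands g \<beta> \<alpha> E"
    using finite_gap_set_bands[OF assms(2)] .
  then interpret bands g \<beta> \<alpha> E .
  obtain l0 c0 l where pos: "l0 > 0" "\<And>j. j < g \<Longrightarrow> l j > 0"
    and Delta: "\<And>z. z \<notin> of_real ` E \<Longrightarrow> z \<notin> finite_zeros E \<Psi> \<Longrightarrow> Delta \<Psi> z = rational_fun l0 c0 l C z"
    and E_eq: "E = {x. x \<notin> set C \<and> \<bar>rational_fun l0 c0 l C x\<bar> \<le> 2}"
    using Delta_rational[OF ahlfors_function_unique[OF assms(3)] assms(1,4,5,6)] by metis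
  have op: "Delta_op E \<Psi> C A = rational_op l0 c0 l C A"
    by (simp add: Delta_op_def Delta_coeffs_eq[OF assms(5) Delta assms(6)] rational_op_def)
  have shift: "(\<lambda>x. (rshift ^^ (g + 1)) x + (inv rshift ^^ (g + 1)) x) = two_sided_shift (g + 1)"
    by (simp add: fun_eq_iff two_sided_shift_def)
  note gmp = assms(7,4) refl[of "g + 1"]
  show ?thesis unfolding op shift
  proof
    assume "A \<in> isospectral_GMP E C"
    then have per: "periodic_GMP C A" and spec: "op_spectrum A = of_real ` E"
      by (auto simp: isospectral_GMP_def)
    obtain m0 d0 m where m: "m0 > 0" "\<And>j. j < g \<Longrightarrow> m j > 0"
      and magic: "rational_op m0 d0 m C A = two_sided_shift (g + 1)"
      using periodic_magic_formula[OF gmp per] by metis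
    have "complex_of_real ` E = of_real ` {x. x \<notin> set C \<and> \<bar>rational_fun m0 d0 m C x\<bar> \<le> 2}"
      using spectrum_of_magic_formula[OF gmp magic m] spec by simp
    then have "E = {x. x \<notin> set C \<and> \<bar>rational_fun m0 d0 m C x\<bar> \<le> 2}"
      by (simp only: inj_image_eq_iff[OF inj_of_real])
    then have "l0 = m0 \<and> c0 = d0 \<and> (\<forall>j<length C. l j = m j)"
      using pos m assms(4) by (intro rational_fun_determined_by_bands[OF assms(5,4) _ _ _ _ E_eq]) auto
    then have "rational_op l0 c0 l C A = rational_op m0 d0 m C A"
      by (simp add: rational_op_def)
    then show "rational_op l0 c0 l C A = two_sided_shift (g + 1)"
      by (simp only: magic)
  next
    assume magic: "rational_op l0 c0 l C A = two_sided_shift (g + 1)"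
    have "op_spectrum A = of_real ` E"
      using spectrum_of_magic_formula[OF gmp magic pos] E_eq by simp
    then show "A \<in> isospectral_GMP E C"
      using magic_formula_periodic(1)[OF gmp magic] assms(7) by (simp add: isospectral_GMP_def)
  qed
qed

end
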